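(* Let $C$ be a strict symmetric bimonoidal category. Then the matrix construction $\mathsf{Mat}^C$, with the multiplication $\odot$, unit $1$ and Gray symmetry $\beta$ described in the context, is a permutative Gray monoid.
   Context: A symmetric bimonoidal category is strict if its additive and multiplicative structures are both permutative (symmetric strict monoidal) categories and $\zeta^\oplus$, $\delta^l$, $\delta^r$, $\lambda^\bullet$, $\rho^\bullet$ are identities. Explicitly, it is a category $C$ with permutative structures $(\oplus,0)$, having identity symmetry $\zeta^\oplus$ (so $A\oplus B=B\oplus A$ naturally), and $(\otimes,1,\zeta^\otimes)$, such that, on objects and morphisms, $0\otimes A=0=A\otimes 0$, $A\otimes(B\oplus C)=(A\otimes B)\oplus(A\otimes C)$, $(A\oplus B)\otimes C=(A\otimes C)\oplus(B\otimes C)$, and such that $\zeta^\otimes_{A\oplus B,C}=\zeta^\otimes_{A,C}\oplus\zeta^\otimes_{B,C}$ and $\zeta^\otimes_{A,0}=1_0$. $\mathsf{Mat}^C$ is the 2-category with objects the integers $m\ge0$; 1-cells (2-cells) $m\to n$ the $n\times m$ matrices of objects (morphisms) of $C$, with entrywise vertical composition; horizontal composition the matrix product $(BA)_{ki}=\bigoplus_j B_{kj}\otimes A_{ji}$; identity 1-cells the matrices $\mathbb 1^n$ with $1$ on the diagonal and $0$ elsewhere. The matrix tensor product $A\boxtimes B$ is the block matrix with $(j,i)$ block $(A_{ji}\otimes B_{lk})_{l,k}$. The category $\mathsf{Gray}$ is the category of small 2-categories and 2-functors, with the Gray tensor product in its pseudo version. For 2-categories $X,Y$, the 2-category $X\otimes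 Y$ has objects $(x,y)$, is generated by 1-cells $f\otimes y$ and $x\otimes g$ and 2-cells $\alpha\otimes y$, $x\otimes\alpha'$, functorially in each variable separately, and has invertible transition 2-cells $\Sigma_{f,g}:(f\otimes y')(x\otimes g)\cong(x'\otimes g)(f\otimes y)$ for $f:x\to x'$, $g:y\to y'$, satisfying the usual compatibility relations. A Gray monoid $(M,\odot,I)$ is a monoid in $\mathsf{Gray}$. A permutative Gray monoid is a Gray monoid with a Gray symmetry: a 2-natural isomorphism $\beta:\odot\Rightarrow\odot\circ\tau$ of 2-functors $M\otimes M\to M$, where $\tau$ is the symmetry of the Gray tensor product (sending $\Sigma_{f,g}$ to $\Sigma_{g,f}^{-1}$), such that $\beta_{I,x}=1_x$ (unit axiom), $\beta_{y,x}\beta_{x,y}=1$ (symmetry axiom) and $\beta_{x,y\odot z}=(y\odot\beta_{x,z})(\beta_{x,y}\odot z)$ (hexagon axiom), for all objects $x,y,z$. On $\mathsf{Mat}^C$: $I=1$, $m\odot n=mn$, $A\odot n=A\boxtimes\mathbb 1^n$ and $m\odot B=\mathbb 1^m\boxtimes B$ (similarly on 2-cells); for 1-cells $A$ and $B$ the transition 2-cell $\Sigma_{A,B}$ from $(A\boxtimes\mathbb 1)(\mathbb 1\boxtimes B)$ to $(\mathbb 1\boxtimes B)(A\boxtimes\mathbb 1)$ has entries the symmetries $\zeta^\otimes_{A_{ji},B_{lk}}$; and $\beta_{m,n}:mn\to nm$ is the permutation matrix (entries $1$ and $0$) of the permutation transposing the two indices. As usual, size conventions are such that $\mathsf{Mat}^C$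 is an object of $\mathsf{Gray}$ (e.g. $C$ small). *)

theory Defs
  imports "Jordan_Normal_Form.Matrix"
begin

section \<open>Strict symmetric bimonoidal categories\<close>

locale category =
  fixes Ob :: "'o set" and Ar :: "'a set"
    and dm cd :: "'a \<Rightarrow> 'o" and ide :: "'o \<Rightarrow> 'a" and cmp :: "'a \<Rightarrow> 'a \<Rightarrow> 'a"
  assumes dm_closed: "f \<in> Ar \<Longrightarrow> dm f \<in> Ob"
    and cd_closed: "f \<in> Ar \<Longrightarrow> cd f \<in> Ob"
    and ide_closed: "A \<in> Ob \<Longrightarrow> ide A \<in> Ar"
    and dm_ide: "A \<in> Ob \<Longrightarrow> dm (ide A) = A"
    and cd_ide: "A \<in> Ob \<Longrightarrow> cd (ide A) = A"
    and cmp_closed: "\<lbrakk>f \<in> Ar; g \<in> Ar; dm g = cd f\<rbrakk> \<Longrightarrow> cmp g f \<in> Ar"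
    and dm_cmp: "\<lbrakk>f \<in> Ar; g \<in> Ar; dm g = cd f\<rbrakk> \<Longrightarrow> dm (cmp g f) = dm f"
    and cd_cmp: "\<lbrakk>f \<in> Ar; g \<in> Ar; dm g = cd f\<rbrakk> \<Longrightarrow> cd (cmp g f) = cd g"
    and cmp_ide_right: "f \<in> Ar \<Longrightarrow> cmp f (ide (dm f)) = f"
    and cmp_ide_left: "f \<in> Ar \<Longrightarrow> cmp (ide (cd f)) f = f"
    and cmp_assoc: "\<lbrakk>f \<in> Ar; g \<in> Ar; h \<in> Ar; dm g = cd f; dm h = cd g\<rbrakk>
                     \<Longrightarrow> cmp h (cmp g f) = cmp (cmp h g) f"

locale permutative_category = category Ob Ar dm cd ide cmp
  for Ob :: "'o set" and Ar :: "'a set"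
    and dm cd :: "'a \<Rightarrow> 'o" and ide :: "'o \<Rightarrow> 'a" and cmp :: "'a \<Rightarrow> 'a \<Rightarrow> 'a" +
  fixes tens0 :: "'o \<Rightarrow> 'o \<Rightarrow> 'o" and tens1 :: "'a \<Rightarrow> 'a \<Rightarrow> 'a"
    and e :: 'o and sym :: "'o \<Rightarrow> 'o \<Rightarrow> 'a"
  assumes tens0_closed: "\<lbrakk>A \<in> Ob; B \<in> Ob\<rbrakk> \<Longrightarrow> tens0 A B \<in> Ob"
    and tens1_closed: "\<lbrakk>f \<in> Ar; g \<in> Ar\<rbrakk> \<Longrightarrow> tens1 f g \<in> Ar"
    and dm_tens1: "\<lbrakk>f \<in> Ar; g \<in> Ar\<rbrakk> \<Longrightarrow> dm (tens1 f g) = tens0 (dm f) (dm g)"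
    and cd_tens1: "\<lbrakk>f \<in> Ar; g \<in> Ar\<rbrakk> \<Longrightarrow> cd (tens1 f g) = tens0 (cd f) (cd g)"
    and tens1_ide: "\<lbrakk>A \<in> Ob; B \<in> Ob\<rbrakk> \<Longrightarrow> tens1 (ide A) (ide B) = ide (tens0 A B)"
    and tens1_cmp: "\<lbrakk>f \<in> Ar; f' \<in> Ar; g \<in> Ar; g' \<in> Ar; dm f' = cd f; dm g' = cd g\<rbrakk>
          \<Longrightarrow> tens1 (cmp f' f) (cmp g' g) = cmp (tens1 f' g') (tens1 f g)"
    and e_closed: "e \<in> Ob"
    and tens0_assoc: "\<lbrakk>A \<in> Ob; B \<in> Ob; D \<in> Ob\<rbrakk>
          \<Longrightarrow> tens0 (tens0 A B) D = tens0 A (tens0 B D)"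
    and tens1_assoc: "\<lbrakk>f \<in> Ar; g \<in> Ar; h \<in> Ar\<rbrakk>
          \<Longrightarrow> tens1 (tens1 f g) h = tens1 f (tens1 g h)"
    and tens0_e_left: "A \<in> Ob \<Longrightarrow> tens0 e A = A"
    and tens0_e_right: "A \<in> Ob \<Longrightarrow> tens0 A e = A"
    and tens1_e_left: "f \<in> Ar \<Longrightarrow> tens1 (ide e) f = f"
    and tens1_e_right: "f \<in> Ar \<Longrightarrow> tens1 f (ide e) = f"
    and sym_closed: "\<lbrakk>A \<in> Ob; B \<in> Ob\<rbrakk> \<Longrightarrow> sym A B \<in> Ar"
    and dm_sym: "\<lbrakk>A \<in> Ob; B \<in> Ob\<rbrakk> \<Longrightarrow> dm (sym A B) = tens0 A B"
    and cd_sym: "\<lbrakk>A \<in> Ob; B \<in> Ob\<rbrakk> \<Longrightarrow> cd (sym A B) = tens0 B A"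
    and sym_natural: "\<lbrakk>f \<in> Ar; g \<in> Ar\<rbrakk>
          \<Longrightarrow> cmp (sym (cd f) (cd g)) (tens1 f g) = cmp (tens1 g f) (sym (dm f) (dm g))"
    and sym_e: "A \<in> Ob \<Longrightarrow> sym A e = ide A"
    and sym_sym: "\<lbrakk>A \<in> Ob; B \<in> Ob\<rbrakk> \<Longrightarrow> cmp (sym B A) (sym A B) = ide (tens0 A B)"
    and sym_hexagon: "\<lbrakk>A \<in> Ob; B \<in> Ob; D \<in> Ob\<rbrakk>
          \<Longrightarrow> sym A (tens0 B D) = cmp (tens1 (ide B) (sym A D)) (tens1 (sym A B) (ide D))"

record ('o, 'a) bimon_cat =
  Ob :: "'o set"
  Ar :: "'a set"
  dm :: "'a \<Rightarrow> 'o"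
  cd :: "'a \<Rightarrow> 'o"
  ide :: "'o \<Rightarrow> 'a"
  cmp :: "'a \<Rightarrow> 'a \<Rightarrow> 'a"
  add0 :: "'o \<Rightarrow> 'o \<Rightarrow> 'o"
  add1 :: "'a \<Rightarrow> 'a \<Rightarrow> 'a"
  zer :: 'o
  mul0 :: "'o \<Rightarrow> 'o \<Rightarrow> 'o"
  mul1 :: "'a \<Rightarrow> 'a \<Rightarrow> 'a"
  uni :: 'o
  zeta :: "'o \<Rightarrow> 'o \<Rightarrow> 'a"  \<comment> \<open>the multiplicative symmetry; the additive one is the identity\<close>

locale strict_symmetric_bimonoidal_category =
  fixes C :: "('o, 'a) bimon_cat"
  assumes additive:
      "permutative_category (Ob C) (Ar C) (dm C) (cd C) (ide C) (cmp C)
         (add0 C) (add1 C) (zer C) (\<lambda>A B. ide C (add0 C A B))"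
    and multiplicative:
      "permutative_category (Ob C) (Ar C) (dm C) (cd C) (ide C) (cmp C)
         (mul0 C) (mul1 C) (uni C) (zeta C)"
    and zer_mul0: "A \<in> Ob C \<Longrightarrow> mul0 C (zer C) A = zer C"
    and mul0_zer: "A \<in> Ob C \<Longrightarrow> mul0 C A (zer C) = zer C"
    and zer_mul1: "f \<in> Ar C \<Longrightarrow> mul1 C (ide C (zer C)) f = ide C (zer C)"
    and mul1_zer: "f \<in> Ar C \<Longrightarrow> mul1 C f (ide C (zer C)) = ide C (zer C)"
    and distrib_left0: "\<lbrakk>A \<in> Ob C; B \<in> Ob C; D \<in> Ob C\<rbrakk>
          \<Longrightarrow> mul0 C A (add0 C B D) = add0 C (mul0 C A B) (mul0 C A D)"
    and distrib_left1: "\<lbrakk>f \<in> Ar C; g \<in> Ar C; h \<in> Ar C\<rbrakk>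
          \<Longrightarrow> mul1 C f (add1 C g h) = add1 C (mul1 C f g) (mul1 C f h)"
    and distrib_right0: "\<lbrakk>A \<in> Ob C; B \<in> Ob C; D \<in> Ob C\<rbrakk>
          \<Longrightarrow> mul0 C (add0 C A B) D = add0 C (mul0 C A D) (mul0 C B D)"
    and distrib_right1: "\<lbrakk>f \<in> Ar C; g \<in> Ar C; h \<in> Ar C\<rbrakk>
          \<Longrightarrow> mul1 C (add1 C f g) h = add1 C (mul1 C f h) (mul1 C g h)"
    and zeta_add: "\<lbrakk>A \<in> Ob C; B \<in> Ob C; D \<in> Ob C\<rbrakk>
          \<Longrightarrow> zeta C (add0 C A B) D = add1 C (zeta C A D) (zeta C B D)"
    and zeta_zer: "A \<in> Ob C \<Longrightarrow> zeta C A (zer C) = ide C (zer C)"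


section \<open>Strict 2-categories, 2-functors and 2-natural transformations\<close>

record ('o, 'f, 'c) two_cat =
  cells0 :: "'o set"
  cells1 :: "'f set"
  cells2 :: "'c set"
  src1 :: "'f \<Rightarrow> 'o"
  tgt1 :: "'f \<Rightarrow> 'o"
  src2 :: "'c \<Rightarrow> 'f"
  tgt2 :: "'c \<Rightarrow> 'f"
  id1 :: "'o \<Rightarrow> 'f"
  comp1 :: "'f \<Rightarrow> 'f \<Rightarrow> 'f"
  id2 :: "'f \<Rightarrow> 'c"
  vcomp :: "'c \<Rightarrow> 'c \<Rightarrow> 'c"
  hcomp :: "'c \<Rightarrow> 'c \<Rightarrow> 'c"

text \<open>All compositions are written in applicative order: \<open>comp1 X g f\<close>, \<open>vcomp X \<beta> \<alpha>\<close> and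
  \<open>hcomp X \<beta> \<alpha>\<close> mean first \<open>f\<close> (\<open>\<alpha>\<close>), then \<open>g\<close> (\<open>\<beta>\<close>).\<close>

locale two_category =
  fixes X :: "('o, 'f, 'c) two_cat"
  assumes cat1: "category (cells0 X) (cells1 X) (src1 X) (tgt1 X) (id1 X) (comp1 X)"
    and vcat: "category (cells1 X) (cells2 X) (src2 X) (tgt2 X) (id2 X) (vcomp X)"
    and hcat: "category (cells0 X) (cells2 X)
                 (\<lambda>\<alpha>. src1 X (src2 X \<alpha>)) (\<lambda>\<alpha>. tgt1 X (src2 X \<alpha>))
                 (\<lambda>x. id2 X (id1 X x)) (hcomp X)"
    and src1_tgt2: "\<alpha> \<in> cells2 X \<Longrightarrow> src1 X (tgt2 X \<alpha>) = src1 X (src2 X \<alpha>)"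
    and tgt1_tgt2: "\<alpha> \<in> cells2 X \<Longrightarrow> tgt1 X (tgt2 X \<alpha>) = tgt1 X (src2 X \<alpha>)"
    and src2_hcomp: "\<lbrakk>\<alpha> \<in> cells2 X; \<beta> \<in> cells2 X; src1 X (src2 X \<beta>) = tgt1 X (src2 X \<alpha>)\<rbrakk>
          \<Longrightarrow> src2 X (hcomp X \<beta> \<alpha>) = comp1 X (src2 X \<beta>) (src2 X \<alpha>)"
    and tgt2_hcomp: "\<lbrakk>\<alpha> \<in> cells2 X; \<beta> \<in> cells2 X; src1 X (src2 X \<beta>) = tgt1 X (src2 X \<alpha>)\<rbrakk>
          \<Longrightarrow> tgt2 X (hcomp X \<beta> \<alpha>) = comp1 X (tgt2 X \<beta>) (tgt2 X \<alpha>)"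
    and id2_comp1: "\<lbrakk>f \<in> cells1 X; g \<in> cells1 X; src1 X g = tgt1 X f\<rbrakk>
          \<Longrightarrow> id2 X (comp1 X g f) = hcomp X (id2 X g) (id2 X f)"
    and interchange: "\<lbrakk>\<alpha> \<in> cells2 X; \<alpha>' \<in> cells2 X; \<beta> \<in> cells2 X; \<beta>' \<in> cells2 X;
            src2 X \<alpha>' = tgt2 X \<alpha>; src2 X \<beta>' = tgt2 X \<beta>; src1 X (src2 X \<beta>) = tgt1 X (src2 X \<alpha>)\<rbrakk>
          \<Longrightarrow> hcomp X (vcomp X \<beta>' \<beta>) (vcomp X \<alpha>' \<alpha>) = vcomp X (hcomp X \<beta>' \<alpha>') (hcomp X \<beta> \<alpha>)"

definition inv2 :: "('o, 'f, 'c) two_cat \<Rightarrow> 'c \<Rightarrow> 'c" where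
  "inv2 X \<alpha> = (THE \<beta>. \<beta> \<in> cells2 X \<and> src2 X \<beta> = tgt2 X \<alpha> \<and> tgt2 X \<beta> = src2 X \<alpha>
                 \<and> vcomp X \<beta> \<alpha> = id2 X (src2 X \<alpha>) \<and> vcomp X \<alpha> \<beta> = id2 X (tgt2 X \<alpha>))"

record ('o, 'f, 'c, 'p, 'g, 'd) two_fun =
  map0 :: "'o \<Rightarrow> 'p"
  map1 :: "'f \<Rightarrow> 'g"
  map2 :: "'c \<Rightarrow> 'd"

locale two_functor = S: two_category X + T: two_category Y
  for X :: "('o, 'f, 'c) two_cat" and Y :: "('p, 'g, 'd) two_cat" +
  fixes F :: "('o, 'f, 'c, 'p, 'g, 'd) two_fun"
  assumes map0_closed: "x \<in> cells0 X \<Longrightarrow> map0 F x \<in> cells0 Y"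
    and map1_closed: "f \<in> cells1 X \<Longrightarrow> map1 F f \<in> cells1 Y"
    and map2_closed: "\<alpha> \<in> cells2 X \<Longrightarrow> map2 F \<alpha> \<in> cells2 Y"
    and src1_map1: "f \<in> cells1 X \<Longrightarrow> src1 Y (map1 F f) = map0 F (src1 X f)"
    and tgt1_map1: "f \<in> cells1 X \<Longrightarrow> tgt1 Y (map1 F f) = map0 F (tgt1 X f)"
    and src2_map2: "\<alpha> \<in> cells2 X \<Longrightarrow> src2 Y (map2 F \<alpha>) = map1 F (src2 X \<alpha>)"
    and tgt2_map2: "\<alpha> \<in> cells2 X \<Longrightarrow> tgt2 Y (map2 F \<alpha>) = map1 F (tgt2 X \<alpha>)"
    and map1_id1: "x \<in> cells0 X \<Longrightarrow> map1 F (id1 X x) = id1 Y (map0 F x)"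
    and map1_comp1: "\<lbrakk>f \<in> cells1 X; g \<in> cells1 X; src1 X g = tgt1 X f\<rbrakk>
          \<Longrightarrow> map1 F (comp1 X g f) = comp1 Y (map1 F g) (map1 F f)"
    and map2_id2: "f \<in> cells1 X \<Longrightarrow> map2 F (id2 X f) = id2 Y (map1 F f)"
    and map2_vcomp: "\<lbrakk>\<alpha> \<in> cells2 X; \<beta> \<in> cells2 X; src2 X \<beta> = tgt2 X \<alpha>\<rbrakk>
          \<Longrightarrow> map2 F (vcomp X \<beta> \<alpha>) = vcomp Y (map2 F \<beta>) (map2 F \<alpha>)"
    and map2_hcomp: "\<lbrakk>\<alpha> \<in> cells2 X; \<beta> \<in> cells2 X; src1 X (src2 X \<beta>) = tgt1 X (src2 X \<alpha>)\<rbrakk>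
          \<Longrightarrow> map2 F (hcomp X \<beta> \<alpha>) = hcomp Y (map2 F \<beta>) (map2 F \<alpha>)"

definition fun_id :: "('o, 'f, 'c, 'o, 'f, 'c) two_fun" where
  "fun_id = \<lparr>map0 = \<lambda>x. x, map1 = \<lambda>f. f, map2 = \<lambda>\<alpha>. \<alpha>\<rparr>"

definition fun_comp :: "('p, 'g, 'd, 'q, 'h, 'e) two_fun \<Rightarrow> ('o, 'f, 'c, 'p, 'g, 'd) two_fun
    \<Rightarrow> ('o, 'f, 'c, 'q, 'h, 'e) two_fun"  (infixl "\<circ>\<^sub>F" 55) where
  "G \<circ>\<^sub>F F = \<lparr>map0 = \<lambda>x. map0 G (map0 F x), map1 = \<lambda>f. map1 G (map1 F f),
              map2 = \<lambda>\<alpha>. map2 G (map2 F \<alpha>)\<rparr>"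

definition fun_const :: "('p, 'g, 'd) two_cat \<Rightarrow> 'p \<Rightarrow> ('o, 'f, 'c, 'p, 'g, 'd) two_fun" where
  "fun_const Y y = \<lparr>map0 = \<lambda>_. y, map1 = \<lambda>_. id1 Y y, map2 = \<lambda>_. id2 Y (id1 Y y)\<rparr>"

definition fun_eq_on :: "('o, 'f, 'c) two_cat \<Rightarrow> ('o, 'f, 'c, 'p, 'g, 'd) two_fun
    \<Rightarrow> ('o, 'f, 'c, 'p, 'g, 'd) two_fun \<Rightarrow> bool" where
  "fun_eq_on X F G \<longleftrightarrow> (\<forall>x\<in>cells0 X. map0 F x = map0 G x)
     \<and> (\<forall>f\<in>cells1 X. map1 F f = map1 G f) \<and> (\<forall>\<alpha>\<in>cells2 X. map2 F \<alpha> = map2 G \<alpha>)"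

locale two_natural = F: two_functor X Y F + G: two_functor X Y G
  for X :: "('o, 'f, 'c) two_cat" and Y :: "('p, 'g, 'd) two_cat"
    and F G :: "('o, 'f, 'c, 'p, 'g, 'd) two_fun" +
  fixes \<theta> :: "'o \<Rightarrow> 'g"
  assumes component_closed: "x \<in> cells0 X \<Longrightarrow> \<theta> x \<in> cells1 Y"
    and src1_component: "x \<in> cells0 X \<Longrightarrow> src1 Y (\<theta> x) = map0 F x"
    and tgt1_component: "x \<in> cells0 X \<Longrightarrow> tgt1 Y (\<theta> x) = map0 G x"
    and natural1: "f \<in> cells1 X
          \<Longrightarrow> comp1 Y (\<theta> (tgt1 X f)) (map1 F f) = comp1 Y (map1 G f) (\<theta> (src1 X f))"
    and natural2: "\<alpha> \<in> cells2 X
          \<Longrightarrow> hcomp Y (id2 Y (\<theta> (tgt1 X (src2 X \<alpha>)))) (map2 F \<alpha>)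
            = hcomp Y (map2 G \<alpha>) (id2 Y (\<theta> (src1 X (src2 X \<alpha>))))"

definition two_natural_iso :: "('o, 'f, 'c) two_cat \<Rightarrow> ('p, 'g, 'd) two_cat
    \<Rightarrow> ('o, 'f, 'c, 'p, 'g, 'd) two_fun \<Rightarrow> ('o, 'f, 'c, 'p, 'g, 'd) two_fun
    \<Rightarrow> ('o \<Rightarrow> 'g) \<Rightarrow> bool" where
  "two_natural_iso X Y F G \<theta> \<longleftrightarrow> two_natural X Y F G \<theta> \<and>
     (\<exists>\<theta>'. two_natural X Y G F \<theta>' \<and>
        (\<forall>x\<in>cells0 X. comp1 Y (\<theta>' x) (\<theta> x) = id1 Y (map0 F x)
                     \<and> comp1 Y (\<theta> x) (\<theta>' x) = id1 Y (map0 G x)))"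


section \<open>The Gray tensor product (pseudo version)\<close>

text \<open>The tensor product is presented by generators and relations: raw terms with a typing,
  divided by the least congruence containing the 2-category axioms, functoriality in each
  variable, and the compatibility relations of the transition 2-cells.  In the raw terms,
  \<open>L1 f y\<close>, \<open>R1 x g\<close>, \<open>L2 \<alpha> y\<close>, \<open>R2 x \<alpha>\<close> stand for \<open>f \<otimes> y\<close>, \<open>x \<otimes> g\<close>, \<open>\<alpha> \<otimes> y\<close>, \<open>x \<otimes> \<alpha>\<close>, and
  \<open>Sig f g\<close>, \<open>SigInv f g\<close> for the transition 2-cell and its formal inverse.\<close>

datatype ('o, 'f, 'p, 'g) raw1 =
    I1 "'o \<times> 'p"
  | L1 'f 'p
  | R1 'o 'g
  | C1 "('o, 'f, 'p, 'g) raw1" "('o, 'f, 'p, 'g) raw1"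

datatype ('o, 'f, 'c, 'p, 'g, 'd) raw2 =
    I2 "('o, 'f, 'p, 'g) raw1"
  | L2 'c 'p
  | R2 'o 'd
  | Sig 'f 'g
  | SigInv 'f 'g
  | V2 "('o, 'f, 'c, 'p, 'g, 'd) raw2" "('o, 'f, 'c, 'p, 'g, 'd) raw2"
  | H2 "('o, 'f, 'c, 'p, 'g, 'd) raw2" "('o, 'f, 'c, 'p, 'g, 'd) raw2"

primrec rsrc1 :: "('o, 'f, 'c) two_cat \<Rightarrow> ('p, 'g, 'd) two_cat
    \<Rightarrow> ('o, 'f, 'p, 'g) raw1 \<Rightarrow> 'o \<times> 'p" where
  "rsrc1 X Y (I1 z) = z"
| "rsrc1 X Y (L1 f y) = (src1 X f, y)"
| "rsrc1 X Y (R1 x g) = (x, src1 Y g)"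
| "rsrc1 X Y (C1 t s) = rsrc1 X Y s"

primrec rtgt1 :: "('o, 'f, 'c) two_cat \<Rightarrow> ('p, 'g, 'd) two_cat
    \<Rightarrow> ('o, 'f, 'p, 'g) raw1 \<Rightarrow> 'o \<times> 'p" where
  "rtgt1 X Y (I1 z) = z"
| "rtgt1 X Y (L1 f y) = (tgt1 X f, y)"
| "rtgt1 X Y (R1 x g) = (x, tgt1 Y g)"
| "rtgt1 X Y (C1 t s) = rtgt1 X Y t"

primrec wf1 :: "('o, 'f, 'c) two_cat \<Rightarrow> ('p, 'g, 'd) two_cat
    \<Rightarrow> ('o, 'f, 'p, 'g) raw1 \<Rightarrow> bool" where
  "wf1 X Y (I1 z) \<longleftrightarrow> z \<in> cells0 X \<times> cells0 Y"
| "wf1 X Y (L1 f y) \<longleftrightarrow> f \<in> cells1 X \<and> y \<in> cells0 Y"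
| "wf1 X Y (R1 x g) \<longleftrightarrow> x \<in> cells0 X \<and> g \<in> cells1 Y"
| "wf1 X Y (C1 t s) \<longleftrightarrow> wf1 X Y t \<and> wf1 X Y s \<and> rsrc1 X Y t = rtgt1 X Y s"

inductive_set rel1 :: "('o, 'f, 'c) two_cat \<Rightarrow> ('p, 'g, 'd) two_cat
    \<Rightarrow> (('o, 'f, 'p, 'g) raw1 \<times> ('o, 'f, 'p, 'g) raw1) set"
  for X :: "('o, 'f, 'c) two_cat" and Y :: "('p, 'g, 'd) two_cat" where
  refl: "wf1 X Y t \<Longrightarrow> (t, t) \<in> rel1 X Y"
| sym: "(t, s) \<in> rel1 X Y \<Longrightarrow> (s, t) \<in> rel1 X Y"
| trans: "\<lbrakk>(t, s) \<in> rel1 X Y; (s, r) \<in> rel1 X Y\<rbrakk> \<Longrightarrow> (t, r) \<in> rel1 X Y"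
| cong: "\<lbrakk>(t, t') \<in> rel1 X Y; (s, s') \<in> rel1 X Y; wf1 X Y (C1 t s)\<rbrakk>
    \<Longrightarrow> (C1 t s, C1 t' s') \<in> rel1 X Y"
| assoc: "wf1 X Y (C1 t (C1 s r)) \<Longrightarrow> (C1 t (C1 s r), C1 (C1 t s) r) \<in> rel1 X Y"
| unit_left: "wf1 X Y t \<Longrightarrow> (C1 (I1 (rtgt1 X Y t)) t, t) \<in> rel1 X Y"
| unit_right: "wf1 X Y t \<Longrightarrow> (C1 t (I1 (rsrc1 X Y t)), t) \<in> rel1 X Y"
| L_id: "\<lbrakk>x \<in> cells0 X; y \<in> cells0 Y\<rbrakk> \<Longrightarrow> (L1 (id1 X x) y, I1 (x, y)) \<in> rel1 X Y"
| L_comp: "\<lbrakk>f \<in> cells1 X; f' \<in> cells1 X; src1 X f' = tgt1 X f; y \<in> cells0 Y\<rbrakk>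
    \<Longrightarrow> (L1 (comp1 X f' f) y, C1 (L1 f' y) (L1 f y)) \<in> rel1 X Y"
| R_id: "\<lbrakk>x \<in> cells0 X; y \<in> cells0 Y\<rbrakk> \<Longrightarrow> (R1 x (id1 Y y), I1 (x, y)) \<in> rel1 X Y"
| R_comp: "\<lbrakk>x \<in> cells0 X; g \<in> cells1 Y; g' \<in> cells1 Y; src1 Y g' = tgt1 Y g\<rbrakk>
    \<Longrightarrow> (R1 x (comp1 Y g' g), C1 (R1 x g') (R1 x g)) \<in> rel1 X Y"

primrec rsrc2 :: "('o, 'f, 'c) two_cat \<Rightarrow> ('p, 'g, 'd) two_cat
    \<Rightarrow> ('o, 'f, 'c, 'p, 'g, 'd) raw2 \<Rightarrow> ('o, 'f, 'p, 'g) raw1" where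
  "rsrc2 X Y (I2 t) = t"
| "rsrc2 X Y (L2 \<alpha> y) = L1 (src2 X \<alpha>) y"
| "rsrc2 X Y (R2 x \<alpha>) = R1 x (src2 Y \<alpha>)"
| "rsrc2 X Y (Sig f g) = C1 (L1 f (tgt1 Y g)) (R1 (src1 X f) g)"
| "rsrc2 X Y (SigInv f g) = C1 (R1 (tgt1 X f) g) (L1 f (src1 Y g))"
| "rsrc2 X Y (V2 b a) = rsrc2 X Y a"
| "rsrc2 X Y (H2 b a) = C1 (rsrc2 X Y b) (rsrc2 X Y a)"

primrec rtgt2 :: "('o, 'f, 'c) two_cat \<Rightarrow> ('p, 'g, 'd) two_cat
    \<Rightarrow> ('o, 'f, 'c, 'p, 'g, 'd) raw2 \<Rightarrow> ('o, 'f, 'p, 'g) raw1" where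
  "rtgt2 X Y (I2 t) = t"
| "rtgt2 X Y (L2 \<alpha> y) = L1 (tgt2 X \<alpha>) y"
| "rtgt2 X Y (R2 x \<alpha>) = R1 x (tgt2 Y \<alpha>)"
| "rtgt2 X Y (Sig f g) = C1 (R1 (tgt1 X f) g) (L1 f (src1 Y g))"
| "rtgt2 X Y (SigInv f g) = C1 (L1 f (tgt1 Y g)) (R1 (src1 X f) g)"
| "rtgt2 X Y (V2 b a) = rtgt2 X Y b"
| "rtgt2 X Y (H2 b a) = C1 (rtgt2 X Y b) (rtgt2 X Y a)"

primrec wf2 :: "('o, 'f, 'c) two_cat \<Rightarrow> ('p, 'g, 'd) two_cat
    \<Rightarrow> ('o, 'f, 'c, 'p, 'g, 'd) raw2 \<Rightarrow> bool" where
  "wf2 X Y (I2 t) \<longleftrightarrow> wf1 X Y t"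
| "wf2 X Y (L2 \<alpha> y) \<longleftrightarrow> \<alpha> \<in> cells2 X \<and> y \<in> cells0 Y"
| "wf2 X Y (R2 x \<alpha>) \<longleftrightarrow> x \<in> cells0 X \<and> \<alpha> \<in> cells2 Y"
| "wf2 X Y (Sig f g) \<longleftrightarrow> f \<in> cells1 X \<and> g \<in> cells1 Y"
| "wf2 X Y (SigInv f g) \<longleftrightarrow> f \<in> cells1 X \<and> g \<in> cells1 Y"
| "wf2 X Y (V2 b a) \<longleftrightarrow> wf2 X Y b \<and> wf2 X Y a \<and> (rsrc2 X Y b, rtgt2 X Y a) \<in> rel1 X Y"
| "wf2 X Y (H2 b a) \<longleftrightarrow> wf2 X Y b \<and> wf2 X Y a
     \<and> rsrc1 X Y (rsrc2 X Y b) = rtgt1 X Y (rsrc2 X Y a)"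

inductive_set rel2 :: "('o, 'f, 'c) two_cat \<Rightarrow> ('p, 'g, 'd) two_cat
    \<Rightarrow> (('o, 'f, 'c, 'p, 'g, 'd) raw2 \<times> ('o, 'f, 'c, 'p, 'g, 'd) raw2) set"
  for X :: "('o, 'f, 'c) two_cat" and Y :: "('p, 'g, 'd) two_cat" where
  refl: "wf2 X Y a \<Longrightarrow> (a, a) \<in> rel2 X Y"
| sym: "(a, b) \<in> rel2 X Y \<Longrightarrow> (b, a) \<in> rel2 X Y"
| trans: "\<lbrakk>(a, b) \<in> rel2 X Y; (b, c) \<in> rel2 X Y\<rbrakk> \<Longrightarrow> (a, c) \<in> rel2 X Y"
| I_cong: "(t, s) \<in> rel1 X Y \<Longrightarrow> (I2 t, I2 s) \<in> rel2 X Y"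
| V_cong: "\<lbrakk>(b, b') \<in> rel2 X Y; (a, a') \<in> rel2 X Y; wf2 X Y (V2 b a)\<rbrakk>
    \<Longrightarrow> (V2 b a, V2 b' a') \<in> rel2 X Y"
| H_cong: "\<lbrakk>(b, b') \<in> rel2 X Y; (a, a') \<in> rel2 X Y; wf2 X Y (H2 b a)\<rbrakk>
    \<Longrightarrow> (H2 b a, H2 b' a') \<in> rel2 X Y"
| V_assoc: "wf2 X Y (V2 c (V2 b a)) \<Longrightarrow> (V2 c (V2 b a), V2 (V2 c b) a) \<in> rel2 X Y"
| V_unit_left: "wf2 X Y a \<Longrightarrow> (V2 (I2 (rtgt2 X Y a)) a, a) \<in> rel2 X Y"
| V_unit_right: "wf2 X Y a \<Longrightarrow> (V2 a (I2 (rsrc2 X Y a)), a) \<in> rel2 X Y"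
| H_assoc: "wf2 X Y (H2 c (H2 b a)) \<Longrightarrow> (H2 c (H2 b a), H2 (H2 c b) a) \<in> rel2 X Y"
| H_unit_left: "wf2 X Y a \<Longrightarrow> (H2 (I2 (I1 (rtgt1 X Y (rsrc2 X Y a)))) a, a) \<in> rel2 X Y"
| H_unit_right: "wf2 X Y a \<Longrightarrow> (H2 a (I2 (I1 (rsrc1 X Y (rsrc2 X Y a)))), a) \<in> rel2 X Y"
| H_id: "wf1 X Y (C1 t s) \<Longrightarrow> (I2 (C1 t s), H2 (I2 t) (I2 s)) \<in> rel2 X Y"
| interchange: "\<lbrakk>wf2 X Y (V2 b' b); wf2 X Y (V2 a' a); wf2 X Y (H2 b a)\<rbrakk>
    \<Longrightarrow> (H2 (V2 b' b) (V2 a' a), V2 (H2 b' a') (H2 b a)) \<in> rel2 X Y"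
| L_id: "\<lbrakk>f \<in> cells1 X; y \<in> cells0 Y\<rbrakk> \<Longrightarrow> (L2 (id2 X f) y, I2 (L1 f y)) \<in> rel2 X Y"
| L_vcomp: "\<lbrakk>\<alpha> \<in> cells2 X; \<beta> \<in> cells2 X; src2 X \<beta> = tgt2 X \<alpha>; y \<in> cells0 Y\<rbrakk>
    \<Longrightarrow> (L2 (vcomp X \<beta> \<alpha>) y, V2 (L2 \<beta> y) (L2 \<alpha> y)) \<in> rel2 X Y"
| L_hcomp: "\<lbrakk>\<alpha> \<in> cells2 X; \<beta> \<in> cells2 X; src1 X (src2 X \<beta>) = tgt1 X (src2 X \<alpha>); y \<in> cells0 Y\<rbrakk>
    \<Longrightarrow> (L2 (hcomp X \<beta> \<alpha>) y, H2 (L2 \<beta> y) (L2 \<alpha> y)) \<in> rel2 X Y"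
| R_id: "\<lbrakk>x \<in> cells0 X; g \<in> cells1 Y\<rbrakk> \<Longrightarrow> (R2 x (id2 Y g), I2 (R1 x g)) \<in> rel2 X Y"
| R_vcomp: "\<lbrakk>x \<in> cells0 X; \<alpha> \<in> cells2 Y; \<beta> \<in> cells2 Y; src2 Y \<beta> = tgt2 Y \<alpha>\<rbrakk>
    \<Longrightarrow> (R2 x (vcomp Y \<beta> \<alpha>), V2 (R2 x \<beta>) (R2 x \<alpha>)) \<in> rel2 X Y"
| R_hcomp: "\<lbrakk>x \<in> cells0 X; \<alpha> \<in> cells2 Y; \<beta> \<in> cells2 Y; src1 Y (src2 Y \<beta>) = tgt1 Y (src2 Y \<alpha>)\<rbrakk>
    \<Longrightarrow> (R2 x (hcomp Y \<beta> \<alpha>), H2 (R2 x \<beta>) (R2 x \<alpha>)) \<in> rel2 X Y"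
| Sig_inv_left: "\<lbrakk>f \<in> cells1 X; g \<in> cells1 Y\<rbrakk>
    \<Longrightarrow> (V2 (SigInv f g) (Sig f g), I2 (rsrc2 X Y (Sig f g))) \<in> rel2 X Y"
| Sig_inv_right: "\<lbrakk>f \<in> cells1 X; g \<in> cells1 Y\<rbrakk>
    \<Longrightarrow> (V2 (Sig f g) (SigInv f g), I2 (rtgt2 X Y (Sig f g))) \<in> rel2 X Y"
| Sig_nat_left: "\<lbrakk>\<alpha> \<in> cells2 X; g \<in> cells1 Y\<rbrakk>
    \<Longrightarrow> (V2 (H2 (I2 (R1 (tgt1 X (src2 X \<alpha>)) g)) (L2 \<alpha> (src1 Y g))) (Sig (src2 X \<alpha>) g),
         V2 (Sig (tgt2 X \<alpha>) g) (H2 (L2 \<alpha> (tgt1 Y g)) (I2 (R1 (src1 X (src2 X \<alpha>)) g))))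
        \<in> rel2 X Y"
| Sig_nat_right: "\<lbrakk>f \<in> cells1 X; \<alpha> \<in> cells2 Y\<rbrakk>
    \<Longrightarrow> (V2 (H2 (R2 (tgt1 X f) \<alpha>) (I2 (L1 f (src1 Y (src2 Y \<alpha>))))) (Sig f (src2 Y \<alpha>)),
         V2 (Sig f (tgt2 Y \<alpha>)) (H2 (I2 (L1 f (tgt1 Y (src2 Y \<alpha>)))) (R2 (src1 X f) \<alpha>)))
        \<in> rel2 X Y"
| Sig_id_left: "\<lbrakk>x \<in> cells0 X; g \<in> cells1 Y\<rbrakk>
    \<Longrightarrow> (Sig (id1 X x) g, I2 (R1 x g)) \<in> rel2 X Y"
| Sig_id_right: "\<lbrakk>f \<in> cells1 X; y \<in> cells0 Y\<rbrakk>
    \<Longrightarrow> (Sig f (id1 Y y), I2 (L1 f y)) \<in> rel2 X Y"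
| Sig_comp_left: "\<lbrakk>f \<in> cells1 X; f' \<in> cells1 X; src1 X f' = tgt1 X f; g \<in> cells1 Y\<rbrakk>
    \<Longrightarrow> (Sig (comp1 X f' f) g,
         V2 (H2 (Sig f' g) (I2 (L1 f (src1 Y g)))) (H2 (I2 (L1 f' (tgt1 Y g))) (Sig f g)))
        \<in> rel2 X Y"
| Sig_comp_right: "\<lbrakk>f \<in> cells1 X; g \<in> cells1 Y; g' \<in> cells1 Y; src1 Y g' = tgt1 Y g\<rbrakk>
    \<Longrightarrow> (Sig f (comp1 Y g' g),
         V2 (H2 (I2 (R1 (tgt1 X f) g')) (Sig f g)) (H2 (Sig f g') (I2 (R1 (src1 X f) g))))
        \<in> rel2 X Y"

definition rep :: "'t set \<Rightarrow> 't" where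
  "rep c = (SOME t. t \<in> c)"

definition cls1 :: "('o, 'f, 'c) two_cat \<Rightarrow> ('p, 'g, 'd) two_cat
    \<Rightarrow> ('o, 'f, 'p, 'g) raw1 \<Rightarrow> ('o, 'f, 'p, 'g) raw1 set" where
  "cls1 X Y t = rel1 X Y `` {t}"

definition cls2 :: "('o, 'f, 'c) two_cat \<Rightarrow> ('p, 'g, 'd) two_cat
    \<Rightarrow> ('o, 'f, 'c, 'p, 'g, 'd) raw2 \<Rightarrow> ('o, 'f, 'c, 'p, 'g, 'd) raw2 set" where
  "cls2 X Y a = rel2 X Y `` {a}"

definition gray :: "('o, 'f, 'c) two_cat \<Rightarrow> ('p, 'g, 'd) two_cat
    \<Rightarrow> ('o \<times> 'p, ('o, 'f, 'p, 'g) raw1 set, ('o, 'f, 'c, 'p, 'g, 'd) raw2 set) two_cat"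
    (infixr "\<otimes>\<^sub>G" 70) where
  "X \<otimes>\<^sub>G Y =
    \<lparr>cells0 = cells0 X \<times> cells0 Y,
     cells1 = {t. wf1 X Y t} // rel1 X Y,
     cells2 = {a. wf2 X Y a} // rel2 X Y,
     src1 = \<lambda>c. rsrc1 X Y (rep c),
     tgt1 = \<lambda>c. rtgt1 X Y (rep c),
     src2 = \<lambda>c. cls1 X Y (rsrc2 X Y (rep c)),
     tgt2 = \<lambda>c. cls1 X Y (rtgt2 X Y (rep c)),
     id1 = \<lambda>z. cls1 X Y (I1 z),
     comp1 = \<lambda>d c. cls1 X Y (C1 (rep d) (rep c)),
     id2 = \<lambda>c. cls2 X Y (I2 (rep c)),
     vcomp = \<lambda>d c. cls2 X Y (V2 (rep d) (rep c)),
     hcomp = \<lambda>d c. cls2 X Y (H2 (rep d) (rep c))\<rparr>"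

definition gray_L :: "('o, 'f, 'c) two_cat \<Rightarrow> ('p, 'g, 'd) two_cat \<Rightarrow> 'p
    \<Rightarrow> ('o, 'f, 'c, 'o \<times> 'p, ('o, 'f, 'p, 'g) raw1 set, ('o, 'f, 'c, 'p, 'g, 'd) raw2 set) two_fun"
  where
  "gray_L X Y y = \<lparr>map0 = \<lambda>x. (x, y), map1 = \<lambda>f. cls1 X Y (L1 f y), map2 = \<lambda>\<alpha>. cls2 X Y (L2 \<alpha> y)\<rparr>"

definition gray_R :: "('o, 'f, 'c) two_cat \<Rightarrow> ('p, 'g, 'd) two_cat \<Rightarrow> 'o
    \<Rightarrow> ('p, 'g, 'd, 'o \<times> 'p, ('o, 'f, 'p, 'g) raw1 set, ('o, 'f, 'c, 'p, 'g, 'd) raw2 set) two_fun"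
  where
  "gray_R X Y x = \<lparr>map0 = \<lambda>y. (x, y), map1 = \<lambda>g. cls1 X Y (R1 x g), map2 = \<lambda>\<alpha>. cls2 X Y (R2 x \<alpha>)\<rparr>"

definition gray_Sig :: "('o, 'f, 'c) two_cat \<Rightarrow> ('p, 'g, 'd) two_cat \<Rightarrow> 'f \<Rightarrow> 'g
    \<Rightarrow> ('o, 'f, 'c, 'p, 'g, 'd) raw2 set" where
  "gray_Sig X Y f g = cls2 X Y (Sig f g)"

text \<open>The 2-functor \<open>X \<otimes>\<^sub>G Y \<rightarrow> Z\<close> determined by its values on generators: 2-functors \<open>Lf y\<close>
  (the restriction to \<open>- \<otimes> y\<close>) and \<open>Rf x\<close> (the restriction to \<open>x \<otimes> -\<close>), agreeing on objects, and
  the images \<open>S f g\<close> of the transition 2-cells.  It is meaningful only if the data respect the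
  relations.\<close>

primrec lift1 :: "('q, 'h, 'e) two_cat \<Rightarrow> ('p \<Rightarrow> ('o, 'f, 'c, 'q, 'h, 'e) two_fun)
    \<Rightarrow> ('o \<Rightarrow> ('p, 'g, 'd, 'q, 'h, 'e) two_fun) \<Rightarrow> ('o, 'f, 'p, 'g) raw1 \<Rightarrow> 'h" where
  "lift1 Z Lf Rf (I1 z) = id1 Z (map0 (Lf (snd z)) (fst z))"
| "lift1 Z Lf Rf (L1 f y) = map1 (Lf y) f"
| "lift1 Z Lf Rf (R1 x g) = map1 (Rf x) g"
| "lift1 Z Lf Rf (C1 t s) = comp1 Z (lift1 Z Lf Rf t) (lift1 Z Lf Rf s)"

primrec lift2 :: "('q, 'h, 'e) two_cat \<Rightarrow> ('p \<Rightarrow> ('o, 'f, 'c, 'q, 'h, 'e) two_fun)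
    \<Rightarrow> ('o \<Rightarrow> ('p, 'g, 'd, 'q, 'h, 'e) two_fun) \<Rightarrow> ('f \<Rightarrow> 'g \<Rightarrow> 'e)
    \<Rightarrow> ('o, 'f, 'c, 'p, 'g, 'd) raw2 \<Rightarrow> 'e" where
  "lift2 Z Lf Rf S (I2 t) = id2 Z (lift1 Z Lf Rf t)"
| "lift2 Z Lf Rf S (L2 \<alpha> y) = map2 (Lf y) \<alpha>"
| "lift2 Z Lf Rf S (R2 x \<alpha>) = map2 (Rf x) \<alpha>"
| "lift2 Z Lf Rf S (Sig f g) = S f g"
| "lift2 Z Lf Rf S (SigInv f g) = inv2 Z (S f g)"
| "lift2 Z Lf Rf S (V2 b a) = vcomp Z (lift2 Z Lf Rf S b) (lift2 Z Lf Rf S a)"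
| "lift2 Z Lf Rf S (H2 b a) = hcomp Z (lift2 Z Lf Rf S b) (lift2 Z Lf Rf S a)"

definition gray_lift :: "('q, 'h, 'e) two_cat \<Rightarrow> ('p \<Rightarrow> ('o, 'f, 'c, 'q, 'h, 'e) two_fun)
    \<Rightarrow> ('o \<Rightarrow> ('p, 'g, 'd, 'q, 'h, 'e) two_fun) \<Rightarrow> ('f \<Rightarrow> 'g \<Rightarrow> 'e)
    \<Rightarrow> ('o \<times> 'p, ('o, 'f, 'p, 'g) raw1 set, ('o, 'f, 'c, 'p, 'g, 'd) raw2 set, 'q, 'h, 'e) two_fun"
  where
  "gray_lift Z Lf Rf S =
    \<lparr>map0 = \<lambda>z. map0 (Lf (snd z)) (fst z),
     map1 = \<lambda>c. lift1 Z Lf Rf (rep c),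
     map2 = \<lambda>c. lift2 Z Lf Rf S (rep c)\<rparr>"


section \<open>The symmetric monoidal structure of the category Gray\<close>

definition gray_map :: "('o', 'f', 'c') two_cat \<Rightarrow> ('p', 'g', 'd') two_cat
    \<Rightarrow> ('o, 'f, 'c, 'o', 'f', 'c') two_fun \<Rightarrow> ('p, 'g, 'd, 'p', 'g', 'd') two_fun
    \<Rightarrow> ('o \<times> 'p, ('o, 'f, 'p, 'g) raw1 set, ('o, 'f, 'c, 'p, 'g, 'd) raw2 set,
        'o' \<times> 'p', ('o', 'f', 'p', 'g') raw1 set, ('o', 'f', 'c', 'p', 'g', 'd') raw2 set) two_fun"
  where
  "gray_map X' Y' F G =
     gray_lift (X' \<otimes>\<^sub>G Y')
       (\<lambda>y. gray_L X' Y' (map0 G y) \<circ>\<^sub>F F)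
       (\<lambda>x. gray_R X' Y' (map0 F x) \<circ>\<^sub>F G)
       (\<lambda>f g. gray_Sig X' Y' (map1 F f) (map1 G g))"

definition gray_swap :: "('o, 'f, 'c) two_cat \<Rightarrow> ('p, 'g, 'd) two_cat
    \<Rightarrow> ('o \<times> 'p, ('o, 'f, 'p, 'g) raw1 set, ('o, 'f, 'c, 'p, 'g, 'd) raw2 set,
        'p \<times> 'o, ('p, 'g, 'o, 'f) raw1 set, ('p, 'g, 'd, 'o, 'f, 'c) raw2 set) two_fun" where
  "gray_swap X Y =
     gray_lift (Y \<otimes>\<^sub>G X) (\<lambda>y. gray_R Y X y) (\<lambda>x. gray_L Y X x) (\<lambda>f g. cls2 Y X (SigInv g f))"

definition unit_two_cat :: "(unit, unit, unit) two_cat" where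
  "unit_two_cat =
    \<lparr>cells0 = UNIV, cells1 = UNIV, cells2 = UNIV,
     src1 = \<lambda>_. (), tgt1 = \<lambda>_. (), src2 = \<lambda>_. (), tgt2 = \<lambda>_. (),
     id1 = \<lambda>_. (), comp1 = \<lambda>_ _. (), id2 = \<lambda>_. (), vcomp = \<lambda>_ _. (), hcomp = \<lambda>_ _. ()\<rparr>"

definition gray_lunit :: "('o, 'f, 'c) two_cat
    \<Rightarrow> (unit \<times> 'o, (unit, unit, 'o, 'f) raw1 set, (unit, unit, unit, 'o, 'f, 'c) raw2 set,
        'o, 'f, 'c) two_fun" where
  "gray_lunit X = gray_lift X (\<lambda>x. fun_const X x) (\<lambda>_. fun_id) (\<lambda>_ g. id2 X g)"

definition gray_runit :: "('o, 'f, 'c) two_cat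
    \<Rightarrow> ('o \<times> unit, ('o, 'f, unit, unit) raw1 set, ('o, 'f, 'c, unit, unit, unit) raw2 set,
        'o, 'f, 'c) two_fun" where
  "gray_runit X = gray_lift X (\<lambda>_. fun_id) (\<lambda>x. fun_const X x) (\<lambda>f _. id2 X f)"

text \<open>The associator \<open>(X \<otimes> Y) \<otimes> Z \<rightarrow> X \<otimes> (Y \<otimes> Z)\<close>.  The image of the transition 2-cell of a
  1-cell \<open>w\<close> of \<open>X \<otimes> Y\<close> and a 1-cell \<open>h\<close> of \<open>Z\<close> is computed by recursion on a term for \<open>w\<close>:
  \<open>f \<otimes> y\<close> gives \<open>\<Sigma>\<close> of \<open>f\<close> and \<open>y \<otimes> h\<close>, \<open>x \<otimes> g\<close> gives \<open>x \<otimes> \<Sigma>\<close> of \<open>g\<close> and \<open>h\<close>, and identities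
  and composites are forced by the compatibility relations.\<close>

primrec assoc_Sig :: "('o, 'f, 'c) two_cat \<Rightarrow> ('p, 'g, 'd) two_cat \<Rightarrow> ('q, 'h, 'e) two_cat
    \<Rightarrow> 'h \<Rightarrow> ('o, 'f, 'p, 'g) raw1
    \<Rightarrow> ('o, 'f, 'c, 'p \<times> 'q, ('p, 'g, 'q, 'h) raw1 set, ('p, 'g, 'd, 'q, 'h, 'e) raw2 set) raw2 set"
  where
  "assoc_Sig X Y Z h (I1 z) =
     id2 (X \<otimes>\<^sub>G Y \<otimes>\<^sub>G Z) (map1 (gray_R X (Y \<otimes>\<^sub>G Z) (fst z) \<circ>\<^sub>F gray_R Y Z (snd z)) h)"
| "assoc_Sig X Y Z h (L1 f y) = gray_Sig X (Y \<otimes>\<^sub>G Z) f (map1 (gray_R Y Z y) h)"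
| "assoc_Sig X Y Z h (R1 x g) = map2 (gray_R X (Y \<otimes>\<^sub>G Z) x) (gray_Sig Y Z g h)"
| "assoc_Sig X Y Z h (C1 t s) =
     (let T = X \<otimes>\<^sub>G Y \<otimes>\<^sub>G Z;
          lt = (\<lambda>z r. map1 (gray_map X (Y \<otimes>\<^sub>G Z) fun_id (gray_L Y Z z)) (cls1 X Y r))
      in vcomp T (hcomp T (assoc_Sig X Y Z h t) (id2 T (lt (src1 Z h) s)))
                 (hcomp T (id2 T (lt (tgt1 Z h) t)) (assoc_Sig X Y Z h s)))"

definition gray_assoc :: "('o, 'f, 'c) two_cat \<Rightarrow> ('p, 'g, 'd) two_cat \<Rightarrow> ('q, 'h, 'e) two_cat
    \<Rightarrow> (('o \<times> 'p) \<times> 'q,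
        ('o \<times> 'p, ('o, 'f, 'p, 'g) raw1 set, 'q, 'h) raw1 set,
        ('o \<times> 'p, ('o, 'f, 'p, 'g) raw1 set, ('o, 'f, 'c, 'p, 'g, 'd) raw2 set, 'q, 'h, 'e) raw2 set,
        'o \<times> 'p \<times> 'q,
        ('o, 'f, 'p \<times> 'q, ('p, 'g, 'q, 'h) raw1 set) raw1 set,
        ('o, 'f, 'c, 'p \<times> 'q, ('p, 'g, 'q, 'h) raw1 set, ('p, 'g, 'd, 'q, 'h, 'e) raw2 set) raw2 set)
       two_fun" where
  "gray_assoc X Y Z =
     gray_lift (X \<otimes>\<^sub>G Y \<otimes>\<^sub>G Z)
       (\<lambda>z. gray_map X (Y \<otimes>\<^sub>G Z) fun_id (gray_L Y Z z))
       (\<lambda>xy. gray_R X (Y \<otimes>\<^sub>G Z) (fst xy) \<circ>\<^sub>F gray_R Y Z (snd xy))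
       (\<lambda>w h. assoc_Sig X Y Z h (rep w))"


section \<open>Permutative Gray monoids\<close>

text \<open>A monoid in Gray: the unit is a 2-functor from the unit 2-category, that is, an object.\<close>

locale gray_monoid = mult: two_functor "M \<otimes>\<^sub>G M" M mul
  for M :: "('o, 'f, 'c) two_cat"
    and mul :: "('o \<times> 'o, ('o, 'f, 'o, 'f) raw1 set, ('o, 'f, 'c, 'o, 'f, 'c) raw2 set,
                 'o, 'f, 'c) two_fun" +
  fixes I :: 'o
  assumes unit_functor: "two_functor unit_two_cat M (fun_const M I)"
    and mul_assoc: "fun_eq_on ((M \<otimes>\<^sub>G M) \<otimes>\<^sub>G M)
          (mul \<circ>\<^sub>F gray_map M M mul fun_id)
          (mul \<circ>\<^sub>F gray_map M M fun_id mul \<circ>\<^sub>F gray_assoc M M M)"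
    and mul_unit_left: "fun_eq_on (unit_two_cat \<otimes>\<^sub>G M)
          (mul \<circ>\<^sub>F gray_map M M (fun_const M I) fun_id) (gray_lunit M)"
    and mul_unit_right: "fun_eq_on (M \<otimes>\<^sub>G unit_two_cat)
          (mul \<circ>\<^sub>F gray_map M M fun_id (fun_const M I)) (gray_runit M)"

locale permutative_gray_monoid = gray_monoid M mul I
  for M :: "('o, 'f, 'c) two_cat"
    and mul :: "('o \<times> 'o, ('o, 'f, 'o, 'f) raw1 set, ('o, 'f, 'c, 'o, 'f, 'c) raw2 set,
                 'o, 'f, 'c) two_fun"
    and I :: 'o +
  fixes \<beta> :: "'o \<Rightarrow> 'o \<Rightarrow> 'f"
  assumes symmetry_iso:
      "two_natural_iso (M \<otimes>\<^sub>G M) M mul (mul \<circ>\<^sub>F gray_swap M M) (\<lambda>z. \<beta> (fst z) (snd z))"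
    and unit_axiom: "x \<in> cells0 M \<Longrightarrow> \<beta> I x = id1 M x"
    and symmetry_axiom: "\<lbrakk>x \<in> cells0 M; y \<in> cells0 M\<rbrakk>
          \<Longrightarrow> comp1 M (\<beta> y x) (\<beta> x y) = id1 M (map0 mul (x, y))"
    and hexagon_axiom: "\<lbrakk>x \<in> cells0 M; y \<in> cells0 M; z \<in> cells0 M\<rbrakk>
          \<Longrightarrow> \<beta> x (map0 mul (y, z))
            = comp1 M (map1 (mul \<circ>\<^sub>F gray_R M M y) (\<beta> x z)) (map1 (mul \<circ>\<^sub>F gray_L M M z) (\<beta> x y))"


section \<open>The matrix construction\<close>

definition mat_prod :: "('b \<Rightarrow> 'b \<Rightarrow> 'b) \<Rightarrow> ('b \<Rightarrow> 'b \<Rightarrow> 'b) \<Rightarrow> 'b \<Rightarrow> 'b mat \<Rightarrow> 'b mat \<Rightarrow> 'b mat" where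
  "mat_prod sm pr z B A = mat (dim_row B) (dim_col A)
     (\<lambda>(k, i). foldr sm (map (\<lambda>j. pr (B $$ (k, j)) (A $$ (j, i))) [0..<dim_row A]) z)"

text \<open>The block matrix with \<open>(j, i)\<close> block \<open>(op (A\<^sub>j\<^sub>i) (B\<^sub>l\<^sub>k))\<^sub>l\<^sub>,\<^sub>k\<close>; the pair \<open>(j, l)\<close> is encoded as the
  row index \<open>j * dim_row B + l\<close>, and similarly for columns.\<close>

definition block_mat :: "('b \<Rightarrow> 'b \<Rightarrow> 'd) \<Rightarrow> 'b mat \<Rightarrow> 'b mat \<Rightarrow> 'd mat" where
  "block_mat op A B = mat (dim_row A * dim_row B) (dim_col A * dim_col B)
     (\<lambda>(r, c). op (A $$ (r div dim_row B, c div dim_col B)) (B $$ (r mod dim_row B, c mod dim_col B)))"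

definition mat_one :: "('o, 'a) bimon_cat \<Rightarrow> nat \<Rightarrow> 'o mat" where
  "mat_one C n = mat n n (\<lambda>(i, j). if i = j then uni C else zer C)"

definition Mat :: "('o, 'a) bimon_cat \<Rightarrow> (nat, 'o mat, 'a mat) two_cat" where
  "Mat C =
    \<lparr>cells0 = UNIV,
     cells1 = {A. elements_mat A \<subseteq> Ob C},
     cells2 = {A. elements_mat A \<subseteq> Ar C},
     src1 = dim_col,
     tgt1 = dim_row,
     src2 = map_mat (dm C),
     tgt2 = map_mat (cd C),
     id1 = mat_one C,
     comp1 = mat_prod (add0 C) (mul0 C) (zer C),
     id2 = map_mat (ide C),
     vcomp = \<lambda>B A. mat (dim_row A) (dim_col A) (\<lambda>ij. cmp C (B $$ ij) (A $$ ij)),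
     hcomp = mat_prod (add1 C) (mul1 C) (ide C (zer C))\<rparr>"

definition Mat_mult :: "('o, 'a) bimon_cat
    \<Rightarrow> (nat \<times> nat, (nat, 'o mat, nat, 'o mat) raw1 set,
        (nat, 'o mat, 'a mat, nat, 'o mat, 'a mat) raw2 set, nat, 'o mat, 'a mat) two_fun" where
  "Mat_mult C =
     gray_lift (Mat C)
       (\<lambda>n. \<lparr>map0 = \<lambda>m. m * n,
             map1 = \<lambda>A. block_mat (mul0 C) A (mat_one C n),
             map2 = \<lambda>A. block_mat (mul1 C) A (map_mat (ide C) (mat_one C n))\<rparr>)
       (\<lambda>m. \<lparr>map0 = \<lambda>n. m * n,
             map1 = \<lambda>B. block_mat (mul0 C) (mat_one C m) B,
             map2 = \<lambda>B. block_mat (mul1 C) (map_mat (ide C) (mat_one C m)) B\<rparr>)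
       (\<lambda>A B. block_mat (zeta C) A B)"

text \<open>The entry of the permutation matrix in row \<open>(k', i')\<close> (that is, \<open>k' * m + i'\<close>) and column
  \<open>(i, k)\<close> (that is, \<open>i * n + k\<close>) is the unit exactly if \<open>i' = i\<close> and \<open>k' = k\<close>.\<close>

definition Mat_sym :: "('o, 'a) bimon_cat \<Rightarrow> nat \<Rightarrow> nat \<Rightarrow> 'o mat" where
  "Mat_sym C m n = mat (n * m) (m * n)
     (\<lambda>(r, c). if r mod m = c div n \<and> r div m = c mod n then uni C else zer C)"

end

theory Submission
  imports Defs
begin

text \<open>
  A 2-functor out of a Gray tensor product \<open>X \<otimes> Y\<close> is the same thing as a cubical functor of two
  variables: 2-functors \<open>Lf y\<close> and \<open>Rf x\<close> in each variable separately, which agree on objects, and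
  invertible 2-cells \<open>S f g\<close> that are natural and compatible with identities and composition in both
  variables.  Two 2-functors on \<open>X \<otimes> Y\<close> are equal as soon as they agree on generators, and a family of
  1-cells is 2-natural as soon as it is natural on generators.  Both facts are inductions over the
  terms by which the tensor product is presented, once it is known that these terms modulo the
  relations form a 2-category (\<open>gray_two_category\<close>, \<open>two_functor_gray_lift\<close>, \<open>fun_eq_on_gray_lift\<close>,
  \<open>two_natural_gray\<close>).

  It follows that a permutative Gray monoid can be recognized from equations between generators
  (locales \<open>cubical_monoid\<close> and \<open>symmetric_cubical_monoid\<close>).  The only equation that involves terms of
  arbitrary length is the associativity law on the transition cell of a 1-cell of \<open>M \<otimes> M\<close> and one of
  \<open>M\<close>; there the associator is defined by the same recursion by which the transition cell of a
  composite decomposes, so that the law holds by induction.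

  For matrices the equations become statements about entries.  Since the additive symmetry of \<open>C\<close> is an
  identity, the objects and the arrows of \<open>C\<close> are semirings with commutative addition, and 1-cells and
  2-cells of \<open>Mat C\<close> are matrices over them; domain, codomain and identities are semiring
  homomorphisms, and composition of arrows commutes with finite sums.  A product with \<open>A \<otimes> 1\<close> or
  \<open>1 \<otimes> B\<close> is a sum over a single index (\<open>index_mprod_blockL_right\<close> and its three variants).  Hence
  \<open>(A \<otimes> 1)(1 \<otimes> B)\<close> and \<open>(1 \<otimes> B)(A \<otimes> 1)\<close> have the entries \<open>A\<^sub>j\<^sub>i B\<^sub>l\<^sub>k\<close> and \<open>B\<^sub>l\<^sub>k A\<^sub>j\<^sub>i\<close>, the
  matrix of symmetries is a 2-cell from the first to the second, and its naturality and its
  compatibility with composition are, entry by entry, naturality of the symmetry, its hexagon axioms and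
  its additivity.  Multiplication by \<open>\<beta>\<close> permutes rows or columns, which reduces the axioms of the Gray
  symmetry to division with remainder, and for the transition cells to the fact that the symmetry of
  \<open>C\<close> is its own inverse.
\<close>

section \<open>Strict 2-categories: inverses and composite 2-functors\<close>

context two_category begin

sublocale one: category "cells0 X" "cells1 X" "src1 X" "tgt1 X" "id1 X" "comp1 X"
  by (rule cat1)

sublocale ver: category "cells1 X" "cells2 X" "src2 X" "tgt2 X" "id2 X" "vcomp X"
  by (rule vcat)

sublocale hor: category "cells0 X" "cells2 X" "\<lambda>\<alpha>. src1 X (src2 X \<alpha>)" "\<lambda>\<alpha>. tgt1 X (src2 X \<alpha>)"
    "\<lambda>x. id2 X (id1 X x)" "hcomp X"
  by (rule hcat)

lemmas cell_simps =
  one.dm_closed one.cd_closed one.ide_closed one.dm_ide one.cd_ide one.cmp_closed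
  one.dm_cmp one.cd_cmp
  ver.dm_closed ver.cd_closed ver.ide_closed ver.dm_ide ver.cd_ide ver.cmp_closed
  ver.dm_cmp ver.cd_cmp hor.cmp_closed
  src1_tgt2 tgt1_tgt2 src2_hcomp tgt2_hcomp

end

definition inverse2 :: "('o, 'f, 'c) two_cat \<Rightarrow> 'c \<Rightarrow> 'c \<Rightarrow> bool" where
  "inverse2 X \<alpha> \<beta> \<longleftrightarrow> \<alpha> \<in> cells2 X \<and> \<beta> \<in> cells2 X \<and> src2 X \<beta> = tgt2 X \<alpha> \<and> tgt2 X \<beta> = src2 X \<alpha>
     \<and> vcomp X \<beta> \<alpha> = id2 X (src2 X \<alpha>) \<and> vcomp X \<alpha> \<beta> = id2 X (tgt2 X \<alpha>)"

lemma inverse2_sym: "inverse2 X \<alpha> \<beta> \<Longrightarrow> inverse2 X \<beta> \<alpha>"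
  by (auto simp: inverse2_def)

context two_category begin

lemma inverse2_unique:
  assumes "inverse2 X \<alpha> \<beta>" "inverse2 X \<alpha> \<beta>'"
  shows "\<beta> = \<beta>'"
proof -
  have "\<beta> = vcomp X \<beta> (vcomp X \<alpha> \<beta>')"
    using assms ver.cmp_ide_right[of \<beta>] by (simp add: inverse2_def)
  also have "\<dots> = vcomp X (vcomp X \<beta> \<alpha>) \<beta>'"
    using assms by (intro ver.cmp_assoc) (auto simp: inverse2_def)
  also have "\<dots> = \<beta>'"
    using assms ver.cmp_ide_left[of \<beta>'] by (simp add: inverse2_def)
  finally show ?thesis .
qed

lemma inv2_eq: "inverse2 X \<alpha> \<beta> \<Longrightarrow> inv2 X \<alpha> = \<beta>"
  unfolding inv2_def
  by (rule the_equality) (auto simp: inverse2_def intro: inverse2_unique[unfolded inverse2_def])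

lemma inverse2_inv2: "\<exists>\<beta>. inverse2 X \<alpha> \<beta> \<Longrightarrow> inverse2 X \<alpha> (inv2 X \<alpha>)"
  using inv2_eq by auto

lemma inverse2_id2: "f \<in> cells1 X \<Longrightarrow> inverse2 X (id2 X f) (id2 X f)"
  using ver.cmp_ide_left[of "id2 X f"] by (simp add: inverse2_def cell_simps)

lemma inverse2_vcomp:
  assumes \<alpha>: "inverse2 X \<alpha> \<alpha>'" and \<beta>: "inverse2 X \<beta> \<beta>'" and c: "src2 X \<beta> = tgt2 X \<alpha>"
  shows "inverse2 X (vcomp X \<beta> \<alpha>) (vcomp X \<alpha>' \<beta>')"
proof -
  have cancel: "vcomp X (vcomp X \<alpha>' \<beta>') (vcomp X \<beta> \<alpha>) = id2 X (src2 X \<alpha>)"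
    if "inverse2 X \<alpha> \<alpha>'" "inverse2 X \<beta> \<beta>'" "src2 X \<beta> = tgt2 X \<alpha>" for \<alpha> \<alpha>' \<beta> \<beta>'
  proof -
    have "vcomp X (vcomp X \<alpha>' \<beta>') (vcomp X \<beta> \<alpha>) = vcomp X \<alpha>' (vcomp X \<beta>' (vcomp X \<beta> \<alpha>))"
      using that by (intro ver.cmp_assoc[symmetric]) (auto simp: inverse2_def cell_simps)
    also have "vcomp X \<beta>' (vcomp X \<beta> \<alpha>) = vcomp X (vcomp X \<beta>' \<beta>) \<alpha>"
      using that by (intro ver.cmp_assoc) (auto simp: inverse2_def cell_simps)
    also have "\<dots> = \<alpha>"
      using that ver.cmp_ide_left[of \<alpha>] by (auto simp: inverse2_def)
    finally show ?thesis using that by (simp add: inverse2_def)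
  qed
  show ?thesis
    using cancel[OF assms] cancel[OF inverse2_sym[OF \<beta>] inverse2_sym[OF \<alpha>]] assms
    by (simp add: inverse2_def cell_simps)
qed

lemma inverse2_hcomp:
  assumes \<alpha>: "inverse2 X \<alpha> \<alpha>'" and \<beta>: "inverse2 X \<beta> \<beta>'"
    and c: "src1 X (src2 X \<beta>) = tgt1 X (src2 X \<alpha>)"
  shows "inverse2 X (hcomp X \<beta> \<alpha>) (hcomp X \<beta>' \<alpha>')"
proof -
  have ty: "\<alpha> \<in> cells2 X" "\<alpha>' \<in> cells2 X" "\<beta> \<in> cells2 X" "\<beta>' \<in> cells2 X"
      "src2 X \<alpha>' = tgt2 X \<alpha>" "tgt2 X \<alpha>' = src2 X \<alpha>" "src2 X \<beta>' = tgt2 X \<beta>" "tgt2 X \<beta>' = src2 X \<beta>"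
    using assms by (auto simp: inverse2_def)
  have "vcomp X (hcomp X \<beta>' \<alpha>') (hcomp X \<beta> \<alpha>) = hcomp X (vcomp X \<beta>' \<beta>) (vcomp X \<alpha>' \<alpha>)"
    using ty c by (intro interchange[symmetric]) auto
  moreover have "vcomp X (hcomp X \<beta> \<alpha>) (hcomp X \<beta>' \<alpha>') = hcomp X (vcomp X \<beta> \<beta>') (vcomp X \<alpha> \<alpha>')"
    using ty c by (intro interchange[symmetric]) (auto simp: cell_simps)
  ultimately show ?thesis
    using assms ty by (simp add: inverse2_def cell_simps id2_comp1)
qed

text \<open>Conjugating an equation of 2-cells by invertible ones: this turns each relation for the
  transition cells into the mirror-image relation for their inverses.\<close>

lemma vcomp_inverse_swap:
  assumes eq: "vcomp X \<gamma> \<sigma> = vcomp X \<sigma>' \<delta>"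
    and i: "inverse2 X \<sigma> \<tau>" "inverse2 X \<sigma>' \<tau>'" and c: "\<gamma> \<in> cells2 X" "\<delta> \<in> cells2 X"
      "src2 X \<gamma> = tgt2 X \<sigma>" "tgt2 X \<delta> = src2 X \<sigma>'"
  shows "vcomp X \<delta> \<tau> = vcomp X \<tau>' \<gamma>"
proof -
  have ty: "\<sigma> \<in> cells2 X" "\<tau> \<in> cells2 X" "\<sigma>' \<in> cells2 X" "\<tau>' \<in> cells2 X"
    "src2 X \<tau> = tgt2 X \<sigma>" "tgt2 X \<tau> = src2 X \<sigma>" "src2 X \<tau>' = tgt2 X \<sigma>'" "tgt2 X \<tau>' = src2 X \<sigma>'"
    using i by (auto simp: inverse2_def)
  have s: "src2 X \<delta> = src2 X \<sigma>" "tgt2 X \<gamma> = tgt2 X \<sigma>'"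
    using arg_cong[OF eq, of "src2 X"] arg_cong[OF eq, of "tgt2 X"] c ty by (simp_all add: cell_simps)
  have "vcomp X \<delta> \<tau> = vcomp X (vcomp X \<tau>' \<sigma>') (vcomp X \<delta> \<tau>)"
    using i c ty s ver.cmp_ide_left[of "vcomp X \<delta> \<tau>"] by (simp add: inverse2_def cell_simps)
  also have "\<dots> = vcomp X \<tau>' (vcomp X \<sigma>' (vcomp X \<delta> \<tau>))"
    using ty c s by (simp add: ver.cmp_assoc cell_simps)
  also have "vcomp X \<sigma>' (vcomp X \<delta> \<tau>) = vcomp X (vcomp X \<gamma> \<sigma>) \<tau>"
    using ty c s eq by (simp add: ver.cmp_assoc cell_simps)
  also have "\<dots> = vcomp X \<gamma> (vcomp X \<sigma> \<tau>)"
    using ty c s by (simp add: ver.cmp_assoc cell_simps)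
  also have "\<dots> = \<gamma>"
    using i c ver.cmp_ide_right[of \<gamma>] by (simp add: inverse2_def)
  finally show ?thesis .
qed

end

lemma (in two_functor) map2_inverse2:
  "inverse2 X \<alpha> \<beta> \<Longrightarrow> inverse2 Y (map2 F \<alpha>) (map2 F \<beta>)"
  unfolding inverse2_def
  by (metis map2_closed map2_id2 map2_vcomp src2_map2 tgt2_map2 S.ver.dm_closed S.ver.cd_closed)

lemma (in two_functor) map2_inv2:
  "\<exists>\<beta>. inverse2 X \<alpha> \<beta> \<Longrightarrow> map2 F (inv2 X \<alpha>) = inv2 Y (map2 F \<alpha>)"
  by (metis S.inv2_eq T.inv2_eq map2_inverse2)

lemma fun_comp_simps [simp]:
  "map0 (G \<circ>\<^sub>F F) x = map0 G (map0 F x)"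
  "map1 (G \<circ>\<^sub>F F) f = map1 G (map1 F f)"
  "map2 (G \<circ>\<^sub>F F) \<alpha> = map2 G (map2 F \<alpha>)"
  by (simp_all add: fun_comp_def)

lemma fun_id_simps [simp]: "map0 fun_id x = x" "map1 fun_id f = f" "map2 fun_id \<alpha> = \<alpha>"
  by (simp_all add: fun_id_def)

lemma fun_const_simps [simp]:
  "map0 (fun_const Y y) x = y" "map1 (fun_const Y y) f = id1 Y y"
  "map2 (fun_const Y y) \<alpha> = id2 Y (id1 Y y)"
  by (simp_all add: fun_const_def)

lemma two_functor_fun_comp:
  assumes "two_functor X Y F" "two_functor Y Z G"
  shows "two_functor X Z (G \<circ>\<^sub>F F)"
proof -
  interpret F: two_functor X Y F by fact
  interpret G: two_functor Y Z G by fact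
  show ?thesis
    by unfold_locales
      (simp_all add: F.map0_closed F.map1_closed F.map2_closed F.src1_map1 F.tgt1_map1
        F.src2_map2 F.tgt2_map2 F.map1_id1 F.map1_comp1 F.map2_id2 F.map2_vcomp F.map2_hcomp
        G.map0_closed G.map1_closed G.map2_closed G.src1_map1 G.tgt1_map1
        G.src2_map2 G.tgt2_map2 G.map1_id1 G.map1_comp1 G.map2_id2 G.map2_vcomp G.map2_hcomp
        F.S.cell_simps)
qed

lemma two_functor_fun_id: "two_category X \<Longrightarrow> two_functor X X fun_id"
  by (simp add: two_functor_def two_functor_axioms_def)

lemma two_functor_fun_const:
  assumes "two_category X" "two_category Y" "y \<in> cells0 Y"
  shows "two_functor X Y (fun_const Y y)"
proof -
  interpret X: two_category X by fact
  interpret Y: two_category Y by fact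
  have "id1 Y y \<in> cells1 Y" "src1 Y (id1 Y y) = y" "tgt1 Y (id1 Y y) = y"
      "comp1 Y (id1 Y y) (id1 Y y) = id1 Y y"
    using assms(3) Y.one.cmp_ide_left[of "id1 Y y"] by (auto simp: Y.cell_simps)
  moreover from this have "vcomp Y (id2 Y (id1 Y y)) (id2 Y (id1 Y y)) = id2 Y (id1 Y y)"
    using Y.ver.cmp_ide_left[of "id2 Y (id1 Y y)"] by (simp add: Y.cell_simps)
  moreover have "hcomp Y (id2 Y (id1 Y y)) (id2 Y (id1 Y y)) = id2 Y (id1 Y y)"
    using calculation Y.id2_comp1[of "id1 Y y" "id1 Y y"] by simp
  ultimately show ?thesis
    using assms(3) by unfold_locales (simp_all add: Y.cell_simps)
qed


section \<open>The Gray tensor product is a 2-category\<close>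

locale two_category_pair = X: two_category X + Y: two_category Y
  for X :: "('o, 'f, 'c) two_cat" and Y :: "('p, 'g, 'd) two_cat"
begin

lemma wf1_boundary:
  "wf1 X Y t \<Longrightarrow> rsrc1 X Y t \<in> cells0 X \<times> cells0 Y \<and> rtgt1 X Y t \<in> cells0 X \<times> cells0 Y"
  by (induction t) (auto simp: X.cell_simps Y.cell_simps)

text \<open>Equivalent terms have equal boundaries, and equivalent 2-cell terms have equivalent boundaries.  All
  operations on classes can therefore be computed on terms, instead of on the representatives chosen
  by \<open>rep\<close>.\<close>

lemma rel1_boundary:
  "(t, s) \<in> rel1 X Y \<Longrightarrow>
     wf1 X Y t \<and> wf1 X Y s \<and> rsrc1 X Y t = rsrc1 X Y s \<and> rtgt1 X Y t = rtgt1 X Y s"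
  by (induction rule: rel1.induct)
    (auto simp: X.cell_simps Y.cell_simps dest: wf1_boundary)

lemma wf2_boundary:
  "wf2 X Y a \<Longrightarrow> wf1 X Y (rsrc2 X Y a) \<and> wf1 X Y (rtgt2 X Y a)
     \<and> rsrc1 X Y (rtgt2 X Y a) = rsrc1 X Y (rsrc2 X Y a)
     \<and> rtgt1 X Y (rtgt2 X Y a) = rtgt1 X Y (rsrc2 X Y a)"
  by (induction a) (auto simp: X.cell_simps Y.cell_simps dest: rel1_boundary)

lemma rel1_cong_left: "(t, t') \<in> rel1 X Y \<Longrightarrow> wf1 X Y (C1 t s) \<Longrightarrow> (C1 t s, C1 t' s) \<in> rel1 X Y"
  by (auto intro: rel1.cong rel1.refl)

lemma rel1_cong_right: "(s, s') \<in> rel1 X Y \<Longrightarrow> wf1 X Y (C1 t s) \<Longrightarrow> (C1 t s, C1 t s') \<in> rel1 X Y"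
  by (auto intro: rel1.cong rel1.refl)

lemma rel1_assoc_sym: "wf1 X Y (C1 t (C1 s r)) \<Longrightarrow> (C1 (C1 t s) r, C1 t (C1 s r)) \<in> rel1 X Y"
  by (intro rel1.sym[OF rel1.assoc])

lemmas boundary_simps = wf2_boundary[THEN conjunct1] wf2_boundary[THEN conjunct2, THEN conjunct1]
  wf2_boundary[THEN conjunct2, THEN conjunct2, THEN conjunct1]
  wf2_boundary[THEN conjunct2, THEN conjunct2, THEN conjunct2]

lemma rel2_boundary:
  "(a, b) \<in> rel2 X Y \<Longrightarrow> wf2 X Y a \<and> wf2 X Y b
     \<and> (rsrc2 X Y a, rsrc2 X Y b) \<in> rel1 X Y \<and> (rtgt2 X Y a, rtgt2 X Y b) \<in> rel1 X Y"
proof (induction rule: rel2.induct)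
  case (sym a b)
  then show ?case by (blast intro: rel1.sym)
next
  case (trans a b c)
  then show ?case by (blast intro: rel1.trans)
next
  case (V_cong b b' a a')
  then show ?case by (auto intro: rel1.trans rel1.sym)
next
  case (H_cong b b' a a')
  then have "wf1 X Y (C1 (rsrc2 X Y b) (rsrc2 X Y a))" "wf1 X Y (C1 (rtgt2 X Y b) (rtgt2 X Y a))"
    using wf2_boundary[of a] wf2_boundary[of b] by auto
  moreover have "rsrc1 X Y (rsrc2 X Y b') = rtgt1 X Y (rsrc2 X Y a')"
    using H_cong rel1_boundary by (metis wf2.simps(7))
  ultimately show ?case using H_cong by (auto intro: rel1.cong)
next
  case (H_assoc c b a)
  then show ?case by (auto intro!: rel1.assoc simp: boundary_simps)
next
  case (H_unit_left a)
  have "wf1 X Y (rsrc2 X Y a)" "wf1 X Y (rtgt2 X Y a)"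
    "rtgt1 X Y (rtgt2 X Y a) = rtgt1 X Y (rsrc2 X Y a)"
    using H_unit_left wf2_boundary by blast+
  then show ?case using H_unit_left wf1_boundary[of "rsrc2 X Y a"]
      rel1.unit_left[of X Y "rsrc2 X Y a"] rel1.unit_left[of X Y "rtgt2 X Y a"] by auto
next
  case (H_unit_right a)
  have "wf1 X Y (rsrc2 X Y a)" "wf1 X Y (rtgt2 X Y a)"
    "rsrc1 X Y (rtgt2 X Y a) = rsrc1 X Y (rsrc2 X Y a)"
    using H_unit_right wf2_boundary by blast+
  then show ?case using H_unit_right wf1_boundary[of "rsrc2 X Y a"]
      rel1.unit_right[of X Y "rsrc2 X Y a"] rel1.unit_right[of X Y "rtgt2 X Y a"] by auto
next
  case (interchange b' b a' a)
  from interchange have "rsrc1 X Y (rsrc2 X Y b') = rtgt1 X Y (rsrc2 X Y a')"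
    by (auto simp: boundary_simps dest!: rel1_boundary)
  with interchange show ?case
    by (auto intro!: rel1.refl rel1.cong simp: boundary_simps)
next
  case (Sig_id_left x g)
  have "(C1 (L1 (id1 X x) (tgt1 Y g)) (R1 x g), R1 x g) \<in> rel1 X Y"
    using Sig_id_left rel1.unit_left[of X Y "R1 x g"]
    by (intro rel1.trans[OF rel1_cong_left[OF rel1.L_id]]) (auto simp: X.cell_simps Y.cell_simps)
  moreover have "(C1 (R1 x g) (L1 (id1 X x) (src1 Y g)), R1 x g) \<in> rel1 X Y"
    using Sig_id_left rel1.unit_right[of X Y "R1 x g"]
    by (intro rel1.trans[OF rel1_cong_right[OF rel1.L_id]]) (auto simp: X.cell_simps Y.cell_simps)
  ultimately show ?case using Sig_id_left by (simp add: X.cell_simps)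
next
  case (Sig_id_right f y)
  have "(C1 (L1 f y) (R1 (src1 X f) (id1 Y y)), L1 f y) \<in> rel1 X Y"
    using Sig_id_right rel1.unit_right[of X Y "L1 f y"]
    by (intro rel1.trans[OF rel1_cong_right[OF rel1.R_id]]) (auto simp: X.cell_simps Y.cell_simps)
  moreover have "(C1 (R1 (tgt1 X f) (id1 Y y)) (L1 f y), L1 f y) \<in> rel1 X Y"
    using Sig_id_right rel1.unit_left[of X Y "L1 f y"]
    by (intro rel1.trans[OF rel1_cong_left[OF rel1.R_id]]) (auto simp: X.cell_simps Y.cell_simps)
  ultimately show ?case using Sig_id_right by (simp add: Y.cell_simps)
next
  case (Sig_comp_left f f' g)
  then have "(C1 (L1 (comp1 X f' f) (tgt1 Y g)) (R1 (src1 X f) g),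
      C1 (L1 f' (tgt1 Y g)) (C1 (L1 f (tgt1 Y g)) (R1 (src1 X f) g))) \<in> rel1 X Y"
    by (intro rel1.trans[OF rel1_cong_left[OF rel1.L_comp] rel1_assoc_sym])
      (auto simp: X.cell_simps Y.cell_simps)
  moreover have "(C1 (R1 (tgt1 X f') g) (L1 (comp1 X f' f) (src1 Y g)),
      C1 (C1 (R1 (tgt1 X f') g) (L1 f' (src1 Y g))) (L1 f (src1 Y g))) \<in> rel1 X Y"
    using Sig_comp_left
    by (intro rel1.trans[OF rel1_cong_right[OF rel1.L_comp] rel1.assoc])
      (auto simp: X.cell_simps Y.cell_simps)
  ultimately show ?case using Sig_comp_left
    by (auto simp: X.cell_simps Y.cell_simps intro: rel1_assoc_sym)
next
  case (Sig_comp_right f g g')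
  then have "(C1 (L1 f (tgt1 Y g')) (R1 (src1 X f) (comp1 Y g' g)),
      C1 (C1 (L1 f (tgt1 Y g')) (R1 (src1 X f) g')) (R1 (src1 X f) g)) \<in> rel1 X Y"
    by (intro rel1.trans[OF rel1_cong_right[OF rel1.R_comp] rel1.assoc])
      (auto simp: X.cell_simps Y.cell_simps)
  moreover have "(C1 (R1 (tgt1 X f) (comp1 Y g' g)) (L1 f (src1 Y g)),
      C1 (R1 (tgt1 X f) g') (C1 (R1 (tgt1 X f) g) (L1 f (src1 Y g)))) \<in> rel1 X Y"
    using Sig_comp_right
    by (intro rel1.trans[OF rel1_cong_left[OF rel1.R_comp] rel1_assoc_sym])
      (auto simp: X.cell_simps Y.cell_simps)
  ultimately show ?case using Sig_comp_right
    by (auto simp: X.cell_simps Y.cell_simps intro: rel1.assoc)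
qed (auto simp: X.cell_simps Y.cell_simps boundary_simps dest: rel1_boundary intro: rel1.intros)

lemma cls1_eq_iff: "wf1 X Y t \<Longrightarrow> cls1 X Y t = cls1 X Y s \<longleftrightarrow> (t, s) \<in> rel1 X Y"
  unfolding cls1_def by (auto intro: rel1.refl rel1.sym rel1.trans)

lemma cls1_eqI: "(t, s) \<in> rel1 X Y \<Longrightarrow> cls1 X Y t = cls1 X Y s"
  using cls1_eq_iff rel1_boundary by blast

lemma cls2_eq_iff: "wf2 X Y a \<Longrightarrow> cls2 X Y a = cls2 X Y b \<longleftrightarrow> (a, b) \<in> rel2 X Y"
  unfolding cls2_def by (auto intro: rel2.refl rel2.sym rel2.trans)

lemma cls2_eqI: "(a, b) \<in> rel2 X Y \<Longrightarrow> cls2 X Y a = cls2 X Y b"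
  using cls2_eq_iff rel2_boundary by blast

lemma rep_cls1: "wf1 X Y t \<Longrightarrow> (t, rep (cls1 X Y t)) \<in> rel1 X Y"
  unfolding rep_def cls1_def by (rule someI2[of _ t]) (auto intro: rel1.refl)

lemma rep_cls2: "wf2 X Y a \<Longrightarrow> (a, rep (cls2 X Y a)) \<in> rel2 X Y"
  unfolding rep_def cls2_def by (rule someI2[of _ a]) (auto intro: rel2.refl)

lemma cells0_gray: "cells0 (X \<otimes>\<^sub>G Y) = cells0 X \<times> cells0 Y"
  by (simp add: gray_def)

lemma cells1_gray: "cells1 (X \<otimes>\<^sub>G Y) = cls1 X Y ` {t. wf1 X Y t}"
  by (auto simp: gray_def quotient_def cls1_def)

lemma cells2_gray: "cells2 (X \<otimes>\<^sub>G Y) = cls2 X Y ` {a. wf2 X Y a}"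
  by (auto simp: gray_def quotient_def cls2_def)

lemma src1_gray: "wf1 X Y t \<Longrightarrow> src1 (X \<otimes>\<^sub>G Y) (cls1 X Y t) = rsrc1 X Y t"
  using rel1_boundary[OF rep_cls1] by (simp add: gray_def)

lemma tgt1_gray: "wf1 X Y t \<Longrightarrow> tgt1 (X \<otimes>\<^sub>G Y) (cls1 X Y t) = rtgt1 X Y t"
  using rel1_boundary[OF rep_cls1] by (simp add: gray_def)

lemma src2_gray: "wf2 X Y a \<Longrightarrow> src2 (X \<otimes>\<^sub>G Y) (cls2 X Y a) = cls1 X Y (rsrc2 X Y a)"
  using rel2_boundary[OF rep_cls2, of a] by (auto simp: gray_def cls1_eq_iff boundary_simps intro: rel1.sym)

lemma tgt2_gray: "wf2 X Y a \<Longrightarrow> tgt2 (X \<otimes>\<^sub>G Y) (cls2 X Y a) = cls1 X Y (rtgt2 X Y a)"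
  using rel2_boundary[OF rep_cls2, of a] by (auto simp: gray_def cls1_eq_iff boundary_simps intro: rel1.sym)

lemma id1_gray: "id1 (X \<otimes>\<^sub>G Y) z = cls1 X Y (I1 z)"
  by (simp add: gray_def)

lemma comp1_gray: "wf1 X Y (C1 t s) \<Longrightarrow> comp1 (X \<otimes>\<^sub>G Y) (cls1 X Y t) (cls1 X Y s) = cls1 X Y (C1 t s)"
  using rel1.cong[OF rep_cls1 rep_cls1, of t s] cls1_eq_iff[of "C1 t s"]
  by (auto simp: gray_def)

lemma id2_gray: "wf1 X Y t \<Longrightarrow> id2 (X \<otimes>\<^sub>G Y) (cls1 X Y t) = cls2 X Y (I2 t)"
  using rel2.I_cong[OF rep_cls1, of t] cls2_eq_iff[of "I2 t"] by (auto simp: gray_def)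

lemma vcomp_gray: "wf2 X Y (V2 b a) \<Longrightarrow> vcomp (X \<otimes>\<^sub>G Y) (cls2 X Y b) (cls2 X Y a) = cls2 X Y (V2 b a)"
  using rel2.V_cong[OF rep_cls2 rep_cls2, of b a] cls2_eq_iff[of "V2 b a"]
  by (auto simp: gray_def)

lemma hcomp_gray: "wf2 X Y (H2 b a) \<Longrightarrow> hcomp (X \<otimes>\<^sub>G Y) (cls2 X Y b) (cls2 X Y a) = cls2 X Y (H2 b a)"
  using rel2.H_cong[OF rep_cls2 rep_cls2, of b a] cls2_eq_iff[of "H2 b a"]
  by (auto simp: gray_def)

lemmas gray_simps = cells0_gray cells1_gray cells2_gray src1_gray tgt1_gray src2_gray tgt2_gray
  id1_gray comp1_gray id2_gray vcomp_gray hcomp_gray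

lemma gray_two_category: "two_category (X \<otimes>\<^sub>G Y)"
proof -
  have interchange: "vcomp (X \<otimes>\<^sub>G Y) (hcomp (X \<otimes>\<^sub>G Y) (cls2 X Y b') (cls2 X Y a')) (cls2 X Y (H2 b a))
      = cls2 X Y (H2 (V2 b' b) (V2 a' a))"
    if "wf2 X Y (V2 b' b)" "wf2 X Y (V2 a' a)" "wf2 X Y (H2 b a)" for a a' b b'
    using rel2.interchange[OF that] that
    by (metis cls2_eqI hcomp_gray rel2_boundary vcomp_gray wf2.simps(6))
  show ?thesis
    by unfold_locales
      (auto simp: gray_simps wf1_boundary cls1_eq_iff boundary_simps rel1.refl rel1.assoc
          rel1.unit_left rel1.unit_right interchange[simplified]
        intro!: cls1_eqI[OF rel1.unit_left] cls1_eqI[OF rel1.unit_right] cls1_eqI[OF rel1.assoc]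
          cls2_eqI[OF rel2.V_unit_left] cls2_eqI[OF rel2.V_unit_right] cls2_eqI[OF rel2.V_assoc]
          cls2_eqI[OF rel2.H_unit_left] cls2_eqI[OF rel2.H_unit_right] cls2_eqI[OF rel2.H_assoc]
          cls2_eqI[OF rel2.H_id] imageI
        del: equalityI subsetI)
qed

end

section \<open>The universal property of the Gray tensor product\<close>

lemma (in two_category_pair) cls1_rep: "c \<in> cells1 (X \<otimes>\<^sub>G Y) \<Longrightarrow> wf1 X Y (rep c) \<and> cls1 X Y (rep c) = c"
  unfolding cells1_gray using rel1_boundary[OF rep_cls1] cls1_eqI[OF rep_cls1] by auto

lemma (in two_category_pair) cls2_rep: "c \<in> cells2 (X \<otimes>\<^sub>G Y) \<Longrightarrow> wf2 X Y (rep c) \<and> cls2 X Y (rep c) = c"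
  unfolding cells2_gray using rel2_boundary[OF rep_cls2] cls2_eqI[OF rep_cls2] by auto

lemma (in two_category_pair) cls_closed:
  "wf1 X Y t \<Longrightarrow> cls1 X Y t \<in> cells1 (X \<otimes>\<^sub>G Y)"
  "wf2 X Y a \<Longrightarrow> cls2 X Y a \<in> cells2 (X \<otimes>\<^sub>G Y)"
  by (auto simp: cells1_gray cells2_gray)

lemmas (in two_category_pair) boundary_gray = cells0_gray src1_gray tgt1_gray src2_gray tgt2_gray

lemmas (in two_category_pair) composition_gray =
  id1_gray comp1_gray id2_gray vcomp_gray hcomp_gray

text \<open>The typing part of the data for a 2-functor on \<open>X \<otimes> Y\<close>.  It is separated from the relations since
  it already determines a value, with the right boundary, on every term.\<close>

locale gray_data = two_category_pair X Y + Z: two_category Z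
  for X :: "('o, 'f, 'c) two_cat" and Y :: "('p, 'g, 'd) two_cat" and Z :: "('q, 'h, 'e) two_cat" +
  fixes Lf :: "'p \<Rightarrow> ('o, 'f, 'c, 'q, 'h, 'e) two_fun"
    and Rf :: "'o \<Rightarrow> ('p, 'g, 'd, 'q, 'h, 'e) two_fun"
    and S :: "'f \<Rightarrow> 'g \<Rightarrow> 'e"
  assumes Lf: "y \<in> cells0 Y \<Longrightarrow> two_functor X Z (Lf y)"
    and Rf: "x \<in> cells0 X \<Longrightarrow> two_functor Y Z (Rf x)"
    and map0_agree: "\<lbrakk>x \<in> cells0 X; y \<in> cells0 Y\<rbrakk> \<Longrightarrow> map0 (Rf x) y = map0 (Lf y) x"
    and S_invertible: "\<lbrakk>f \<in> cells1 X; g \<in> cells1 Y\<rbrakk> \<Longrightarrow> \<exists>\<tau>. inverse2 Z (S f g) \<tau>"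
    and src2_S: "\<lbrakk>f \<in> cells1 X; g \<in> cells1 Y\<rbrakk> \<Longrightarrow>
      src2 Z (S f g) = comp1 Z (map1 (Lf (tgt1 Y g)) f) (map1 (Rf (src1 X f)) g)"
    and tgt2_S: "\<lbrakk>f \<in> cells1 X; g \<in> cells1 Y\<rbrakk> \<Longrightarrow>
      tgt2 Z (S f g) = comp1 Z (map1 (Rf (tgt1 X f)) g) (map1 (Lf (src1 Y g)) f)"
begin

lemmas functor_simps =
  two_functor.map0_closed[OF Lf] two_functor.map1_closed[OF Lf] two_functor.map2_closed[OF Lf]
  two_functor.src1_map1[OF Lf] two_functor.tgt1_map1[OF Lf]
  two_functor.src2_map2[OF Lf] two_functor.tgt2_map2[OF Lf] two_functor.map1_id1[OF Lf]
  two_functor.map1_comp1[OF Lf] two_functor.map2_id2[OF Lf] two_functor.map2_vcomp[OF Lf]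
  two_functor.map2_hcomp[OF Lf]
  two_functor.map0_closed[OF Rf] two_functor.map1_closed[OF Rf] two_functor.map2_closed[OF Rf]
  two_functor.src1_map1[OF Rf] two_functor.tgt1_map1[OF Rf]
  two_functor.src2_map2[OF Rf] two_functor.tgt2_map2[OF Rf] two_functor.map1_id1[OF Rf]
  two_functor.map1_comp1[OF Rf] two_functor.map2_id2[OF Rf] two_functor.map2_vcomp[OF Rf]
  two_functor.map2_hcomp[OF Rf]
  map0_agree

lemmas all_simps = functor_simps X.cell_simps Y.cell_simps Z.cell_simps

lemma S_closed: "\<lbrakk>f \<in> cells1 X; g \<in> cells1 Y\<rbrakk> \<Longrightarrow> S f g \<in> cells2 Z"
  using S_invertible[of f g] by (auto simp: inverse2_def)

lemma S_inverse: "\<lbrakk>f \<in> cells1 X; g \<in> cells1 Y\<rbrakk> \<Longrightarrow> inverse2 Z (S f g) (inv2 Z (S f g))"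
  using Z.inverse2_inv2[OF S_invertible] by simp

lemma lift1_boundary:
  "wf1 X Y t \<Longrightarrow> lift1 Z Lf Rf t \<in> cells1 Z
     \<and> src1 Z (lift1 Z Lf Rf t) = map0 (Lf (snd (rsrc1 X Y t))) (fst (rsrc1 X Y t))
     \<and> tgt1 Z (lift1 Z Lf Rf t) = map0 (Lf (snd (rtgt1 X Y t))) (fst (rtgt1 X Y t))"
  by (induction t) (auto simp: all_simps)

lemmas lift1_simps = lift1_boundary[THEN conjunct1] lift1_boundary[THEN conjunct2, THEN conjunct1]
  lift1_boundary[THEN conjunct2, THEN conjunct2]

lemma lift1_rel: "(t, s) \<in> rel1 X Y \<Longrightarrow> lift1 Z Lf Rf t = lift1 Z Lf Rf s"
proof (induction rule: rel1.induct)
  case (assoc t s r)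
  then show ?case by (simp add: lift1_simps Z.one.cmp_assoc)
next
  case (unit_left t)
  then show ?case using Z.one.cmp_ide_left[of "lift1 Z Lf Rf t"] by (simp add: lift1_simps)
next
  case (unit_right t)
  then show ?case using Z.one.cmp_ide_right[of "lift1 Z Lf Rf t"] by (simp add: lift1_simps)
qed (simp_all add: all_simps)

lemma lift2_boundary:
  "wf2 X Y a \<Longrightarrow> lift2 Z Lf Rf S a \<in> cells2 Z
     \<and> src2 Z (lift2 Z Lf Rf S a) = lift1 Z Lf Rf (rsrc2 X Y a)
     \<and> tgt2 Z (lift2 Z Lf Rf S a) = lift1 Z Lf Rf (rtgt2 X Y a)"
proof (induction a)
  case (SigInv f g)
  then show ?case using S_inverse[of f g] by (auto simp: inverse2_def src2_S tgt2_S)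
next
  case (V2 b a)
  then show ?case using lift1_rel[of "rsrc2 X Y b" "rtgt2 X Y a"] by (simp add: Z.cell_simps)
qed (simp_all add: all_simps lift1_simps boundary_simps S_closed src2_S tgt2_S)

lemmas lift2_simps = lift2_boundary[THEN conjunct1] lift2_boundary[THEN conjunct2, THEN conjunct1]
  lift2_boundary[THEN conjunct2, THEN conjunct2]

text \<open>Composing with a 2-functor can be carried out term by term.  This holds at the level of typed data,
  so that it applies to the associator, whose transition cells are given by recursion on terms.\<close>

lemma map1_lift1:
  assumes "two_functor Z W G" "wf1 X Y t"
  shows "map1 G (lift1 Z Lf Rf t) = lift1 W (\<lambda>y. G \<circ>\<^sub>F Lf y) (\<lambda>x. G \<circ>\<^sub>F Rf x) t"
proof -
  interpret G: two_functor Z W G by fact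
  show ?thesis using assms(2)
    by (induction t) (auto simp: G.map1_id1 G.map1_comp1 lift1_simps all_simps)
qed

lemma map2_lift2:
  assumes "two_functor Z W G" "wf2 X Y a"
  shows "map2 G (lift2 Z Lf Rf S a)
    = lift2 W (\<lambda>y. G \<circ>\<^sub>F Lf y) (\<lambda>x. G \<circ>\<^sub>F Rf x) (\<lambda>f g. map2 G (S f g)) a"
proof -
  interpret G: two_functor Z W G by fact
  show ?thesis using assms(2)
  proof (induction a)
    case (V2 b a)
    then show ?case using lift1_rel[of "rsrc2 X Y b" "rtgt2 X Y a"]
      by (simp add: lift2_simps G.map2_vcomp)
  qed (simp_all add: map1_lift1[OF assms(1)] G.map2_id2 G.map2_hcomp lift1_simps lift2_simps
      G.map2_inv2 S_invertible boundary_simps)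
qed

lemma map1_gray_lift: "wf1 X Y t \<Longrightarrow> map1 (gray_lift Z Lf Rf S) (cls1 X Y t) = lift1 Z Lf Rf t"
  using lift1_rel[OF rep_cls1, of t] by (simp add: gray_lift_def)

end

lemma map0_gray_lift: "map0 (gray_lift Z Lf Rf S) z = map0 (Lf (snd z)) (fst z)"
  by (simp add: gray_lift_def)

text \<open>The full data of a cubical functor of two variables; the six equations are the images of the
  relations for the transition cells.\<close>

locale gray_cocycle = gray_data X Y Z Lf Rf S
  for X :: "('o, 'f, 'c) two_cat" and Y :: "('p, 'g, 'd) two_cat" and Z :: "('q, 'h, 'e) two_cat"
    and Lf :: "'p \<Rightarrow> ('o, 'f, 'c, 'q, 'h, 'e) two_fun"
    and Rf :: "'o \<Rightarrow> ('p, 'g, 'd, 'q, 'h, 'e) two_fun"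
    and S :: "'f \<Rightarrow> 'g \<Rightarrow> 'e" +
  assumes S_nat_left: "\<lbrakk>\<alpha> \<in> cells2 X; g \<in> cells1 Y\<rbrakk> \<Longrightarrow>
      vcomp Z (hcomp Z (id2 Z (map1 (Rf (tgt1 X (src2 X \<alpha>))) g)) (map2 (Lf (src1 Y g)) \<alpha>))
        (S (src2 X \<alpha>) g)
      = vcomp Z (S (tgt2 X \<alpha>) g)
        (hcomp Z (map2 (Lf (tgt1 Y g)) \<alpha>) (id2 Z (map1 (Rf (src1 X (src2 X \<alpha>))) g)))"
    and S_nat_right: "\<lbrakk>f \<in> cells1 X; \<beta> \<in> cells2 Y\<rbrakk> \<Longrightarrow>
      vcomp Z (hcomp Z (map2 (Rf (tgt1 X f)) \<beta>) (id2 Z (map1 (Lf (src1 Y (src2 Y \<beta>))) f)))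
        (S f (src2 Y \<beta>))
      = vcomp Z (S f (tgt2 Y \<beta>))
        (hcomp Z (id2 Z (map1 (Lf (tgt1 Y (src2 Y \<beta>))) f)) (map2 (Rf (src1 X f)) \<beta>))"
    and S_id_left: "\<lbrakk>x \<in> cells0 X; g \<in> cells1 Y\<rbrakk> \<Longrightarrow> S (id1 X x) g = id2 Z (map1 (Rf x) g)"
    and S_id_right: "\<lbrakk>f \<in> cells1 X; y \<in> cells0 Y\<rbrakk> \<Longrightarrow> S f (id1 Y y) = id2 Z (map1 (Lf y) f)"
    and S_comp_left: "\<lbrakk>f \<in> cells1 X; f' \<in> cells1 X; src1 X f' = tgt1 X f; g \<in> cells1 Y\<rbrakk> \<Longrightarrow>
      S (comp1 X f' f) g = vcomp Z (hcomp Z (S f' g) (id2 Z (map1 (Lf (src1 Y g)) f)))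
        (hcomp Z (id2 Z (map1 (Lf (tgt1 Y g)) f')) (S f g))"
    and S_comp_right: "\<lbrakk>f \<in> cells1 X; g \<in> cells1 Y; g' \<in> cells1 Y; src1 Y g' = tgt1 Y g\<rbrakk> \<Longrightarrow>
      S f (comp1 Y g' g) = vcomp Z (hcomp Z (id2 Z (map1 (Rf (tgt1 X f)) g')) (S f g))
        (hcomp Z (S f g') (id2 Z (map1 (Rf (src1 X f)) g)))"
begin

lemma lift2_rel: "(a, b) \<in> rel2 X Y \<Longrightarrow> lift2 Z Lf Rf S a = lift2 Z Lf Rf S b"
proof (induction rule: rel2.induct)
  case (I_cong t s)
  then show ?case by (simp add: lift1_rel[OF I_cong])
next
  case (V_assoc c b a)
  then show ?case
    using lift1_rel[of "rsrc2 X Y b" "rtgt2 X Y a"] lift1_rel[of "rsrc2 X Y c" "rtgt2 X Y b"]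
    by (simp add: lift2_simps Z.ver.cmp_assoc)
next
  case (V_unit_left a)
  then show ?case using Z.ver.cmp_ide_left[of "lift2 Z Lf Rf S a"] by (simp add: lift2_simps)
next
  case (V_unit_right a)
  then show ?case using Z.ver.cmp_ide_right[of "lift2 Z Lf Rf S a"] by (simp add: lift2_simps)
next
  case (H_assoc c b a)
  then show ?case using Z.hor.cmp_assoc[of "lift2 Z Lf Rf S a" "lift2 Z Lf Rf S b" "lift2 Z Lf Rf S c"]
    by (simp add: lift2_simps lift1_simps boundary_simps)
next
  case (H_unit_left a)
  then show ?case using Z.hor.cmp_ide_left[of "lift2 Z Lf Rf S a"]
    by (simp add: lift2_simps lift1_simps boundary_simps)
next
  case (H_unit_right a)
  then show ?case using Z.hor.cmp_ide_right[of "lift2 Z Lf Rf S a"]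
    by (simp add: lift2_simps lift1_simps boundary_simps)
next
  case (H_id t s)
  then show ?case by (simp add: lift1_simps Z.id2_comp1)
next
  case (interchange b' b a' a)
  then show ?case
    using lift1_rel[of "rsrc2 X Y b'" "rtgt2 X Y b"] lift1_rel[of "rsrc2 X Y a'" "rtgt2 X Y a"]
    by (simp add: lift2_simps lift1_simps boundary_simps Z.interchange)
next
  case (Sig_inv_left f g)
  then show ?case using S_inverse[of f g] by (simp add: inverse2_def src2_S)
next
  case (Sig_inv_right f g)
  then show ?case using S_inverse[of f g] by (simp add: inverse2_def tgt2_S)
qed (simp_all add: functor_simps S_nat_left S_nat_right S_id_left S_id_right S_comp_left S_comp_right)

lemma map2_gray_lift: "wf2 X Y a \<Longrightarrow> map2 (gray_lift Z Lf Rf S) (cls2 X Y a) = lift2 Z Lf Rf S a"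
  using lift2_rel[OF rep_cls2, of a] by (simp add: gray_lift_def)

lemma two_functor_gray_lift: "two_functor (X \<otimes>\<^sub>G Y) Z (gray_lift Z Lf Rf S)"
proof -
  interpret G: two_category "X \<otimes>\<^sub>G Y" by (rule gray_two_category)
  show ?thesis
    by unfold_locales
      (auto simp: gray_simps cls1_eq_iff map0_gray_lift map1_gray_lift map2_gray_lift
        lift1_simps lift2_simps boundary_simps functor_simps)
qed

end

lemma (in two_category_pair) Sig_inverse:
  assumes "f \<in> cells1 X" "g \<in> cells1 Y"
  shows "inverse2 (X \<otimes>\<^sub>G Y) (cls2 X Y (Sig f g)) (cls2 X Y (SigInv f g))"
  using assms cls2_eqI[OF rel2.Sig_inv_left[OF assms]] cls2_eqI[OF rel2.Sig_inv_right[OF assms]]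
  by (simp add: inverse2_def cls_closed boundary_gray composition_gray X.cell_simps Y.cell_simps rel1.refl)

text \<open>The generators of the tensor product are themselves such data, and the induced 2-functor is
  the identity: every cell is the lift of a term for it.\<close>

lemma (in two_category_pair) gray_cocycle_generators:
  "gray_cocycle X Y (X \<otimes>\<^sub>G Y) (gray_L X Y) (gray_R X Y) (gray_Sig X Y)"
proof -
  interpret G: two_category "X \<otimes>\<^sub>G Y" by (rule gray_two_category)
  have L: "two_functor X (X \<otimes>\<^sub>G Y) (gray_L X Y y)" if "y \<in> cells0 Y" for y
    using that
    by unfold_locales
      (simp_all add: gray_L_def cls_closed boundary_gray composition_gray X.cell_simps
        cls1_eqI[OF rel1.L_id] cls1_eqI[OF rel1.L_comp]
        cls2_eqI[OF rel2.L_id] cls2_eqI[OF rel2.L_vcomp] cls2_eqI[OF rel2.L_hcomp] rel1.refl)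
  have R: "two_functor Y (X \<otimes>\<^sub>G Y) (gray_R X Y x)" if "x \<in> cells0 X" for x
    using that
    by unfold_locales
      (simp_all add: gray_R_def cls_closed boundary_gray composition_gray Y.cell_simps
        cls1_eqI[OF rel1.R_id] cls1_eqI[OF rel1.R_comp]
        cls2_eqI[OF rel2.R_id] cls2_eqI[OF rel2.R_vcomp] cls2_eqI[OF rel2.R_hcomp] rel1.refl)
  interpret D: gray_data X Y "X \<otimes>\<^sub>G Y" "gray_L X Y" "gray_R X Y" "gray_Sig X Y"
  proof (intro gray_data.intro gray_data_axioms.intro, goal_cases)
    case 1 show ?case by (rule two_category_pair_axioms)
  next
    case 2 show ?case by (rule G.two_category_axioms)
  next
    case 3 then show ?case by (rule L)
  next
    case 4 then show ?case by (rule R)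
  next
    case (6 f g) then show ?case unfolding gray_Sig_def using Sig_inverse by blast
  qed (simp_all add: gray_L_def gray_R_def gray_Sig_def boundary_gray composition_gray
      X.cell_simps Y.cell_simps)
  show ?thesis
  proof (unfold_locales, goal_cases)
    case (1 \<alpha> g)
    note r = rel2.Sig_nat_left[of \<alpha> X g Y, OF 1]
    show ?case using cls2_eqI[OF r] rel2_boundary[OF r] 1
      by (simp add: gray_L_def gray_R_def gray_Sig_def boundary_gray composition_gray X.cell_simps Y.cell_simps)
  next
    case (2 f \<alpha>)
    note r = rel2.Sig_nat_right[of f X \<alpha> Y, OF 2]
    show ?case using cls2_eqI[OF r] rel2_boundary[OF r] 2
      by (simp add: gray_L_def gray_R_def gray_Sig_def boundary_gray composition_gray X.cell_simps Y.cell_simps)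
  next
    case (3 x g)
    then show ?case using cls2_eqI[OF rel2.Sig_id_left[of x X g Y]]
      by (simp add: gray_R_def gray_Sig_def boundary_gray composition_gray)
  next
    case (4 f y)
    then show ?case using cls2_eqI[OF rel2.Sig_id_right[of f X y Y]]
      by (simp add: gray_L_def gray_Sig_def boundary_gray composition_gray)
  next
    case (5 f f' g)
    note r = rel2.Sig_comp_left[of f X f' g Y, OF 5]
    show ?case using cls2_eqI[OF r] rel2_boundary[OF r] 5
      by (simp add: gray_L_def gray_R_def gray_Sig_def boundary_gray composition_gray X.cell_simps Y.cell_simps)
  next
    case (6 f g g')
    note r = rel2.Sig_comp_right[of f X g Y g', OF 6]
    show ?case using cls2_eqI[OF r] rel2_boundary[OF r] 6
      by (simp add: gray_L_def gray_R_def gray_Sig_def boundary_gray composition_gray X.cell_simps Y.cell_simps)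
  qed
qed

context two_category_pair begin

lemma lift1_generators:
  "wf1 X Y t \<Longrightarrow> lift1 (X \<otimes>\<^sub>G Y) (gray_L X Y) (gray_R X Y) t = cls1 X Y t"
  by (induction t) (auto simp: gray_L_def gray_R_def composition_gray)

lemma lift2_generators:
  "wf2 X Y a \<Longrightarrow> lift2 (X \<otimes>\<^sub>G Y) (gray_L X Y) (gray_R X Y) (gray_Sig X Y) a = cls2 X Y a"
proof (induction a)
  case (SigInv f g)
  interpret G: two_category "X \<otimes>\<^sub>G Y" by (rule gray_two_category)
  show ?case using SigInv Sig_inverse[of f g] by (simp add: gray_Sig_def G.inv2_eq)
qed (simp_all add: gray_L_def gray_R_def gray_Sig_def composition_gray lift1_generators)

end

lemma lift1_cong:
  assumes "wf1 X Y t"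
    and "\<And>x y. \<lbrakk>x \<in> cells0 X; y \<in> cells0 Y\<rbrakk> \<Longrightarrow> map0 (Lf y) x = map0 (Lf' y) x"
    and "\<And>f y. \<lbrakk>f \<in> cells1 X; y \<in> cells0 Y\<rbrakk> \<Longrightarrow> map1 (Lf y) f = map1 (Lf' y) f"
    and "\<And>x g. \<lbrakk>x \<in> cells0 X; g \<in> cells1 Y\<rbrakk> \<Longrightarrow> map1 (Rf x) g = map1 (Rf' x) g"
  shows "lift1 Z Lf Rf t = lift1 Z Lf' Rf' t"
  using assms(1) by (induction t) (auto simp: assms(2-))

lemma (in two_category_pair) lift2_cong:
  assumes "wf2 X Y a"
    and "\<And>x y. \<lbrakk>x \<in> cells0 X; y \<in> cells0 Y\<rbrakk> \<Longrightarrow> map0 (Lf y) x = map0 (Lf' y) x"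
    and "\<And>f y. \<lbrakk>f \<in> cells1 X; y \<in> cells0 Y\<rbrakk> \<Longrightarrow> map1 (Lf y) f = map1 (Lf' y) f"
    and "\<And>x g. \<lbrakk>x \<in> cells0 X; g \<in> cells1 Y\<rbrakk> \<Longrightarrow> map1 (Rf x) g = map1 (Rf' x) g"
    and "\<And>\<alpha> y. \<lbrakk>\<alpha> \<in> cells2 X; y \<in> cells0 Y\<rbrakk> \<Longrightarrow> map2 (Lf y) \<alpha> = map2 (Lf' y) \<alpha>"
    and "\<And>x \<alpha>. \<lbrakk>x \<in> cells0 X; \<alpha> \<in> cells2 Y\<rbrakk> \<Longrightarrow> map2 (Rf x) \<alpha> = map2 (Rf' x) \<alpha>"
    and "\<And>f g. \<lbrakk>f \<in> cells1 X; g \<in> cells1 Y\<rbrakk> \<Longrightarrow> S f g = S' f g"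
  shows "lift2 Z Lf Rf S a = lift2 Z Lf' Rf' S' a"
  using assms(1)
proof (induction a)
  case (I2 t)
  then show ?case using lift1_cong[of X Y t Lf Lf' Rf Rf'] assms(2-4) by simp
qed (auto simp: assms(5-7))

text \<open>Uniqueness in the universal property, for a 2-functor \<open>H\<close> applied to the values of a lift.  With
  typed data on the right-hand side, the associator and the unit isomorphisms are covered as they stand.\<close>

lemma (in gray_data) fun_eq_on_gray_lift:
  assumes F: "two_functor (X \<otimes>\<^sub>G Y) W F" and H: "two_functor Z W H"
    and o: "\<And>x y. \<lbrakk>x \<in> cells0 X; y \<in> cells0 Y\<rbrakk> \<Longrightarrow> map0 F (x, y) = map0 H (map0 (Lf y) x)"
    and l1: "\<And>f y. \<lbrakk>f \<in> cells1 X; y \<in> cells0 Y\<rbrakk> \<Longrightarrow> map1 F (cls1 X Y (L1 f y)) = map1 H (map1 (Lf y) f)"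
    and r1: "\<And>x g. \<lbrakk>x \<in> cells0 X; g \<in> cells1 Y\<rbrakk> \<Longrightarrow> map1 F (cls1 X Y (R1 x g)) = map1 H (map1 (Rf x) g)"
    and l2: "\<And>\<alpha> y. \<lbrakk>\<alpha> \<in> cells2 X; y \<in> cells0 Y\<rbrakk> \<Longrightarrow> map2 F (cls2 X Y (L2 \<alpha> y)) = map2 H (map2 (Lf y) \<alpha>)"
    and r2: "\<And>x \<alpha>. \<lbrakk>x \<in> cells0 X; \<alpha> \<in> cells2 Y\<rbrakk> \<Longrightarrow> map2 F (cls2 X Y (R2 x \<alpha>)) = map2 H (map2 (Rf x) \<alpha>)"
    and s: "\<And>f g. \<lbrakk>f \<in> cells1 X; g \<in> cells1 Y\<rbrakk> \<Longrightarrow> map2 F (cls2 X Y (Sig f g)) = map2 H (S f g)"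
  shows "fun_eq_on (X \<otimes>\<^sub>G Y) F (H \<circ>\<^sub>F gray_lift Z Lf Rf S)"
proof -
  interpret D: gray_cocycle X Y "X \<otimes>\<^sub>G Y" "gray_L X Y" "gray_R X Y" "gray_Sig X Y"
    by (rule gray_cocycle_generators)
  have 1: "map1 F (cls1 X Y t) = map1 H (lift1 Z Lf Rf t)" if "wf1 X Y t" for t
    using that
    by (simp add: D.map1_lift1[OF F that, unfolded lift1_generators[OF that]] map1_lift1[OF H that])
      (rule lift1_cong, auto simp: gray_L_def gray_R_def o l1 r1)
  have 2: "map2 F (cls2 X Y a) = map2 H (lift2 Z Lf Rf S a)" if "wf2 X Y a" for a
    using that
    by (simp add: D.map2_lift2[OF F that, unfolded lift2_generators[OF that]] map2_lift2[OF H that])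
      (rule lift2_cong, auto simp: gray_L_def gray_R_def gray_Sig_def o l1 r1 l2 r2 s)
  have "map1 F c = map1 H (lift1 Z Lf Rf (rep c))" if "c \<in> cells1 (X \<otimes>\<^sub>G Y)" for c
    using 1[of "rep c"] cls1_rep[OF that] by simp
  moreover have "map2 F c = map2 H (lift2 Z Lf Rf S (rep c))" if "c \<in> cells2 (X \<otimes>\<^sub>G Y)" for c
    using 2[of "rep c"] cls2_rep[OF that] by simp
  ultimately show ?thesis
    by (auto simp: fun_eq_on_def gray_lift_def o cells0_gray)
qed

lemma (in two_category_pair) fun_eq_on_gray:
  assumes F: "two_functor (X \<otimes>\<^sub>G Y) W F" and G: "two_functor (X \<otimes>\<^sub>G Y) W G"
    and o: "\<And>x y. \<lbrakk>x \<in> cells0 X; y \<in> cells0 Y\<rbrakk> \<Longrightarrow> map0 F (x, y) = map0 G (x, y)"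
    and l1: "\<And>f y. \<lbrakk>f \<in> cells1 X; y \<in> cells0 Y\<rbrakk> \<Longrightarrow> map1 F (cls1 X Y (L1 f y)) = map1 G (cls1 X Y (L1 f y))"
    and r1: "\<And>x g. \<lbrakk>x \<in> cells0 X; g \<in> cells1 Y\<rbrakk> \<Longrightarrow> map1 F (cls1 X Y (R1 x g)) = map1 G (cls1 X Y (R1 x g))"
    and l2: "\<And>\<alpha> y. \<lbrakk>\<alpha> \<in> cells2 X; y \<in> cells0 Y\<rbrakk> \<Longrightarrow> map2 F (cls2 X Y (L2 \<alpha> y)) = map2 G (cls2 X Y (L2 \<alpha> y))"
    and r2: "\<And>x \<alpha>. \<lbrakk>x \<in> cells0 X; \<alpha> \<in> cells2 Y\<rbrakk> \<Longrightarrow> map2 F (cls2 X Y (R2 x \<alpha>)) = map2 G (cls2 X Y (R2 x \<alpha>))"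
    and s: "\<And>f g. \<lbrakk>f \<in> cells1 X; g \<in> cells1 Y\<rbrakk> \<Longrightarrow> map2 F (cls2 X Y (Sig f g)) = map2 G (cls2 X Y (Sig f g))"
  shows "fun_eq_on (X \<otimes>\<^sub>G Y) F G"
proof -
  interpret D: gray_cocycle X Y "X \<otimes>\<^sub>G Y" "gray_L X Y" "gray_R X Y" "gray_Sig X Y"
    by (rule gray_cocycle_generators)
  have "fun_eq_on (X \<otimes>\<^sub>G Y) F (G \<circ>\<^sub>F gray_lift (X \<otimes>\<^sub>G Y) (gray_L X Y) (gray_R X Y) (gray_Sig X Y))"
    by (rule D.fun_eq_on_gray_lift[OF F G])
      (auto simp: gray_L_def gray_R_def gray_Sig_def o l1 r1 l2 r2 s)
  moreover have "fun_eq_on (X \<otimes>\<^sub>G Y) G (G \<circ>\<^sub>F gray_lift (X \<otimes>\<^sub>G Y) (gray_L X Y) (gray_R X Y) (gray_Sig X Y))"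
    by (rule D.fun_eq_on_gray_lift[OF G G]) (auto simp: gray_L_def gray_R_def gray_Sig_def)
  ultimately show ?thesis by (simp add: fun_eq_on_def)
qed

text \<open>The tensor product of two 2-functors is the case where the given data are the generators of
  \<open>X \<otimes> Y\<close>.\<close>

lemma (in gray_cocycle) precompose:
  fixes X' :: "('o1, 'f1, 'c1) two_cat" and Y' :: "('p1, 'g1, 'd1) two_cat"
  assumes F: "two_functor X' X F" and G: "two_functor Y' Y G"
  shows "gray_cocycle X' Y' Z (\<lambda>y. Lf (map0 G y) \<circ>\<^sub>F F) (\<lambda>x. Rf (map0 F x) \<circ>\<^sub>F G)
    (\<lambda>f g. S (map1 F f) (map1 G g))"
proof -
  interpret F: two_functor X' X F by fact
  interpret G: two_functor Y' Y G by fact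
  interpret P: two_category_pair X' Y' by unfold_locales
  note FG = F.map0_closed F.map1_closed F.map2_closed F.src1_map1 F.tgt1_map1 F.src2_map2 F.tgt2_map2
    F.map1_id1 F.map1_comp1 G.map0_closed G.map1_closed G.map2_closed G.src1_map1 G.tgt1_map1
    G.src2_map2 G.tgt2_map2 G.map1_id1 G.map1_comp1 F.S.cell_simps G.S.cell_simps
  interpret D: gray_data X' Y' Z "\<lambda>y. Lf (map0 G y) \<circ>\<^sub>F F" "\<lambda>x. Rf (map0 F x) \<circ>\<^sub>F G"
    "\<lambda>f g. S (map1 F f) (map1 G g)"
  proof (intro gray_data.intro gray_data_axioms.intro, goal_cases)
    case 1 show ?case by (rule P.two_category_pair_axioms)
  next
    case 2 show ?case by (rule Z.two_category_axioms)
  next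
    case 3 then show ?case by (intro two_functor_fun_comp[OF F] Lf G.map0_closed)
  next
    case 4 then show ?case by (intro two_functor_fun_comp[OF G] Rf F.map0_closed)
  next
    case 5 then show ?case by (simp add: map0_agree FG)
  next
    case 6 then show ?case by (intro S_invertible F.map1_closed G.map1_closed)
  next
    case (7 f g) then show ?case using src2_S[of "map1 F f" "map1 G g"] by (simp add: FG)
  next
    case (8 f g) then show ?case using tgt2_S[of "map1 F f" "map1 G g"] by (simp add: FG)
  qed
  show ?thesis
  proof (unfold_locales, goal_cases)
    case (1 \<alpha> g) then show ?case using S_nat_left[of "map2 F \<alpha>" "map1 G g"] by (simp add: FG)
  next
    case (2 f \<beta>) then show ?case using S_nat_right[of "map1 F f" "map2 G \<beta>"] by (simp add: FG)
  next
    case (3 x g) then show ?case using S_id_left[of "map0 F x" "map1 G g"] by (simp add: FG)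
  next
    case (4 f y) then show ?case using S_id_right[of "map1 F f" "map0 G y"] by (simp add: FG)
  next
    case (5 f f' g)
    then show ?case using S_comp_left[of "map1 F f" "map1 F f'" "map1 G g"] by (simp add: FG)
  next
    case (6 f g g')
    then show ?case using S_comp_right[of "map1 F f" "map1 G g" "map1 G g'"] by (simp add: FG)
  qed
qed

lemma gray_cocycle_map:
  assumes "two_functor X X' F" "two_functor Y Y' G"
  shows "gray_cocycle X Y (X' \<otimes>\<^sub>G Y') (\<lambda>y. gray_L X' Y' (map0 G y) \<circ>\<^sub>F F)
    (\<lambda>x. gray_R X' Y' (map0 F x) \<circ>\<^sub>F G) (\<lambda>f g. gray_Sig X' Y' (map1 F f) (map1 G g))"
proof -
  interpret F: two_functor X X' F by fact
  interpret G: two_functor Y Y' G by fact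
  interpret P: two_category_pair X' Y' by unfold_locales
  show ?thesis by (rule gray_cocycle.precompose[OF P.gray_cocycle_generators assms])
qed

lemmas two_functor_gray_map =
  gray_cocycle.two_functor_gray_lift[OF gray_cocycle_map, folded gray_map_def]

lemma gray_lift_generators:
  assumes "gray_cocycle X Y Z Lf Rf S"
  shows "\<lbrakk>f \<in> cells1 X; y \<in> cells0 Y\<rbrakk> \<Longrightarrow> map1 (gray_lift Z Lf Rf S) (cls1 X Y (L1 f y)) = map1 (Lf y) f"
    and "\<lbrakk>x \<in> cells0 X; g \<in> cells1 Y\<rbrakk> \<Longrightarrow> map1 (gray_lift Z Lf Rf S) (cls1 X Y (R1 x g)) = map1 (Rf x) g"
    and "\<lbrakk>\<alpha> \<in> cells2 X; y \<in> cells0 Y\<rbrakk> \<Longrightarrow> map2 (gray_lift Z Lf Rf S) (cls2 X Y (L2 \<alpha> y)) = map2 (Lf y) \<alpha>"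
    and "\<lbrakk>x \<in> cells0 X; \<beta> \<in> cells2 Y\<rbrakk> \<Longrightarrow> map2 (gray_lift Z Lf Rf S) (cls2 X Y (R2 x \<beta>)) = map2 (Rf x) \<beta>"
    and "\<lbrakk>f \<in> cells1 X; g \<in> cells1 Y\<rbrakk> \<Longrightarrow> map2 (gray_lift Z Lf Rf S) (cls2 X Y (Sig f g)) = S f g"
    and "\<lbrakk>f \<in> cells1 X; g \<in> cells1 Y\<rbrakk> \<Longrightarrow>
      map2 (gray_lift Z Lf Rf S) (cls2 X Y (SigInv f g)) = inv2 Z (S f g)"
proof -
  interpret gray_cocycle X Y Z Lf Rf S by fact
  show "\<lbrakk>f \<in> cells1 X; y \<in> cells0 Y\<rbrakk> \<Longrightarrow> map1 (gray_lift Z Lf Rf S) (cls1 X Y (L1 f y)) = map1 (Lf y) f"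
    "\<lbrakk>x \<in> cells0 X; g \<in> cells1 Y\<rbrakk> \<Longrightarrow> map1 (gray_lift Z Lf Rf S) (cls1 X Y (R1 x g)) = map1 (Rf x) g"
    "\<lbrakk>\<alpha> \<in> cells2 X; y \<in> cells0 Y\<rbrakk> \<Longrightarrow> map2 (gray_lift Z Lf Rf S) (cls2 X Y (L2 \<alpha> y)) = map2 (Lf y) \<alpha>"
    "\<lbrakk>x \<in> cells0 X; \<beta> \<in> cells2 Y\<rbrakk> \<Longrightarrow> map2 (gray_lift Z Lf Rf S) (cls2 X Y (R2 x \<beta>)) = map2 (Rf x) \<beta>"
    "\<lbrakk>f \<in> cells1 X; g \<in> cells1 Y\<rbrakk> \<Longrightarrow> map2 (gray_lift Z Lf Rf S) (cls2 X Y (Sig f g)) = S f g"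
    "\<lbrakk>f \<in> cells1 X; g \<in> cells1 Y\<rbrakk> \<Longrightarrow>
      map2 (gray_lift Z Lf Rf S) (cls2 X Y (SigInv f g)) = inv2 Z (S f g)"
    by (simp_all add: map1_gray_lift map2_gray_lift)
qed

text \<open>Exchanging the two variables replaces the transition cells by their inverses.\<close>

lemma (in gray_cocycle) swap:
  assumes S': "\<And>f g. \<lbrakk>f \<in> cells1 X; g \<in> cells1 Y\<rbrakk> \<Longrightarrow> inverse2 Z (S f g) (S' g f)"
  shows "gray_cocycle Y X Z Rf Lf S'"
proof -
  interpret P: two_category_pair Y X by unfold_locales
  interpret D: gray_data Y X Z Rf Lf S'
  proof (intro gray_data.intro gray_data_axioms.intro, goal_cases)
    case 1 show ?case by (rule P.two_category_pair_axioms)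
  next
    case 2 show ?case by (rule Z.two_category_axioms)
  next
    case 3 then show ?case by (rule Rf)
  next
    case 4 then show ?case by (rule Lf)
  next
    case 5 then show ?case by (simp add: map0_agree)
  next
    case (6 f g) then show ?case using inverse2_sym[OF S'] by blast
  next
    case (7 f g) then show ?case using S'[of g f] by (simp add: inverse2_def tgt2_S)
  next
    case (8 f g) then show ?case using S'[of g f] by (simp add: inverse2_def src2_S)
  qed
  show ?thesis
  proof (unfold_locales, goal_cases)
    case (1 \<beta> f)
    then show ?case
      by (intro Z.vcomp_inverse_swap[OF S_nat_right[of f \<beta>] S' S'])
        (simp_all add: all_simps src2_S tgt2_S)
  next
    case (2 g \<alpha>)
    then show ?case
      by (intro Z.vcomp_inverse_swap[OF S_nat_left[of \<alpha> g] S' S'])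
        (simp_all add: all_simps src2_S tgt2_S)
  next
    case (3 y f)
    then show ?case
      using S'[of f "id1 Y y"] Z.inverse2_unique[OF _ Z.inverse2_id2]
      by (simp add: S_id_right all_simps)
  next
    case (4 g x)
    then show ?case
      using S'[of "id1 X x" g] Z.inverse2_unique[OF _ Z.inverse2_id2]
      by (simp add: S_id_left all_simps)
  next
    case (5 g g' f)
    have "inverse2 Z (S f (comp1 Y g' g)) (vcomp Z (hcomp Z (S' g' f) (id2 Z (map1 (Rf (src1 X f)) g)))
        (hcomp Z (id2 Z (map1 (Rf (tgt1 X f)) g')) (S' g f)))"
      using 5 by (simp add: S_comp_right)
        (intro Z.inverse2_vcomp Z.inverse2_hcomp Z.inverse2_id2 S', simp_all add: all_simps src2_S tgt2_S S_closed Z.one.cmp_assoc)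
    then show ?case
      using 5 S'[of f "comp1 Y g' g"] Z.inverse2_unique by (simp add: Y.cell_simps)
  next
    case (6 g f f')
    have "inverse2 Z (S (comp1 X f' f) g) (vcomp Z (hcomp Z (id2 Z (map1 (Lf (tgt1 Y g)) f')) (S' g f))
        (hcomp Z (S' g f') (id2 Z (map1 (Lf (src1 Y g)) f))))"
      using 6 by (simp add: S_comp_left)
        (intro Z.inverse2_vcomp Z.inverse2_hcomp Z.inverse2_id2 S', simp_all add: all_simps src2_S tgt2_S S_closed Z.one.cmp_assoc)
    then show ?case
      using 6 S'[of "comp1 X f' f" g] Z.inverse2_unique by (simp add: X.cell_simps)
  qed
qed

section \<open>2-natural transformations on a Gray tensor product\<close>

text \<open>Naturality of a family of 1-cells says that certain squares commute, in the category of 1-cells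
  and, for 2-cells, in the category given by horizontal composition.  The following two facts about
  squares in a category serve both.\<close>

context category begin

lemma square_paste:
  assumes "f \<in> Ar" "f' \<in> Ar" "g \<in> Ar" "g' \<in> Ar" "p \<in> Ar" "q \<in> Ar" "r \<in> Ar"
    and "dm q = cd f" "dm g = cd p" "dm r = cd f'" "dm g' = cd q" "dm f' = cd f" "dm g' = cd g"
    and "cmp q f = cmp g p" "cmp r f' = cmp g' q"
  shows "cmp r (cmp f' f) = cmp (cmp g' g) p"
proof -
  have "cmp r (cmp f' f) = cmp (cmp g' q) f"
    using assms by (simp add: cmp_assoc)
  also have "\<dots> = cmp g' (cmp g p)"
    using assms(14) cmp_assoc[of f q g'] assms by simp
  finally show ?thesis using assms by (simp add: cmp_assoc)
qed

lemma square_flip: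
  assumes "f \<in> Ar" "g \<in> Ar" "p \<in> Ar" "q \<in> Ar" "p' \<in> Ar" "q' \<in> Ar"
    and "dm q = cd f" "dm g = cd p" "dm p' = cd p" "cd p' = dm p" "dm q' = cd q" "cd q' = dm q"
    and "dm f = dm p" "cd g = cd q"
    and eq: "cmp q f = cmp g p" and p: "cmp p p' = ide (dm p')" and q: "cmp q' q = ide (dm q)"
  shows "cmp q' g = cmp f p'"
proof -
  have "cmp q' g = cmp q' (cmp g (cmp p p'))"
    using assms cmp_ide_right[of g] by simp
  also have "\<dots> = cmp q' (cmp (cmp q f) p')"
    using assms(1-14) cmp_assoc[of p' p g] by (simp add: eq)
  also have "\<dots> = cmp (cmp (cmp q' q) f) p'"
    using assms(1-14) cmp_assoc[of p' "cmp q f" q'] cmp_assoc[of f q q']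
    by (simp add: dm_cmp cd_cmp cmp_closed)
  also have "cmp (cmp q' q) f = f"
    using assms cmp_ide_left[of f] by simp
  finally show ?thesis .
qed

end

text \<open>Naturality at \<open>SigInv f g\<close> follows from naturality at \<open>Sig f g\<close>, since both sides of the former are
  inverse to the sides of the latter.\<close>

lemma (in two_category_pair) two_natural_gray:
  assumes F: "two_functor (X \<otimes>\<^sub>G Y) Z F" and G: "two_functor (X \<otimes>\<^sub>G Y) Z G"
    and \<theta>: "\<And>z. z \<in> cells0 X \<times> cells0 Y \<Longrightarrow>
      \<theta> z \<in> cells1 Z \<and> src1 Z (\<theta> z) = map0 F z \<and> tgt1 Z (\<theta> z) = map0 G z"
    and l1: "\<And>f y. \<lbrakk>f \<in> cells1 X; y \<in> cells0 Y\<rbrakk> \<Longrightarrow>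
      comp1 Z (\<theta> (tgt1 X f, y)) (map1 F (cls1 X Y (L1 f y)))
      = comp1 Z (map1 G (cls1 X Y (L1 f y))) (\<theta> (src1 X f, y))"
    and r1: "\<And>x g. \<lbrakk>x \<in> cells0 X; g \<in> cells1 Y\<rbrakk> \<Longrightarrow>
      comp1 Z (\<theta> (x, tgt1 Y g)) (map1 F (cls1 X Y (R1 x g)))
      = comp1 Z (map1 G (cls1 X Y (R1 x g))) (\<theta> (x, src1 Y g))"
    and l2: "\<And>\<alpha> y. \<lbrakk>\<alpha> \<in> cells2 X; y \<in> cells0 Y\<rbrakk> \<Longrightarrow>
      hcomp Z (id2 Z (\<theta> (tgt1 X (src2 X \<alpha>), y))) (map2 F (cls2 X Y (L2 \<alpha> y)))
      = hcomp Z (map2 G (cls2 X Y (L2 \<alpha> y))) (id2 Z (\<theta> (src1 X (src2 X \<alpha>), y)))"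
    and r2: "\<And>x \<alpha>. \<lbrakk>x \<in> cells0 X; \<alpha> \<in> cells2 Y\<rbrakk> \<Longrightarrow>
      hcomp Z (id2 Z (\<theta> (x, tgt1 Y (src2 Y \<alpha>)))) (map2 F (cls2 X Y (R2 x \<alpha>)))
      = hcomp Z (map2 G (cls2 X Y (R2 x \<alpha>))) (id2 Z (\<theta> (x, src1 Y (src2 Y \<alpha>))))"
    and s: "\<And>f g. \<lbrakk>f \<in> cells1 X; g \<in> cells1 Y\<rbrakk> \<Longrightarrow>
      hcomp Z (id2 Z (\<theta> (tgt1 X f, tgt1 Y g))) (map2 F (cls2 X Y (Sig f g)))
      = hcomp Z (map2 G (cls2 X Y (Sig f g))) (id2 Z (\<theta> (src1 X f, src1 Y g)))"
  shows "two_natural (X \<otimes>\<^sub>G Y) Z F G \<theta>"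
proof -
  interpret F: two_functor "X \<otimes>\<^sub>G Y" Z F by fact
  interpret G: two_functor "X \<otimes>\<^sub>G Y" Z G by fact
  note \<theta>_simps = \<theta>[THEN conjunct1] \<theta>[THEN conjunct2, THEN conjunct1] \<theta>[THEN conjunct2, THEN conjunct2]
  note FG = F.map0_closed F.map1_closed F.map2_closed F.src1_map1 F.tgt1_map1 F.src2_map2 F.tgt2_map2
    G.map0_closed G.map1_closed G.map2_closed G.src1_map1 G.tgt1_map1 G.src2_map2 G.tgt2_map2
    cls_closed boundary_gray \<theta>_simps wf1_boundary boundary_simps F.T.cell_simps
  have F1: "map1 F (cls1 X Y (C1 t s)) = comp1 Z (map1 F (cls1 X Y t)) (map1 F (cls1 X Y s))"
    and G1: "map1 G (cls1 X Y (C1 t s)) = comp1 Z (map1 G (cls1 X Y t)) (map1 G (cls1 X Y s))"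
    if "wf1 X Y (C1 t s)" for t s
    using that F.map1_comp1[of "cls1 X Y s" "cls1 X Y t"] G.map1_comp1[of "cls1 X Y s" "cls1 X Y t"]
    by (simp_all add: cls_closed boundary_gray composition_gray)
  have FV: "map2 F (cls2 X Y (V2 b a)) = vcomp Z (map2 F (cls2 X Y b)) (map2 F (cls2 X Y a))"
    and GV: "map2 G (cls2 X Y (V2 b a)) = vcomp Z (map2 G (cls2 X Y b)) (map2 G (cls2 X Y a))"
    if "wf2 X Y (V2 b a)" for a b
    using that F.map2_vcomp[of "cls2 X Y a" "cls2 X Y b"] G.map2_vcomp[of "cls2 X Y a" "cls2 X Y b"]
      cls1_eqI[of "rsrc2 X Y b" "rtgt2 X Y a"]
    by (simp_all add: cls_closed boundary_gray composition_gray)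
  have FH: "map2 F (cls2 X Y (H2 b a)) = hcomp Z (map2 F (cls2 X Y b)) (map2 F (cls2 X Y a))"
    and GH: "map2 G (cls2 X Y (H2 b a)) = hcomp Z (map2 G (cls2 X Y b)) (map2 G (cls2 X Y a))"
    if "wf2 X Y (H2 b a)" for a b
    using that F.map2_hcomp[of "cls2 X Y a" "cls2 X Y b"] G.map2_hcomp[of "cls2 X Y a" "cls2 X Y b"]
    by (simp_all add: cls_closed boundary_gray composition_gray boundary_simps)
  have nat1: "comp1 Z (\<theta> (rtgt1 X Y t)) (map1 F (cls1 X Y t))
      = comp1 Z (map1 G (cls1 X Y t)) (\<theta> (rsrc1 X Y t))" if "wf1 X Y t" for t
    using that
  proof (induction t)
    case (I1 z)
    then show ?case
      using F.map1_id1[of z] G.map1_id1[of z] F.T.one.cmp_ide_left[of "\<theta> z"] F.T.one.cmp_ide_right[of "\<theta> z"]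
      by (simp add: id1_gray cells0_gray \<theta>)
  next
    case (C1 t s)
    then have "wf1 X Y t" "wf1 X Y s" "rsrc1 X Y t = rtgt1 X Y s" by auto
    then show ?case
      using F.T.one.square_paste[of "map1 F (cls1 X Y s)" "map1 F (cls1 X Y t)" "map1 G (cls1 X Y s)"
          "map1 G (cls1 X Y t)" "\<theta> (rsrc1 X Y s)" "\<theta> (rtgt1 X Y s)" "\<theta> (rtgt1 X Y t)"] C1
      by (simp add: F1 G1 FG)
  qed (simp_all add: l1 r1)
  have nat2: "hcomp Z (id2 Z (\<theta> (rtgt1 X Y (rsrc2 X Y a)))) (map2 F (cls2 X Y a))
      = hcomp Z (map2 G (cls2 X Y a)) (id2 Z (\<theta> (rsrc1 X Y (rsrc2 X Y a))))" if "wf2 X Y a" for a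
    using that
  proof (induction a)
    case (I2 t)
    then show ?case
      using nat1[of t] F.map2_id2[of "cls1 X Y t"] G.map2_id2[of "cls1 X Y t"]
      by (simp add: FG composition_gray F.T.id2_comp1[symmetric])
  next
    case (SigInv f g)
    then have inv: "inverse2 (X \<otimes>\<^sub>G Y) (cls2 X Y (Sig f g)) (cls2 X Y (SigInv f g))"
      by (simp add: Sig_inverse)
    have "inverse2 Z (hcomp Z (id2 Z (\<theta> (tgt1 X f, tgt1 Y g))) (map2 F (cls2 X Y (Sig f g))))
        (hcomp Z (id2 Z (\<theta> (tgt1 X f, tgt1 Y g))) (map2 F (cls2 X Y (SigInv f g))))"
      using SigInv by (intro F.T.inverse2_hcomp F.T.inverse2_id2 F.map2_inverse2[OF inv])
        (simp_all add: FG X.cell_simps Y.cell_simps)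
    moreover have "inverse2 Z (hcomp Z (map2 G (cls2 X Y (Sig f g))) (id2 Z (\<theta> (src1 X f, src1 Y g))))
        (hcomp Z (map2 G (cls2 X Y (SigInv f g))) (id2 Z (\<theta> (src1 X f, src1 Y g))))"
      using SigInv by (intro F.T.inverse2_hcomp F.T.inverse2_id2 G.map2_inverse2[OF inv])
        (simp_all add: FG X.cell_simps Y.cell_simps)
    ultimately show ?case
      using SigInv s[of f g] F.T.inverse2_unique by simp
  next
    case (V2 b a)
    then have w: "wf2 X Y b" "wf2 X Y a" "(rsrc2 X Y b, rtgt2 X Y a) \<in> rel1 X Y" by auto
    have c: "cls1 X Y (rsrc2 X Y b) = cls1 X Y (rtgt2 X Y a)"
        "rsrc1 X Y (rsrc2 X Y b) = rsrc1 X Y (rsrc2 X Y a)"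
        "rtgt1 X Y (rsrc2 X Y b) = rtgt1 X Y (rsrc2 X Y a)"
      using w cls1_eqI rel1_boundary[OF w(3)] by (auto simp: boundary_simps)
    let ?p = "\<theta> (rsrc1 X Y (rsrc2 X Y a))" and ?q = "\<theta> (rtgt1 X Y (rsrc2 X Y a))"
    have pq: "vcomp Z (id2 Z ?p) (id2 Z ?p) = id2 Z ?p" "vcomp Z (id2 Z ?q) (id2 Z ?q) = id2 Z ?q"
      using w F.T.ver.cmp_ide_left[of "id2 Z ?p"] F.T.ver.cmp_ide_left[of "id2 Z ?q"] by (simp_all add: FG)
    have "hcomp Z (id2 Z ?q) (vcomp Z (map2 F (cls2 X Y b)) (map2 F (cls2 X Y a)))
        = vcomp Z (hcomp Z (id2 Z ?q) (map2 F (cls2 X Y b))) (hcomp Z (id2 Z ?q) (map2 F (cls2 X Y a)))"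
      using F.T.interchange[of "map2 F (cls2 X Y a)" "map2 F (cls2 X Y b)" "id2 Z ?q" "id2 Z ?q"] w c pq
      by (simp add: FG)
    moreover have "hcomp Z (vcomp Z (map2 G (cls2 X Y b)) (map2 G (cls2 X Y a))) (id2 Z ?p)
        = vcomp Z (hcomp Z (map2 G (cls2 X Y b)) (id2 Z ?p)) (hcomp Z (map2 G (cls2 X Y a)) (id2 Z ?p))"
      using F.T.interchange[of "id2 Z ?p" "id2 Z ?p" "map2 G (cls2 X Y a)" "map2 G (cls2 X Y b)"] w c pq
      by (simp add: FG)
    ultimately show ?case using V2 w c by (simp add: FV GV)
  next
    case (H2 b a)
    then have "wf2 X Y a" "wf2 X Y b" "rsrc1 X Y (rsrc2 X Y b) = rtgt1 X Y (rsrc2 X Y a)" by auto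
    then show ?case
      using F.T.hor.square_paste[of "map2 F (cls2 X Y a)" "map2 F (cls2 X Y b)" "map2 G (cls2 X Y a)"
          "map2 G (cls2 X Y b)" "id2 Z (\<theta> (rsrc1 X Y (rsrc2 X Y a)))" "id2 Z (\<theta> (rtgt1 X Y (rsrc2 X Y a)))"
          "id2 Z (\<theta> (rtgt1 X Y (rsrc2 X Y b)))"] H2
      by (simp add: FH GH FG)
  qed (simp_all add: l2 r2 s)
  show ?thesis
    by unfold_locales (auto simp: \<theta> cells0_gray cells1_gray cells2_gray boundary_gray boundary_simps nat1 nat2)
qed

text \<open>Each naturality square is read backwards along its two invertible sides.\<close>

lemma (in two_natural) two_natural_inverse:
  assumes "\<And>x. x \<in> cells0 X \<Longrightarrow> \<theta>' x \<in> cells1 Y \<and> src1 Y (\<theta>' x) = map0 G x \<and> tgt1 Y (\<theta>' x) = map0 F x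
    \<and> comp1 Y (\<theta>' x) (\<theta> x) = id1 Y (map0 F x) \<and> comp1 Y (\<theta> x) (\<theta>' x) = id1 Y (map0 G x)"
  shows "two_natural X Y G F \<theta>'"
proof -
  note FG = F.map0_closed F.map1_closed F.map2_closed F.src1_map1 F.tgt1_map1 F.src2_map2 F.tgt2_map2
    G.map0_closed G.map1_closed G.map2_closed G.src1_map1 G.tgt1_map1 G.src2_map2 G.tgt2_map2
    component_closed src1_component tgt1_component F.S.cell_simps F.T.cell_simps
  have id: "hcomp Y (id2 Y (\<theta>' x)) (id2 Y (\<theta> x)) = id2 Y (id1 Y (map0 F x))"
    "hcomp Y (id2 Y (\<theta> x)) (id2 Y (\<theta>' x)) = id2 Y (id1 Y (map0 G x))" if "x \<in> cells0 X" for x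
    using F.T.id2_comp1[of "\<theta> x" "\<theta>' x"] F.T.id2_comp1[of "\<theta>' x" "\<theta> x"] assms[OF that] that
    by (simp_all add: FG)
  show ?thesis
  proof (unfold_locales, goal_cases)
    case (4 f)
    then show ?case
      using F.T.one.square_flip[of "map1 F f" "map1 G f" "\<theta> (src1 X f)" "\<theta> (tgt1 X f)"
          "\<theta>' (src1 X f)" "\<theta>' (tgt1 X f)"] natural1[of f] assms
      by (simp add: FG)
  next
    case (5 \<alpha>)
    then show ?case
      using F.T.hor.square_flip[of "map2 F \<alpha>" "map2 G \<alpha>" "id2 Y (\<theta> (src1 X (src2 X \<alpha>)))"
          "id2 Y (\<theta> (tgt1 X (src2 X \<alpha>)))" "id2 Y (\<theta>' (src1 X (src2 X \<alpha>)))"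
          "id2 Y (\<theta>' (tgt1 X (src2 X \<alpha>)))"] natural2[of \<alpha>] assms id
      by (simp add: FG)
  qed (use assms in auto)
qed

section \<open>The associator and the symmetry of the Gray tensor product\<close>

lemma map0_gray_L [simp]: "map0 (gray_L X Y y) x = (x, y)"
  by (simp add: gray_L_def)

lemma map0_gray_R [simp]: "map0 (gray_R X Y x) y = (x, y)"
  by (simp add: gray_R_def)

locale two_category_triple = two_category_pair X Y + Z: two_category Z
  for X :: "('o, 'f, 'c) two_cat" and Y :: "('p, 'g, 'd) two_cat" and Z :: "('q, 'h, 'e) two_cat"
begin

sublocale YZ: two_category_pair Y Z
  by unfold_locales

sublocale XYZ: two_category_pair X "Y \<otimes>\<^sub>G Z"
  by (intro two_category_pair.intro X.two_category_axioms YZ.gray_two_category)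

sublocale gYZ: gray_cocycle Y Z "Y \<otimes>\<^sub>G Z" "gray_L Y Z" "gray_R Y Z" "gray_Sig Y Z"
  by (rule YZ.gray_cocycle_generators)

sublocale gXYZ: gray_cocycle X "Y \<otimes>\<^sub>G Z" "X \<otimes>\<^sub>G Y \<otimes>\<^sub>G Z" "gray_L X (Y \<otimes>\<^sub>G Z)" "gray_R X (Y \<otimes>\<^sub>G Z)"
    "gray_Sig X (Y \<otimes>\<^sub>G Z)"
  by (rule XYZ.gray_cocycle_generators)

text \<open>The inclusions of \<open>X \<otimes> Y\<close> and of \<open>Z\<close> into the triple product, at an object of the other
  factor.\<close>

abbreviation inL where "inL z \<equiv> gray_map X (Y \<otimes>\<^sub>G Z) fun_id (gray_L Y Z z)"

abbreviation inR where "inR w \<equiv> gray_R X (Y \<otimes>\<^sub>G Z) (fst w) \<circ>\<^sub>F gray_R Y Z (snd w)"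

lemmas inL_cocycle = gray_cocycle_map[OF two_functor_fun_id[OF X.two_category_axioms] gYZ.Lf]

lemma inL: "z \<in> cells0 Z \<Longrightarrow> two_functor (X \<otimes>\<^sub>G Y) (X \<otimes>\<^sub>G Y \<otimes>\<^sub>G Z) (inL z)"
  by (rule two_functor_gray_map[OF two_functor_fun_id[OF X.two_category_axioms] gYZ.Lf])

lemma inR: "w \<in> cells0 X \<times> cells0 Y \<Longrightarrow> two_functor Z (X \<otimes>\<^sub>G Y \<otimes>\<^sub>G Z) (inR w)"
  by (auto intro!: two_functor_fun_comp[OF gYZ.Rf gXYZ.Rf])

lemmas inL_generators = gray_lift_generators[OF inL_cocycle, folded gray_map_def]

lemma inL_map0 [simp]: "map0 (inL z) w = (fst w, snd w, z)"
  by (simp add: gray_map_def map0_gray_lift)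

lemma inL_term:
  assumes "wf1 X Y t" "z \<in> cells0 Z"
  shows "map1 (inL z) (cls1 X Y t) \<in> cells1 (X \<otimes>\<^sub>G Y \<otimes>\<^sub>G Z)"
    "src1 (X \<otimes>\<^sub>G Y \<otimes>\<^sub>G Z) (map1 (inL z) (cls1 X Y t)) = (fst (rsrc1 X Y t), snd (rsrc1 X Y t), z)"
    "tgt1 (X \<otimes>\<^sub>G Y \<otimes>\<^sub>G Z) (map1 (inL z) (cls1 X Y t)) = (fst (rtgt1 X Y t), snd (rtgt1 X Y t), z)"
  using assms two_functor.map1_closed[OF inL, of z "cls1 X Y t"]
    two_functor.src1_map1[OF inL, of z "cls1 X Y t"] two_functor.tgt1_map1[OF inL, of z "cls1 X Y t"]
  by (simp_all add: cls_closed boundary_gray)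

lemma inR_1:
  assumes "w \<in> cells0 X \<times> cells0 Y" "h \<in> cells1 Z"
  shows "map1 (inR w) h \<in> cells1 (X \<otimes>\<^sub>G Y \<otimes>\<^sub>G Z)"
    "src1 (X \<otimes>\<^sub>G Y \<otimes>\<^sub>G Z) (map1 (inR w) h) = (fst w, snd w, src1 Z h)"
    "tgt1 (X \<otimes>\<^sub>G Y \<otimes>\<^sub>G Z) (map1 (inR w) h) = (fst w, snd w, tgt1 Z h)"
  using assms two_functor.map1_closed[OF inR, of w h]
    two_functor.src1_map1[OF inR, of w h] two_functor.tgt1_map1[OF inR, of w h]
  by simp_all

lemma inL_C1:
  assumes "wf1 X Y (C1 t s)" "z \<in> cells0 Z"
  shows "map1 (inL z) (cls1 X Y (C1 t s))
    = comp1 (X \<otimes>\<^sub>G Y \<otimes>\<^sub>G Z) (map1 (inL z) (cls1 X Y t)) (map1 (inL z) (cls1 X Y s))"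
  using assms two_functor.map1_comp1[OF inL, of z "cls1 X Y s" "cls1 X Y t"]
  by (simp add: cls_closed boundary_gray composition_gray)

text \<open>The cell for a composite \<open>C1 t s\<close> exchanges \<open>h\<close> first with \<open>s\<close> and then with \<open>t\<close>; the two steps meet by
  associativity of the composition of 1-cells.\<close>

lemma assoc_Sig_boundary:
  assumes "wf1 X Y w" "h \<in> cells1 Z"
  shows "(\<exists>\<tau>. inverse2 (X \<otimes>\<^sub>G Y \<otimes>\<^sub>G Z) (assoc_Sig X Y Z h w) \<tau>)
    \<and> src2 (X \<otimes>\<^sub>G Y \<otimes>\<^sub>G Z) (assoc_Sig X Y Z h w)
      = comp1 (X \<otimes>\<^sub>G Y \<otimes>\<^sub>G Z) (map1 (inL (tgt1 Z h)) (cls1 X Y w)) (map1 (inR (rsrc1 X Y w)) h)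
    \<and> tgt2 (X \<otimes>\<^sub>G Y \<otimes>\<^sub>G Z) (assoc_Sig X Y Z h w)
      = comp1 (X \<otimes>\<^sub>G Y \<otimes>\<^sub>G Z) (map1 (inR (rtgt1 X Y w)) h) (map1 (inL (src1 Z h)) (cls1 X Y w))"
    (is "?P w")
  using assms(1)
proof (induction w)
  let ?T = "X \<otimes>\<^sub>G Y \<otimes>\<^sub>G Z"
  note T = gXYZ.Z.cell_simps
  have h: "src1 Z h \<in> cells0 Z" "tgt1 Z h \<in> cells0 Z"
    using assms(2) by (simp_all add: Z.cell_simps)
  note gr = gXYZ.functor_simps gYZ.functor_simps YZ.cells0_gray X.cell_simps Y.cell_simps Z.cell_simps
  {
    case (I1 z)
    then have z: "z \<in> cells0 X \<times> cells0 Y" by simp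
    have id: "map1 (inL c) (cls1 X Y (I1 z)) = id1 ?T (fst z, snd z, c)" if "c \<in> cells0 Z" for c
      using two_functor.map1_id1[OF inL[OF that], of z] z by (simp add: id1_gray cells0_gray)
    show ?case
      using gXYZ.Z.one.cmp_ide_left[of "map1 (inR z) h"] gXYZ.Z.one.cmp_ide_right[of "map1 (inR z) h"]
        gXYZ.Z.inverse2_id2[of "map1 (inR z) h"] inR_1[OF z assms(2)] id[OF h(1)] id[OF h(2)]
      by (auto simp: T)
  next
    case (L1 f y)
    then have fy: "f \<in> cells1 X" "y \<in> cells0 Y" by auto
    then show ?case
      using gXYZ.S_invertible[of f "map1 (gray_R Y Z y) h"] gXYZ.src2_S[of f "map1 (gray_R Y Z y) h"]
        gXYZ.tgt2_S[of f "map1 (gray_R Y Z y) h"] assms(2) h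
        inL_generators(1)[of _ f y]
      by (simp add: gYZ.functor_simps)
  next
    case (R1 x g)
    then have xg: "x \<in> cells0 X" "g \<in> cells1 Y" by auto
    have "\<exists>\<tau>. inverse2 ?T (map2 (gray_R X (Y \<otimes>\<^sub>G Z) x) (gray_Sig Y Z g h)) \<tau>"
      using two_functor.map2_inverse2[OF gXYZ.Rf[OF xg(1)] gYZ.S_inverse[OF xg(2) assms(2)]] by blast
    then show ?case
      using xg assms(2) h gYZ.S_closed[of g h] gYZ.src2_S[of g h] gYZ.tgt2_S[of g h]
        inL_generators(2)[of _ x g]
      by (simp add: gr)
  next
    case (C1 t s)
    then have w: "wf1 X Y t" "wf1 X Y s" and c: "rsrc1 X Y t = rtgt1 X Y s" by auto
    note IHt = C1(1)[OF w(1)] and IHs = C1(2)[OF w(2)]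
    obtain \<tau> \<sigma> where i: "inverse2 ?T (assoc_Sig X Y Z h t) \<tau>" "inverse2 ?T (assoc_Sig X Y Z h s) \<sigma>"
      using IHt IHs by blast
    then have cl: "assoc_Sig X Y Z h t \<in> cells2 ?T" "assoc_Sig X Y Z h s \<in> cells2 ?T"
      by (auto simp: inverse2_def)
    have w': "rsrc1 X Y t \<in> cells0 X \<times> cells0 Y" "rsrc1 X Y s \<in> cells0 X \<times> cells0 Y"
      "rtgt1 X Y t \<in> cells0 X \<times> cells0 Y" "rtgt1 X Y s \<in> cells0 X \<times> cells0 Y"
      using wf1_boundary w by auto
    note facts = inL_term[OF w(1) h(1)] inL_term[OF w(1) h(2)] inL_term[OF w(2) h(1)]
      inL_term[OF w(2) h(2)] inR_1[OF w'(1) assms(2)] inR_1[OF w'(2) assms(2)]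
      inR_1[OF w'(3) assms(2)] inR_1[OF w'(4) assms(2)]
    let ?a = "hcomp ?T (assoc_Sig X Y Z h t) (id2 ?T (map1 (inL (src1 Z h)) (cls1 X Y s)))"
    let ?b = "hcomp ?T (id2 ?T (map1 (inL (tgt1 Z h)) (cls1 X Y t))) (assoc_Sig X Y Z h s)"
    have a: "inverse2 ?T ?a (hcomp ?T \<tau> (id2 ?T (map1 (inL (src1 Z h)) (cls1 X Y s))))"
      "src2 ?T ?a = comp1 ?T (src2 ?T (assoc_Sig X Y Z h t)) (map1 (inL (src1 Z h)) (cls1 X Y s))"
      "tgt2 ?T ?a = comp1 ?T (tgt2 ?T (assoc_Sig X Y Z h t)) (map1 (inL (src1 Z h)) (cls1 X Y s))"
      using facts IHt cl c by (auto intro!: gXYZ.Z.inverse2_hcomp i gXYZ.Z.inverse2_id2 simp: T)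
    have b: "inverse2 ?T ?b (hcomp ?T (id2 ?T (map1 (inL (tgt1 Z h)) (cls1 X Y t))) \<sigma>)"
      "src2 ?T ?b = comp1 ?T (map1 (inL (tgt1 Z h)) (cls1 X Y t)) (src2 ?T (assoc_Sig X Y Z h s))"
      "tgt2 ?T ?b = comp1 ?T (map1 (inL (tgt1 Z h)) (cls1 X Y t)) (tgt2 ?T (assoc_Sig X Y Z h s))"
      using facts IHs cl c by (auto intro!: gXYZ.Z.inverse2_hcomp i gXYZ.Z.inverse2_id2 simp: T)
    have cells: "?a \<in> cells2 ?T" "?b \<in> cells2 ?T"
      using a(1) b(1) by (auto simp: inverse2_def)
    have meet: "src2 ?T ?a = tgt2 ?T ?b"
      using a(2) b(3) IHt IHs facts c by (simp add: gXYZ.Z.one.cmp_assoc)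
    show ?case
      using gXYZ.Z.inverse2_vcomp[OF b(1) a(1) meet] cells meet a(2,3) b(2,3) IHt IHs facts c
        inL_C1[OF C1(3) h(1)] inL_C1[OF C1(3) h(2)]
      by (auto simp: Let_def T gXYZ.Z.one.cmp_assoc)
  }
qed

lemma gray_data_assoc: "gray_data (X \<otimes>\<^sub>G Y) Z (X \<otimes>\<^sub>G Y \<otimes>\<^sub>G Z) inL inR (\<lambda>w h. assoc_Sig X Y Z h (rep w))"
proof (intro gray_data.intro gray_data_axioms.intro, goal_cases)
  case 1 show ?case by (intro two_category_pair.intro gray_two_category Z.two_category_axioms)
next
  case 2 show ?case by (rule gXYZ.Z.two_category_axioms)
next
  case 3 then show ?case by (rule inL)
next
  case 4 then show ?case by (intro inR) (simp add: cells0_gray)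
next
  case 5 then show ?case by simp
next
  case (6 f g) then show ?case using assoc_Sig_boundary[of "rep f" g] cls1_rep[of f] by blast
next
  case (7 f g)
  then show ?case
    using assoc_Sig_boundary[of "rep f" g] cls1_rep[of f] src1_gray[of "rep f"] by simp
next
  case (8 f g)
  then show ?case
    using assoc_Sig_boundary[of "rep f" g] cls1_rep[of f] tgt1_gray[of "rep f"] by simp
qed

end

lemma (in two_category_pair) gray_cocycle_gray_swap:
  "gray_cocycle X Y (Y \<otimes>\<^sub>G X) (gray_R Y X) (gray_L Y X) (\<lambda>f g. cls2 Y X (SigInv g f))"
proof -
  interpret P: two_category_pair Y X by unfold_locales
  interpret D: gray_cocycle Y X "Y \<otimes>\<^sub>G X" "gray_L Y X" "gray_R Y X" "gray_Sig Y X"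
    by (rule P.gray_cocycle_generators)
  show ?thesis by (rule D.swap) (simp add: gray_Sig_def P.Sig_inverse)
qed

lemmas (in two_category_pair) two_functor_gray_swap =
  gray_cocycle.two_functor_gray_lift[OF gray_cocycle_gray_swap, folded gray_swap_def]

lemmas (in two_category_pair) gray_swap_generators =
  gray_lift_generators[OF gray_cocycle_gray_swap, folded gray_swap_def]

section \<open>Recognizing permutative Gray monoids\<close>

text \<open>Gray's elementary description of a monoid: objects act from both sides by the 2-functors
  \<open>- \<odot> y = Lf y\<close> and \<open>x \<odot> - = Rf x\<close>, and the associativity and unit laws are required of generators.
  The three laws for \<open>S\<close> are the cases in which one of three factors is an object.\<close>

locale cubical_monoid = gray_cocycle M M M Lf Rf S
  for M :: "('o, 'f, 'c) two_cat"
    and Lf Rf :: "'o \<Rightarrow> ('o, 'f, 'c, 'o, 'f, 'c) two_fun"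
    and S :: "'f \<Rightarrow> 'f \<Rightarrow> 'c" +
  fixes I :: 'o
  assumes I: "I \<in> cells0 M"
    and assoc0: "\<lbrakk>x \<in> cells0 M; y \<in> cells0 M; z \<in> cells0 M\<rbrakk> \<Longrightarrow>
      map0 (Lf z) (map0 (Lf y) x) = map0 (Lf (map0 (Lf z) y)) x"
    and L_L1: "\<lbrakk>f \<in> cells1 M; y \<in> cells0 M; z \<in> cells0 M\<rbrakk> \<Longrightarrow>
      map1 (Lf z) (map1 (Lf y) f) = map1 (Lf (map0 (Lf z) y)) f"
    and L_L2: "\<lbrakk>\<alpha> \<in> cells2 M; y \<in> cells0 M; z \<in> cells0 M\<rbrakk> \<Longrightarrow>
      map2 (Lf z) (map2 (Lf y) \<alpha>) = map2 (Lf (map0 (Lf z) y)) \<alpha>"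
    and L_R1: "\<lbrakk>x \<in> cells0 M; f \<in> cells1 M; z \<in> cells0 M\<rbrakk> \<Longrightarrow>
      map1 (Lf z) (map1 (Rf x) f) = map1 (Rf x) (map1 (Lf z) f)"
    and L_R2: "\<lbrakk>x \<in> cells0 M; \<alpha> \<in> cells2 M; z \<in> cells0 M\<rbrakk> \<Longrightarrow>
      map2 (Lf z) (map2 (Rf x) \<alpha>) = map2 (Rf x) (map2 (Lf z) \<alpha>)"
    and R_R1: "\<lbrakk>x \<in> cells0 M; y \<in> cells0 M; f \<in> cells1 M\<rbrakk> \<Longrightarrow>
      map1 (Rf (map0 (Lf y) x)) f = map1 (Rf x) (map1 (Rf y) f)"
    and R_R2: "\<lbrakk>x \<in> cells0 M; y \<in> cells0 M; \<alpha> \<in> cells2 M\<rbrakk> \<Longrightarrow>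
      map2 (Rf (map0 (Lf y) x)) \<alpha> = map2 (Rf x) (map2 (Rf y) \<alpha>)"
    and S_L_left: "\<lbrakk>f \<in> cells1 M; y \<in> cells0 M; g \<in> cells1 M\<rbrakk> \<Longrightarrow>
      S (map1 (Lf y) f) g = S f (map1 (Rf y) g)"
    and S_R_left: "\<lbrakk>x \<in> cells0 M; f \<in> cells1 M; g \<in> cells1 M\<rbrakk> \<Longrightarrow>
      S (map1 (Rf x) f) g = map2 (Rf x) (S f g)"
    and S_L_right: "\<lbrakk>f \<in> cells1 M; g \<in> cells1 M; z \<in> cells0 M\<rbrakk> \<Longrightarrow>
      map2 (Lf z) (S f g) = S f (map1 (Lf z) g)"
    and unit_left0: "x \<in> cells0 M \<Longrightarrow> map0 (Lf x) I = x"
    and unit_right0: "x \<in> cells0 M \<Longrightarrow> map0 (Lf I) x = x"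
    and unit_left1: "f \<in> cells1 M \<Longrightarrow> map1 (Rf I) f = f"
    and unit_right1: "f \<in> cells1 M \<Longrightarrow> map1 (Lf I) f = f"
    and unit_left2: "\<alpha> \<in> cells2 M \<Longrightarrow> map2 (Rf I) \<alpha> = \<alpha>"
    and unit_right2: "\<alpha> \<in> cells2 M \<Longrightarrow> map2 (Lf I) \<alpha> = \<alpha>"
begin

abbreviation mul where "mul \<equiv> gray_lift M Lf Rf S"

lemmas mul_generators = gray_lift_generators[OF gray_cocycle_axioms]

lemma mul_map0 [simp]: "map0 mul (x, y) = map0 (Lf y) x"
  by (simp add: map0_gray_lift)

lemma M: "two_category M"
  by (rule X.two_category_axioms)

lemmas id_M = two_functor_fun_id[OF M]

lemma assoc: "fun_eq_on ((M \<otimes>\<^sub>G M) \<otimes>\<^sub>G M) (mul \<circ>\<^sub>F gray_map M M mul fun_id)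
    (mul \<circ>\<^sub>F gray_map M M fun_id mul \<circ>\<^sub>F gray_assoc M M M)"
proof -
  interpret T: two_category_triple M M M by unfold_locales
  interpret A: gray_data "M \<otimes>\<^sub>G M" M "M \<otimes>\<^sub>G M \<otimes>\<^sub>G M" T.inL T.inR "\<lambda>w h. assoc_Sig M M M h (rep w)"
    by (rule T.gray_data_assoc)
  note mul = two_functor_gray_lift
  note mul_id = gray_lift_generators[OF gray_cocycle_map[OF mul id_M], folded gray_map_def]
  note id_mul = gray_lift_generators[OF gray_cocycle_map[OF id_M mul], folded gray_map_def]
  let ?H = "mul \<circ>\<^sub>F gray_map M M fun_id mul"
  have H: "two_functor (M \<otimes>\<^sub>G M \<otimes>\<^sub>G M) M ?H"
    by (rule two_functor_fun_comp[OF two_functor_gray_map[OF id_M mul] mul])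
  interpret H: two_functor "M \<otimes>\<^sub>G M \<otimes>\<^sub>G M" M ?H by (rule H)
  have F: "two_functor ((M \<otimes>\<^sub>G M) \<otimes>\<^sub>G M) M (mul \<circ>\<^sub>F gray_map M M mul fun_id)"
    by (rule two_functor_fun_comp[OF two_functor_gray_map[OF mul id_M] mul])
  have H_L1: "map1 ?H (cls1 M (M \<otimes>\<^sub>G M) (L1 f yz)) = map1 (Lf (map0 mul yz)) f"
    if "f \<in> cells1 M" "yz \<in> cells0 (M \<otimes>\<^sub>G M)" for f yz
    using that id_mul(1)[of f yz] mul_generators(1)[of f "map0 mul yz"] two_functor.map0_closed[OF mul]
    by (simp add: gray_L_def)
  have H_L2: "map2 ?H (cls2 M (M \<otimes>\<^sub>G M) (L2 \<alpha> yz)) = map2 (Lf (map0 mul yz)) \<alpha>"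
    if "\<alpha> \<in> cells2 M" "yz \<in> cells0 (M \<otimes>\<^sub>G M)" for \<alpha> yz
    using that id_mul(3)[of \<alpha> yz] mul_generators(3)[of \<alpha> "map0 mul yz"] two_functor.map0_closed[OF mul]
    by (simp add: gray_L_def)
  have H_R1: "map1 ?H (cls1 M (M \<otimes>\<^sub>G M) (R1 x g)) = map1 (Rf x) (map1 mul g)"
    if "x \<in> cells0 M" "g \<in> cells1 (M \<otimes>\<^sub>G M)" for x g
    using that id_mul(2)[of x g] mul_generators(2)[of x "map1 mul g"] two_functor.map1_closed[OF mul]
    by (simp add: gray_R_def)
  have H_R2: "map2 ?H (cls2 M (M \<otimes>\<^sub>G M) (R2 x \<alpha>)) = map2 (Rf x) (map2 mul \<alpha>)"
    if "x \<in> cells0 M" "\<alpha> \<in> cells2 (M \<otimes>\<^sub>G M)" for x \<alpha>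
    using that id_mul(4)[of x \<alpha>] mul_generators(4)[of x "map2 mul \<alpha>"] two_functor.map2_closed[OF mul]
    by (simp add: gray_R_def)
  have H_Sig: "map2 ?H (cls2 M (M \<otimes>\<^sub>G M) (Sig f g)) = S f (map1 mul g)"
    if "f \<in> cells1 M" "g \<in> cells1 (M \<otimes>\<^sub>G M)" for f g
    using that id_mul(5)[of f g] mul_generators(5)[of f "map1 mul g"] two_functor.map1_closed[OF mul]
    by (simp add: gray_Sig_def)
  have gens: "\<lbrakk>f \<in> cells1 M; y \<in> cells0 M\<rbrakk> \<Longrightarrow> cls1 M M (L1 f y) \<in> cells1 (M \<otimes>\<^sub>G M)"
    "\<lbrakk>f \<in> cells1 M; y \<in> cells0 M\<rbrakk> \<Longrightarrow> cls1 M M (R1 y f) \<in> cells1 (M \<otimes>\<^sub>G M)"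
    "\<lbrakk>\<alpha> \<in> cells2 M; y \<in> cells0 M\<rbrakk> \<Longrightarrow> cls2 M M (L2 \<alpha> y) \<in> cells2 (M \<otimes>\<^sub>G M)"
    "\<lbrakk>\<alpha> \<in> cells2 M; y \<in> cells0 M\<rbrakk> \<Longrightarrow> cls2 M M (R2 y \<alpha>) \<in> cells2 (M \<otimes>\<^sub>G M)"
    "\<lbrakk>f \<in> cells1 M; g \<in> cells1 M\<rbrakk> \<Longrightarrow> cls2 M M (Sig f g) \<in> cells2 (M \<otimes>\<^sub>G M)" for f g y \<alpha>
    by (auto intro: cls_closed)
  \<comment> \<open>\<open>(x \<odot> y) \<odot> z\<close> and \<open>x \<odot> (y \<odot> z)\<close> agree as 2-functors of the first two variables\<close>
  have left: "fun_eq_on (M \<otimes>\<^sub>G M) (Lf z \<circ>\<^sub>F mul) (?H \<circ>\<^sub>F T.inL z)" if z: "z \<in> cells0 M" for z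
  proof (rule fun_eq_on_gray[OF two_functor_fun_comp[OF mul Lf[OF z]] two_functor_fun_comp[OF T.inL[OF z] H]],
      goal_cases)
    case (1 x y)
    then show ?case using z by (simp add: map0_gray_lift gray_map_def assoc0)
  next
    case (2 f y)
    then show ?case using z H_L1[of f "(y, z)"] L_L1[of f y z] T.inL_generators(1)[OF z, of f y]
      by (simp add: mul_generators cells0_gray gray_L_def)
  next
    case (3 x g)
    then show ?case using z H_R1[of x "cls1 M M (L1 g z)"] L_R1[of x g z] T.inL_generators(2)[OF z, of x g]
      by (simp add: mul_generators gens gray_L_def gray_R_def)
  next
    case (4 \<alpha> y)
    then show ?case using z H_L2[of \<alpha> "(y, z)"] L_L2[of \<alpha> y z] T.inL_generators(3)[OF z, of \<alpha> y]
      by (simp add: mul_generators cells0_gray gray_L_def)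
  next
    case (5 x \<alpha>)
    then show ?case using z H_R2[of x "cls2 M M (L2 \<alpha> z)"] L_R2[of x \<alpha> z] T.inL_generators(4)[OF z, of x \<alpha>]
      by (simp add: mul_generators gens gray_L_def gray_R_def)
  next
    case (6 f g)
    then show ?case using z H_Sig[of f "cls1 M M (L1 g z)"] S_L_right[of f g z] T.inL_generators(5)[OF z, of f g]
      by (simp add: mul_generators gens gray_L_def gray_Sig_def)
  qed
  have left1: "map1 ?H (map1 (T.inL z) w) = map1 (Lf z) (map1 mul w)"
    if "z \<in> cells0 M" "w \<in> cells1 (M \<otimes>\<^sub>G M)" for z w
    using left[OF that(1)] that(2) by (auto simp: fun_eq_on_def)
  have left2: "map2 ?H (map2 (T.inL z) w) = map2 (Lf z) (map2 mul w)"
    if "z \<in> cells0 M" "w \<in> cells2 (M \<otimes>\<^sub>G M)" for z w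
    using left[OF that(1)] that(2) by (auto simp: fun_eq_on_def)
  have right1: "map1 ?H (map1 (T.inR xy) h) = map1 (Rf (map0 mul xy)) h"
    if "xy \<in> cells0 M \<times> cells0 M" "h \<in> cells1 M" for xy h
    using that H_R1[of "fst xy" "cls1 M M (R1 (snd xy) h)"] R_R1[of "fst xy" "snd xy" h]
    by (auto simp: gray_R_def gens mul_generators)
  have right2: "map2 ?H (map2 (T.inR xy) \<alpha>) = map2 (Rf (map0 mul xy)) \<alpha>"
    if "xy \<in> cells0 M \<times> cells0 M" "\<alpha> \<in> cells2 M" for xy \<alpha>
    using that H_R2[of "fst xy" "cls2 M M (R2 (snd xy) \<alpha>)"] R_R2[of "fst xy" "snd xy" \<alpha>]
    by (auto simp: gray_R_def gens mul_generators)
  \<comment> \<open>the recursion defining \<open>assoc_Sig\<close> is matched by the relations \<open>S_id_left\<close> and \<open>S_comp_left\<close>\<close>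
  have transition: "map2 ?H (assoc_Sig M M M h w) = S (lift1 M Lf Rf w) h"
    if h: "h \<in> cells1 M" and w: "wf1 M M w" for h w
    using w
  proof (induction w)
    case (I1 z)
    then have z: "z \<in> cells0 M \<times> cells0 M" by simp
    have "map2 ?H (assoc_Sig M M M h (I1 z)) = id2 M (map1 ?H (map1 (T.inR z) h))"
      using H.map2_id2[OF T.inR_1(1)[OF z h]] by simp
    also have "\<dots> = id2 M (map1 (Rf (map0 mul z)) h)"
      using right1[OF z h] by simp
    also have "\<dots> = S (lift1 M Lf Rf (I1 z)) h"
      using z h by (auto simp: S_id_left functor_simps)
    finally show ?case .
  next
    case (L1 f y)
    then show ?case
      using h H_Sig[of f "cls1 M M (R1 y h)"] by (auto simp: gray_R_def gray_Sig_def gens mul_generators S_L_left)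
  next
    case (R1 x g)
    then show ?case
      using h H_R2[of x "cls2 M M (Sig g h)"] by (auto simp: gray_R_def gray_Sig_def gens mul_generators S_R_left)
  next
    case (C1 t s)
    let ?T = "M \<otimes>\<^sub>G M \<otimes>\<^sub>G M"
    have w: "wf1 M M t" "wf1 M M s" and c: "rsrc1 M M t = rtgt1 M M s" using C1 by auto
    have bh: "src1 M h \<in> cells0 M" "tgt1 M h \<in> cells0 M" using h by (simp_all add: X.cell_simps)
    have w': "rsrc1 M M t \<in> cells0 M \<times> cells0 M" "rsrc1 M M s \<in> cells0 M \<times> cells0 M"
      "rtgt1 M M t \<in> cells0 M \<times> cells0 M" "rtgt1 M M s \<in> cells0 M \<times> cells0 M"
      using wf1_boundary w by auto
    note facts = T.inL_term[OF w(1) bh(1)] T.inL_term[OF w(1) bh(2)] T.inL_term[OF w(2) bh(1)]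
      T.inL_term[OF w(2) bh(2)] T.inR_1[OF w'(1) h] T.inR_1[OF w'(2) h]
      T.inR_1[OF w'(3) h] T.inR_1[OF w'(4) h]
    note At = T.assoc_Sig_boundary[OF w(1) h] and As = T.assoc_Sig_boundary[OF w(2) h]
    have cl: "assoc_Sig M M M h t \<in> cells2 ?T" "assoc_Sig M M M h s \<in> cells2 ?T"
      using At As by (auto simp: inverse2_def)
    let ?a = "hcomp ?T (assoc_Sig M M M h t) (id2 ?T (map1 (T.inL (src1 M h)) (cls1 M M s)))"
    let ?b = "hcomp ?T (id2 ?T (map1 (T.inL (tgt1 M h)) (cls1 M M t))) (assoc_Sig M M M h s)"
    have a: "map2 ?H ?a = hcomp M (S (lift1 M Lf Rf t) h) (id2 M (map1 (Lf (src1 M h)) (lift1 M Lf Rf s)))"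
      using H.map2_hcomp[of "id2 ?T (map1 (T.inL (src1 M h)) (cls1 M M s))" "assoc_Sig M M M h t"]
        C1(1)[OF w(1)] cl At facts c H.map2_id2 left1[OF bh(1) cls_closed(1)[OF w(2)]] map1_gray_lift[OF w(2)]
      by (simp add: T.gXYZ.Z.cell_simps del: fun_comp_simps)
    have b: "map2 ?H ?b = hcomp M (id2 M (map1 (Lf (tgt1 M h)) (lift1 M Lf Rf t))) (S (lift1 M Lf Rf s) h)"
      using H.map2_hcomp[of "assoc_Sig M M M h s" "id2 ?T (map1 (T.inL (tgt1 M h)) (cls1 M M t))"]
        C1(2)[OF w(2)] cl As facts c H.map2_id2 left1[OF bh(2) cls_closed(1)[OF w(1)]] map1_gray_lift[OF w(1)]
      by (simp add: T.gXYZ.Z.cell_simps del: fun_comp_simps)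
    have "map2 ?H (vcomp ?T ?a ?b) = vcomp M (map2 ?H ?a) (map2 ?H ?b)"
      using cl At As facts c by (intro H.map2_vcomp) (simp_all add: T.gXYZ.Z.cell_simps T.gXYZ.Z.one.cmp_assoc)
    then show ?case
      using S_comp_left[of "lift1 M Lf Rf s" "lift1 M Lf Rf t" h] w c h lift1_simps a b
      by (simp add: Let_def del: fun_comp_simps)
  qed
  show ?thesis
    unfolding gray_assoc_def
  proof (rule A.fun_eq_on_gray_lift[OF F H], goal_cases)
    case (1 xy z)
    then show ?case by (auto simp: gray_map_def map0_gray_lift cells0_gray assoc0)
  next
    case (2 w z)
    then show ?case
      using mul_id(1)[of w z] left1[of z w] two_functor.map1_closed[OF mul]
      by (simp add: gray_L_def mul_generators)
  next
    case (3 xy h)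
    then show ?case
      using mul_id(2)[of xy h] right1[of xy h] two_functor.map0_closed[OF mul]
      by (simp add: gray_R_def mul_generators cells0_gray)
  next
    case (4 w z)
    then show ?case
      using mul_id(3)[of w z] left2[of z w] two_functor.map2_closed[OF mul]
      by (simp add: gray_L_def mul_generators)
  next
    case (5 xy h)
    then show ?case
      using mul_id(4)[of xy h] right2[of xy h] two_functor.map0_closed[OF mul]
      by (simp add: gray_R_def mul_generators cells0_gray)
  next
    case (6 w h)
    have "map1 mul w = lift1 M Lf Rf (rep w)"
      using cls1_rep[OF 6(1)] map1_gray_lift[of "rep w"] by simp
    then show ?case
      using 6 mul_id(5)[of w h] transition[of h "rep w"] cls1_rep[OF 6(1)]
      by (simp add: gray_Sig_def mul_generators lift1_simps)
  qed
qed

lemma unit_two_category: "two_category unit_two_cat"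
  by unfold_locales (simp_all add: unit_two_cat_def)

lemma unit_functor: "two_functor unit_two_cat M (fun_const M I)"
  by (rule two_functor_fun_const[OF unit_two_category M I])

lemma unit_left: "fun_eq_on (unit_two_cat \<otimes>\<^sub>G M) (mul \<circ>\<^sub>F gray_map M M (fun_const M I) fun_id) (gray_lunit M)"
proof -
  interpret U: two_category unit_two_cat by (rule unit_two_category)
  interpret P: two_category_pair unit_two_cat M by unfold_locales
  note map = gray_cocycle_map[OF unit_functor id_M]
  note gen = gray_lift_generators[OF map, folded gray_map_def]
  have F: "two_functor (unit_two_cat \<otimes>\<^sub>G M) M (mul \<circ>\<^sub>F gray_map M M (fun_const M I) fun_id)"
    by (rule two_functor_fun_comp[OF two_functor_gray_map[OF unit_functor id_M] two_functor_gray_lift])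
  interpret D: gray_data unit_two_cat M M "\<lambda>x. fun_const M x" "\<lambda>_. fun_id" "\<lambda>_ g. id2 M g"
  proof (intro gray_data.intro gray_data_axioms.intro, goal_cases)
    case 1 show ?case by (rule P.two_category_pair_axioms)
  next
    case 2 show ?case by (rule M)
  next
    case 3 then show ?case by (rule two_functor_fun_const[OF unit_two_category M])
  next
    case 4 show ?case by (rule id_M)
  next
    case (6 f g) then show ?case using X.inverse2_id2 by blast
  next
    case (7 f g) then show ?case using X.one.cmp_ide_left[of g] by (simp add: X.cell_simps)
  next
    case (8 f g) then show ?case using X.one.cmp_ide_right[of g] by (simp add: X.cell_simps)
  qed simp
  have "fun_eq_on (unit_two_cat \<otimes>\<^sub>G M) (mul \<circ>\<^sub>F gray_map M M (fun_const M I) fun_id)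
      (fun_id \<circ>\<^sub>F gray_lift M (\<lambda>x. fun_const M x) (\<lambda>_. fun_id) (\<lambda>_ g. id2 M g))"
    by (rule D.fun_eq_on_gray_lift[OF F id_M])
      (simp_all add: gen, simp_all add: gray_map_def map0_gray_lift gray_L_def gray_R_def gray_Sig_def
        mul_generators functor_simps X.cell_simps I unit_left0 unit_left1 unit_left2 S_id_left)
  then show ?thesis by (simp add: fun_eq_on_def gray_lunit_def)
qed

lemma unit_right: "fun_eq_on (M \<otimes>\<^sub>G unit_two_cat) (mul \<circ>\<^sub>F gray_map M M fun_id (fun_const M I)) (gray_runit M)"
proof -
  interpret U: two_category unit_two_cat by (rule unit_two_category)
  interpret P: two_category_pair M unit_two_cat by unfold_locales
  note map = gray_cocycle_map[OF id_M unit_functor]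
  note gen = gray_lift_generators[OF map, folded gray_map_def]
  have F: "two_functor (M \<otimes>\<^sub>G unit_two_cat) M (mul \<circ>\<^sub>F gray_map M M fun_id (fun_const M I))"
    by (rule two_functor_fun_comp[OF two_functor_gray_map[OF id_M unit_functor] two_functor_gray_lift])
  interpret D: gray_data M unit_two_cat M "\<lambda>_. fun_id" "\<lambda>x. fun_const M x" "\<lambda>f _. id2 M f"
  proof (intro gray_data.intro gray_data_axioms.intro, goal_cases)
    case 1 show ?case by (rule P.two_category_pair_axioms)
  next
    case 2 show ?case by (rule M)
  next
    case 3 show ?case by (rule id_M)
  next
    case 4 then show ?case by (rule two_functor_fun_const[OF unit_two_category M])
  next
    case (6 f g) then show ?case using X.inverse2_id2 by blast
  next
    case (7 f g) then show ?case using X.one.cmp_ide_right[of f] by (simp add: X.cell_simps)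
  next
    case (8 f g) then show ?case using X.one.cmp_ide_left[of f] by (simp add: X.cell_simps)
  qed simp
  have "fun_eq_on (M \<otimes>\<^sub>G unit_two_cat) (mul \<circ>\<^sub>F gray_map M M fun_id (fun_const M I))
      (fun_id \<circ>\<^sub>F gray_lift M (\<lambda>_. fun_id) (\<lambda>x. fun_const M x) (\<lambda>f _. id2 M f))"
    by (rule D.fun_eq_on_gray_lift[OF F id_M])
      (simp_all add: gen, simp_all add: gray_map_def map0_gray_lift gray_L_def gray_R_def gray_Sig_def
        mul_generators functor_simps X.cell_simps I unit_right0 unit_right1 unit_right2 S_id_right)
  then show ?thesis by (simp add: fun_eq_on_def gray_runit_def)
qed

theorem gray_monoid: "gray_monoid M mul I"
  by (intro gray_monoid.intro gray_monoid_axioms.intro two_functor_gray_lift unit_functor assoc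
      unit_left unit_right)

end

text \<open>Naturality is required in the first variable; since \<open>\<beta> y x\<close> is inverse to \<open>\<beta> x y\<close>, reading the square
  backwards gives it in the second.\<close>

locale symmetric_cubical_monoid = cubical_monoid M Lf Rf S I
  for M :: "('o, 'f, 'c) two_cat"
    and Lf Rf :: "'o \<Rightarrow> ('o, 'f, 'c, 'o, 'f, 'c) two_fun"
    and S :: "'f \<Rightarrow> 'f \<Rightarrow> 'c" and I :: 'o +
  fixes \<beta> :: "'o \<Rightarrow> 'o \<Rightarrow> 'f"
  assumes \<beta>_closed: "\<lbrakk>x \<in> cells0 M; y \<in> cells0 M\<rbrakk> \<Longrightarrow> \<beta> x y \<in> cells1 M"
    and src1_\<beta>: "\<lbrakk>x \<in> cells0 M; y \<in> cells0 M\<rbrakk> \<Longrightarrow> src1 M (\<beta> x y) = map0 (Lf y) x"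
    and tgt1_\<beta>: "\<lbrakk>x \<in> cells0 M; y \<in> cells0 M\<rbrakk> \<Longrightarrow> tgt1 M (\<beta> x y) = map0 (Lf x) y"
    and \<beta>_\<beta>: "\<lbrakk>x \<in> cells0 M; y \<in> cells0 M\<rbrakk> \<Longrightarrow> comp1 M (\<beta> y x) (\<beta> x y) = id1 M (map0 (Lf y) x)"
    and \<beta>_natural1: "\<lbrakk>f \<in> cells1 M; y \<in> cells0 M\<rbrakk> \<Longrightarrow>
      comp1 M (\<beta> (tgt1 M f) y) (map1 (Lf y) f) = comp1 M (map1 (Rf y) f) (\<beta> (src1 M f) y)"
    and \<beta>_natural2: "\<lbrakk>\<alpha> \<in> cells2 M; y \<in> cells0 M\<rbrakk> \<Longrightarrow>
      hcomp M (id2 M (\<beta> (tgt1 M (src2 M \<alpha>)) y)) (map2 (Lf y) \<alpha>)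
      = hcomp M (map2 (Rf y) \<alpha>) (id2 M (\<beta> (src1 M (src2 M \<alpha>)) y))"
    and \<beta>_S: "\<lbrakk>f \<in> cells1 M; g \<in> cells1 M\<rbrakk> \<Longrightarrow>
      hcomp M (id2 M (\<beta> (tgt1 M f) (tgt1 M g))) (S f g)
      = hcomp M (inv2 M (S g f)) (id2 M (\<beta> (src1 M f) (src1 M g)))"
    and \<beta>_unit: "x \<in> cells0 M \<Longrightarrow> \<beta> I x = id1 M x"
    and \<beta>_hexagon: "\<lbrakk>x \<in> cells0 M; y \<in> cells0 M; z \<in> cells0 M\<rbrakk> \<Longrightarrow>
      \<beta> x (map0 (Lf z) y) = comp1 M (map1 (Rf y) (\<beta> x z)) (map1 (Lf z) (\<beta> x y))"
begin

lemmas \<beta>_simps = \<beta>_closed src1_\<beta> tgt1_\<beta> map0_agree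

lemma \<beta>_natural1': 
  assumes "f \<in> cells1 M" "x \<in> cells0 M"
  shows "comp1 M (\<beta> x (tgt1 M f)) (map1 (Rf x) f) = comp1 M (map1 (Lf x) f) (\<beta> x (src1 M f))"
  using assms
  by (intro X.one.square_flip[OF _ _ _ _ _ _ _ _ _ _ _ _ _ _ \<beta>_natural1])
    (simp_all add: all_simps \<beta>_simps \<beta>_\<beta>)

lemma \<beta>_natural2':
  assumes "\<alpha> \<in> cells2 M" "x \<in> cells0 M"
  shows "hcomp M (id2 M (\<beta> x (tgt1 M (src2 M \<alpha>)))) (map2 (Rf x) \<alpha>)
    = hcomp M (map2 (Lf x) \<alpha>) (id2 M (\<beta> x (src1 M (src2 M \<alpha>))))"
  using assms
  by (intro X.hor.square_flip[OF _ _ _ _ _ _ _ _ _ _ _ _ _ _ \<beta>_natural2])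
    (simp_all add: all_simps \<beta>_simps \<beta>_\<beta> X.id2_comp1[symmetric])

theorem permutative_gray_monoid: "permutative_gray_monoid M mul I \<beta>"
proof -
  interpret gray_monoid M mul I by (rule gray_monoid)
  have G: "two_functor (M \<otimes>\<^sub>G M) M (mul \<circ>\<^sub>F gray_swap M M)"
    by (rule two_functor_fun_comp[OF two_functor_gray_swap two_functor_gray_lift])
  have swap0: "map0 (gray_swap M M) z = (snd z, fst z)" for z
    by (simp add: gray_swap_def map0_gray_lift)
  interpret N: two_natural "M \<otimes>\<^sub>G M" M mul "mul \<circ>\<^sub>F gray_swap M M" "\<lambda>z. \<beta> (fst z) (snd z)"
    by (rule two_natural_gray[OF two_functor_gray_lift G])
      (auto simp: swap0 \<beta>_simps gray_swap_generators mul_generators gray_L_def gray_R_def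
        \<beta>_natural1 \<beta>_natural1' \<beta>_natural2 \<beta>_natural2' \<beta>_S)
  have "two_natural_iso (M \<otimes>\<^sub>G M) M mul (mul \<circ>\<^sub>F gray_swap M M) (\<lambda>z. \<beta> (fst z) (snd z))"
    unfolding two_natural_iso_def
    by (intro conjI exI[of _ "\<lambda>z. \<beta> (snd z) (fst z)"] N.two_natural_axioms N.two_natural_inverse)
      (auto simp: swap0 \<beta>_simps \<beta>_\<beta> cells0_gray)
  then show ?thesis
    by unfold_locales
      (auto simp: \<beta>_unit \<beta>_\<beta> \<beta>_hexagon gray_L_def gray_R_def mul_generators \<beta>_simps)
qed

end

section \<open>Matrices over a semiring\<close>

lemma index_div_mod_less:
  assumes "r < m * (n::nat)"
  shows "r div n < m" "r mod n < n"
  using assms by (auto simp: less_mult_imp_div_less intro!: mod_less_divisor gr0I)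

lemma pair_index_less: "j < m \<Longrightarrow> l < n \<Longrightarrow> j * n + l < m * (n::nat)"
proof -
  assume "j < m" "l < n"
  then have "j * n + l < Suc j * n" "Suc j * n \<le> m * n" by simp_all (use \<open>j < m\<close> in \<open>metis Suc_leI mult_Suc mult_le_mono1\<close>)
  then show ?thesis by (rule less_le_trans)
qed

lemma pair_index_less': "j < m \<Longrightarrow> l < n \<Longrightarrow> j * n + l < n * (m::nat)"
  using pair_index_less by (simp add: mult.commute)

definition mats :: "('b, 'm) ring_scheme \<Rightarrow> 'b mat set" where
  "mats R = {A. elements_mat A \<subseteq> carrier R}"

lemma mats_iff: "A \<in> mats R \<longleftrightarrow> (\<forall>i<dim_row A. \<forall>j<dim_col A. A $$ (i, j) \<in> carrier R)"
  by (fastforce simp: mats_def elements_mat_def)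

definition mprod :: "('b, 'm) ring_scheme \<Rightarrow> 'b mat \<Rightarrow> 'b mat \<Rightarrow> 'b mat" where
  "mprod R = mat_prod (add R) (mult R) (zero R)"

definition mone :: "('b, 'm) ring_scheme \<Rightarrow> nat \<Rightarrow> 'b mat" where
  "mone R n = mat n n (\<lambda>(i, j). if i = j then one R else zero R)"

lemma dim_mone [simp]: "dim_row (mone R n) = n" "dim_col (mone R n) = n"
  by (simp_all add: mone_def)

lemma index_mone [simp]: "i < n \<Longrightarrow> j < n \<Longrightarrow> mone R n $$ (i, j) = (if i = j then one R else zero R)"
  by (simp add: mone_def)

lemma dim_mprod [simp]: "dim_row (mprod R B A) = dim_row B" "dim_col (mprod R B A) = dim_col A"
  by (simp_all add: mprod_def mat_prod_def)

lemma dim_block_mat [simp]: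
  "dim_row (block_mat p A B) = dim_row A * dim_row B" "dim_col (block_mat p A B) = dim_col A * dim_col B"
  by (simp_all add: block_mat_def)

lemma index_block_mat [simp]:
  "\<lbrakk>r < dim_row A * dim_row B; c < dim_col A * dim_col B\<rbrakk> \<Longrightarrow> block_mat p A B $$ (r, c)
    = p (A $$ (r div dim_row B, c div dim_col B)) (B $$ (r mod dim_row B, c mod dim_col B))"
  by (simp add: block_mat_def)

lemma div_mod_mult: "(r::nat) div (m * n) = r div n div m" "r mod (m * n) div n = r div n mod m"
    "r mod (m * n) mod n = r mod n"
  by (simp_all add: div_mult2_eq mult.commute[of m n] mod_mult2_eq)
    (cases "n = 0"; simp add: mod_mult2_eq)

text \<open>The maps \<open>g\<close> and \<open>k\<close> insert identity arrows where one side combines a matrix of objects with a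
  matrix of symmetries.\<close>

lemma block_mat_assoc_map:
  assumes "\<And>a b d. \<lbrakk>a \<in> elements_mat A; b \<in> elements_mat B; d \<in> elements_mat D\<rbrakk>
    \<Longrightarrow> p (q a b) (k d) = p' (g a) (q' b d)"
  shows "block_mat p (block_mat q A B) (map_mat k D) = block_mat p' (map_mat g A) (block_mat q' B D)"
proof (rule eq_matI)
  fix r c
  assume "r < dim_row (block_mat p' (map_mat g A) (block_mat q' B D))" "c < dim_col (block_mat p' (map_mat g A) (block_mat q' B D))"
  then have r: "r < dim_row A * (dim_row B * dim_row D)" and c: "c < dim_col A * (dim_col B * dim_col D)"
    by simp_all
  then have r': "r < dim_row A * dim_row B * dim_row D" and c': "c < dim_col A * dim_col B * dim_col D"
    by (simp_all add: mult.assoc)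
  note less = index_div_mod_less[OF r] index_div_mod_less[OF c] index_div_mod_less[OF r']
    index_div_mod_less[OF c'] index_div_mod_less[OF index_div_mod_less(2)[OF r]]
    index_div_mod_less[OF index_div_mod_less(2)[OF c]]
    index_div_mod_less[OF index_div_mod_less(1)[OF r']] index_div_mod_less[OF index_div_mod_less(1)[OF c']]
  have "p (q (A $$ (r div dim_row D div dim_row B, c div dim_col D div dim_col B))
        (B $$ (r div dim_row D mod dim_row B, c div dim_col D mod dim_col B)))
      (k (D $$ (r mod dim_row D, c mod dim_col D)))
    = p' (g (A $$ (r div dim_row D div dim_row B, c div dim_col D div dim_col B)))
      (q' (B $$ (r div dim_row D mod dim_row B, c div dim_col D mod dim_col B))
        (D $$ (r mod dim_row D, c mod dim_col D)))"
    using less by (intro assms elements_matI[OF carrier_matI[OF HOL.refl HOL.refl]]) (simp_all add: div_mod_mult)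
  then show "block_mat p (block_mat q A B) (map_mat k D) $$ (r, c) = block_mat p' (map_mat g A) (block_mat q' B D) $$ (r, c)"
    using r c r' c' less by (simp add: div_mod_mult)
qed (simp_all add: mult.assoc)

lemma block_mat_assoc:
  assumes "\<And>a b d. \<lbrakk>a \<in> elements_mat A; b \<in> elements_mat B; d \<in> elements_mat D\<rbrakk>
    \<Longrightarrow> p (q a b) d = p' a (q' b d)"
  shows "block_mat p (block_mat q A B) D = block_mat p' A (block_mat q' B D)"
proof -
  have id: "map_mat (\<lambda>x. x) A = A" for A :: "'x mat" by (rule eq_matI) auto
  show ?thesis
    using block_mat_assoc_map[of A B D p q "\<lambda>x. x" p' "\<lambda>x. x" q'] assms by (simp add: id)
qed

definition blockL :: "('b, 'm) ring_scheme \<Rightarrow> nat \<Rightarrow> 'b mat \<Rightarrow> 'b mat" where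
  "blockL R n A = block_mat (mult R) A (mone R n)"

definition blockR :: "('b, 'm) ring_scheme \<Rightarrow> nat \<Rightarrow> 'b mat \<Rightarrow> 'b mat" where
  "blockR R m B = block_mat (mult R) (mone R m) B"

lemma dim_block [simp]:
  "dim_row (blockL R n A) = dim_row A * n" "dim_col (blockL R n A) = dim_col A * n"
  "dim_row (blockR R m B) = m * dim_row B" "dim_col (blockR R m B) = m * dim_col B"
  by (simp_all add: blockL_def blockR_def)

lemma index_blockL [simp]: "\<lbrakk>r < dim_row A * n; c < dim_col A * n\<rbrakk> \<Longrightarrow>
    blockL R n A $$ (r, c) = mult R (A $$ (r div n, c div n)) (if r mod n = c mod n then one R else zero R)"
  using index_div_mod_less by (simp add: blockL_def)

lemma index_blockR [simp]: "\<lbrakk>r < m * dim_row B; c < m * dim_col B\<rbrakk> \<Longrightarrow>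
    blockR R m B $$ (r, c) = mult R (if r div dim_row B = c div dim_col B then one R else zero R)
      (B $$ (r mod dim_row B, c mod dim_col B))"
  using index_div_mod_less by (simp add: blockR_def)

definition mswap :: "('b, 'm) ring_scheme \<Rightarrow> nat \<Rightarrow> nat \<Rightarrow> 'b mat" where
  "mswap R m n = mat (n * m) (m * n)
     (\<lambda>(r, c). if r mod m = c div n \<and> r div m = c mod n then one R else zero R)"

lemma dim_mswap [simp]: "dim_row (mswap R m n) = n * m" "dim_col (mswap R m n) = m * n"
  by (simp_all add: mswap_def)

context semiring begin

lemma foldr_eq_finsum:
  assumes "f \<in> {..<n} \<rightarrow> carrier R"
  shows "foldr (add R) (map f [0..<n]) \<zero> = finsum R f {..<n}"
proof -
  have "foldr (add R) (map f [0..<n]) z = finsum R f {..<n} \<oplus> z"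
    if "z \<in> carrier R" "f \<in> {..<n} \<rightarrow> carrier R" for z
    using that
  proof (induction n arbitrary: z)
    case (Suc n)
    then have "f \<in> {..<n} \<rightarrow> carrier R" "f n \<in> carrier R" by auto
    then show ?case
      using Suc by (simp add: lessThan_Suc finsum_insert a_assoc a_comm[of "f n"])
  qed simp
  then show ?thesis using assms by simp
qed

lemma index_mprod:
  assumes "B \<in> mats R" "A \<in> mats R" "dim_col B = dim_row A" "k < dim_row B" "i < dim_col A"
  shows "mprod R B A $$ (k, i) = (\<Oplus>j\<in>{..<dim_row A}. B $$ (k, j) \<otimes> A $$ (j, i))"
  using assms by (simp add: mprod_def mat_prod_def mats_iff) (intro foldr_eq_finsum, auto)

lemma mprod_closed:
  assumes "B \<in> mats R" "A \<in> mats R" "dim_col B = dim_row A"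
  shows "mprod R B A \<in> mats R"
  using assms by (auto simp: mats_iff index_mprod intro!: finsum_closed)

lemma mone_closed: "mone R n \<in> mats R"
  by (simp add: mats_iff)

lemma mswap_closed: "mswap R m n \<in> mats R"
  by (simp add: mats_iff mswap_def)

lemma block_mat_mult_closed:
  assumes "A \<in> mats R" "B \<in> mats R"
  shows "block_mat (mult R) A B \<in> mats R"
  using assms index_div_mod_less by (auto simp: mats_iff)

lemma finsum_swap:
  assumes "finite A" "finite B" "\<And>i j. i \<in> A \<Longrightarrow> j \<in> B \<Longrightarrow> f i j \<in> carrier R"
  shows "(\<Oplus>i\<in>A. \<Oplus>j\<in>B. f i j) = (\<Oplus>j\<in>B. \<Oplus>i\<in>A. f i j)"
  using assms(1,3)
proof (induction A rule: finite_induct)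
  case empty
  then show ?case by simp
next
  case (insert a A)
  then have "(\<Oplus>i\<in>insert a A. \<Oplus>j\<in>B. f i j) = (\<Oplus>j\<in>B. f a j) \<oplus> (\<Oplus>j\<in>B. \<Oplus>i\<in>A. f i j)"
    by (subst finsum_insert) (auto intro!: finsum_closed)
  also have "\<dots> = (\<Oplus>j\<in>B. f a j \<oplus> (\<Oplus>i\<in>A. f i j))"
    using insert by (subst finsum_addf) (auto intro!: finsum_closed)
  also have "\<dots> = (\<Oplus>j\<in>B. \<Oplus>i\<in>insert a A. f i j)"
    using insert by (intro finsum_cong') (auto intro!: finsum_closed)
  finally show ?case .
qed

lemma finsum_one_term:
  assumes "finite A" "i \<in> A" "f i \<in> carrier R" "\<And>j. j \<in> A \<Longrightarrow> j \<noteq> i \<Longrightarrow> f j = \<zero>"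
  shows "finsum R f A = f i"
proof -
  have "finsum R f {i} = finsum R f A"
    using assms by (intro add.finprod_mono_neutral_cong_left) (auto, metis zero_closed)
  then show ?thesis using assms by simp
qed

lemma finsum_reindex_support:
  assumes "finite B" "inj_on g A" "g ` A \<subseteq> B" "f \<in> B \<rightarrow> carrier R" "\<And>i. i \<in> B \<Longrightarrow> i \<notin> g ` A \<Longrightarrow> f i = \<zero>"
  shows "finsum R f B = (\<Oplus>i\<in>A. f (g i))"
proof -
  have "finsum R f (g ` A) = finsum R f B"
    using assms by (intro add.finprod_mono_neutral_cong_left) auto
  moreover have "finsum R f (g ` A) = (\<Oplus>i\<in>A. f (g i))"
    using assms by (intro finsum_reindex) auto
  ultimately show ?thesis by simp
qed

text \<open>With \<open>(j, l)\<close> encoded as \<open>j * n + l\<close>, these are sums over pairs of indices; a factor from an identity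
  matrix will leave one value of one of the two.\<close>

lemma finsum_fixed_second:
  fixes l m n :: nat
  assumes "l < n" "f \<in> {..<m * n} \<rightarrow> carrier R" "\<And>s. s < m * n \<Longrightarrow> s mod n \<noteq> l \<Longrightarrow> f s = \<zero>"
  shows "(\<Oplus>s\<in>{..<m * n}. f s) = (\<Oplus>j\<in>{..<m}. f (j * n + l))"
proof (rule finsum_reindex_support)
  show "inj_on (\<lambda>j. j * n + l) {..<m}"
    using assms(1) by (auto simp: inj_on_def)
  show "(\<lambda>j. j * n + l) ` {..<m} \<subseteq> {..<m * n}" using assms(1) by (auto intro: pair_index_less pair_index_less')
next
  fix s assume s: "s \<in> {..<m * n}" "s \<notin> (\<lambda>j. j * n + l) ` {..<m}"
  show "f s = \<zero>"
  proof (cases "s mod n = l")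
    case True
    then have "s = s div n * n + l" by (metis div_mult_mod_eq)
    then show ?thesis using s index_div_mod_less(1)[of s m n] by blast
  qed (use assms(3) s in auto)
qed (use assms(2) in auto)

lemma finsum_fixed_first:
  fixes j m n :: nat
  assumes "j < m" "f \<in> {..<m * n} \<rightarrow> carrier R" "\<And>s. s < m * n \<Longrightarrow> s div n \<noteq> j \<Longrightarrow> f s = \<zero>"
  shows "(\<Oplus>s\<in>{..<m * n}. f s) = (\<Oplus>l\<in>{..<n}. f (j * n + l))"
proof (rule finsum_reindex_support)
  show "(\<lambda>l. j * n + l) ` {..<n} \<subseteq> {..<m * n}" using assms(1) by (auto intro: pair_index_less pair_index_less')
next
  fix s assume s: "s \<in> {..<m * n}" "s \<notin> (\<lambda>l. j * n + l) ` {..<n}"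
  show "f s = \<zero>"
  proof (cases "s div n = j")
    case True
    then have "s = j * n + s mod n" by (metis div_mult_mod_eq)
    then show ?thesis using s index_div_mod_less(2)[of s m n] by blast
  qed (use assms(3) s in auto)
qed (use assms(2) in \<open>auto simp: inj_on_def\<close>)

lemma mprod_assoc:
  assumes "A \<in> mats R" "B \<in> mats R" "D \<in> mats R" "dim_col B = dim_row A" "dim_col D = dim_row B"
  shows "mprod R D (mprod R B A) = mprod R (mprod R D B) A"
proof (rule eq_matI)
  fix k i assume "k < dim_row (mprod R (mprod R D B) A)" "i < dim_col (mprod R (mprod R D B) A)"
  then have k: "k < dim_row D" and i: "i < dim_col A" by simp_all
  note car = assms(1-3)[unfolded mats_iff, rule_format]
  have "mprod R D (mprod R B A) $$ (k, i)
      = (\<Oplus>j\<in>{..<dim_row B}. D $$ (k, j) \<otimes> (\<Oplus>l\<in>{..<dim_row A}. B $$ (j, l) \<otimes> A $$ (l, i)))"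
    using assms k i car
    by (simp add: index_mprod mprod_closed) (intro finsum_cong', auto simp: index_mprod intro!: finsum_closed)
  also have "\<dots> = (\<Oplus>j\<in>{..<dim_row B}. \<Oplus>l\<in>{..<dim_row A}. D $$ (k, j) \<otimes> B $$ (j, l) \<otimes> A $$ (l, i))"
    using assms k i car
    by (intro finsum_cong') (auto simp: finsum_rdistr m_assoc intro!: finsum_closed finsum_cong')
  also have "\<dots> = (\<Oplus>l\<in>{..<dim_row A}. \<Oplus>j\<in>{..<dim_row B}. D $$ (k, j) \<otimes> B $$ (j, l) \<otimes> A $$ (l, i))"
    using assms k i car by (intro finsum_swap) auto
  also have "\<dots> = (\<Oplus>l\<in>{..<dim_row A}. (\<Oplus>j\<in>{..<dim_row B}. D $$ (k, j) \<otimes> B $$ (j, l)) \<otimes> A $$ (l, i))"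
    using assms k i car
    by (intro finsum_cong') (auto simp: finsum_ldistr intro!: finsum_closed)
  also have "\<dots> = mprod R (mprod R D B) A $$ (k, i)"
    using assms k i car
    by (simp add: index_mprod mprod_closed) (intro finsum_cong', auto simp: index_mprod intro!: finsum_closed)
  finally show "mprod R D (mprod R B A) $$ (k, i) = mprod R (mprod R D B) A $$ (k, i)" .
qed simp_all

lemma mprod_mone_left: "A \<in> mats R \<Longrightarrow> mprod R (mone R (dim_row A)) A = A"
  by (rule eq_matI)
    (auto simp: index_mprod mone_closed mats_iff intro!: HOL.trans[OF finsum_one_term])

lemma mprod_mone_right: "A \<in> mats R \<Longrightarrow> mprod R A (mone R (dim_col A)) = A"
  by (rule eq_matI)
    (auto simp: index_mprod mone_closed mats_iff intro!: HOL.trans[OF finsum_one_term])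

lemma category_mats: "category UNIV (mats R) dim_col dim_row (mone R) (mprod R)"
  by unfold_locales
    (auto simp: mone_closed mprod_closed mprod_mone_left mprod_mone_right mprod_assoc)

text \<open>Products with the matrices \<open>A \<otimes> 1\<close> and \<open>1 \<otimes> B\<close>: in each of the four cases one of the two
  summation indices is fixed by the identity matrix.\<close>

lemma blockL_closed: "A \<in> mats R \<Longrightarrow> blockL R n A \<in> mats R"
  unfolding blockL_def by (intro block_mat_mult_closed mone_closed)

lemma blockR_closed: "B \<in> mats R \<Longrightarrow> blockR R m B \<in> mats R"
  unfolding blockR_def by (intro block_mat_mult_closed mone_closed)

lemma index_mprod_blockL_right:
  assumes "W \<in> mats R" "A \<in> mats R" "dim_col W = dim_row A * n" "r < dim_row W" "c < dim_col A * n"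
  shows "mprod R W (blockL R n A) $$ (r, c)
    = (\<Oplus>j\<in>{..<dim_row A}. W $$ (r, j * n + c mod n) \<otimes> A $$ (j, c div n))"
proof -
  note c = index_div_mod_less[OF assms(5)]
  note car = assms(1,2)[unfolded mats_iff, rule_format]
  let ?f = "\<lambda>s. W $$ (r, s) \<otimes> (A $$ (s div n, c div n) \<otimes> (if s mod n = c mod n then \<one> else \<zero>))"
  have "mprod R W (blockL R n A) $$ (r, c) = (\<Oplus>s\<in>{..<dim_row A * n}. ?f s)"
    using assms c car index_div_mod_less
    by (subst index_mprod) (auto simp: blockL_closed intro!: finsum_cong')
  also have "\<dots> = (\<Oplus>j\<in>{..<dim_row A}. ?f (j * n + c mod n))"
    using assms c car index_div_mod_less by (intro finsum_fixed_second) auto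
  also have "\<dots> = (\<Oplus>j\<in>{..<dim_row A}. W $$ (r, j * n + c mod n) \<otimes> A $$ (j, c div n))"
    using assms c car pair_index_less by (intro finsum_cong') auto
  finally show ?thesis .
qed

lemma index_mprod_blockL_left:
  assumes "W \<in> mats R" "A \<in> mats R" "dim_row W = dim_col A * n" "r < dim_row A * n" "c < dim_col W"
  shows "mprod R (blockL R n A) W $$ (r, c)
    = (\<Oplus>j\<in>{..<dim_col A}. A $$ (r div n, j) \<otimes> W $$ (j * n + r mod n, c))"
proof -
  note r = index_div_mod_less[OF assms(4)]
  note car = assms(1,2)[unfolded mats_iff, rule_format]
  let ?f = "\<lambda>s. A $$ (r div n, s div n) \<otimes> (if r mod n = s mod n then \<one> else \<zero>) \<otimes> W $$ (s, c)"
  have "mprod R (blockL R n A) W $$ (r, c) = (\<Oplus>s\<in>{..<dim_col A * n}. ?f s)"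
    using assms r car index_div_mod_less
    by (subst index_mprod) (auto simp: blockL_closed intro!: finsum_cong')
  also have "\<dots> = (\<Oplus>j\<in>{..<dim_col A}. ?f (j * n + r mod n))"
    using assms r car index_div_mod_less by (intro finsum_fixed_second) auto
  also have "\<dots> = (\<Oplus>j\<in>{..<dim_col A}. A $$ (r div n, j) \<otimes> W $$ (j * n + r mod n, c))"
    using assms r car pair_index_less by (intro finsum_cong') auto
  finally show ?thesis .
qed

lemma index_mprod_blockR_right:
  assumes "W \<in> mats R" "B \<in> mats R" "dim_col W = m * dim_row B" "r < dim_row W" "c < m * dim_col B"
  shows "mprod R W (blockR R m B) $$ (r, c)
    = (\<Oplus>l\<in>{..<dim_row B}. W $$ (r, c div dim_col B * dim_row B + l) \<otimes> B $$ (l, c mod dim_col B))"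
proof -
  note c = index_div_mod_less[OF assms(5)]
  note car = assms(1,2)[unfolded mats_iff, rule_format]
  let ?f = "\<lambda>s. W $$ (r, s) \<otimes> ((if s div dim_row B = c div dim_col B then \<one> else \<zero>)
    \<otimes> B $$ (s mod dim_row B, c mod dim_col B))"
  have "mprod R W (blockR R m B) $$ (r, c) = (\<Oplus>s\<in>{..<m * dim_row B}. ?f s)"
    using assms c car index_div_mod_less
    by (subst index_mprod) (auto simp: blockR_closed intro!: finsum_cong')
  also have "\<dots> = (\<Oplus>l\<in>{..<dim_row B}. ?f (c div dim_col B * dim_row B + l))"
    using assms c car index_div_mod_less by (intro finsum_fixed_first) auto
  also have "\<dots> = (\<Oplus>l\<in>{..<dim_row B}. W $$ (r, c div dim_col B * dim_row B + l) \<otimes> B $$ (l, c mod dim_col B))"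
    using assms c car pair_index_less by (intro finsum_cong') auto
  finally show ?thesis .
qed

lemma index_mprod_blockR_left:
  assumes "W \<in> mats R" "B \<in> mats R" "dim_row W = m * dim_col B" "r < m * dim_row B" "c < dim_col W"
  shows "mprod R (blockR R m B) W $$ (r, c)
    = (\<Oplus>l\<in>{..<dim_col B}. B $$ (r mod dim_row B, l) \<otimes> W $$ (r div dim_row B * dim_col B + l, c))"
proof -
  note r = index_div_mod_less[OF assms(4)]
  note car = assms(1,2)[unfolded mats_iff, rule_format]
  let ?f = "\<lambda>s. (if r div dim_row B = s div dim_col B then \<one> else \<zero>)
    \<otimes> B $$ (r mod dim_row B, s mod dim_col B) \<otimes> W $$ (s, c)"
  have "mprod R (blockR R m B) W $$ (r, c) = (\<Oplus>s\<in>{..<m * dim_col B}. ?f s)"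
    using assms r car index_div_mod_less
    by (subst index_mprod) (auto simp: blockR_closed intro!: finsum_cong')
  also have "\<dots> = (\<Oplus>l\<in>{..<dim_col B}. ?f (r div dim_row B * dim_col B + l))"
    using assms r car index_div_mod_less by (intro finsum_fixed_first) auto
  also have "\<dots> = (\<Oplus>l\<in>{..<dim_col B}. B $$ (r mod dim_row B, l) \<otimes> W $$ (r div dim_row B * dim_col B + l, c))"
    using assms r car pair_index_less by (intro finsum_cong') auto
  finally show ?thesis .
qed

lemma div_mod_eq_iff: "(r::nat) div n = c div n \<and> r mod n = c mod n \<longleftrightarrow> r = c"
  by (metis div_mult_mod_eq)

lemma blockL_mone: "blockL R n (mone R m) = mone R (m * n)"
proof (rule eq_matI)
  fix i j assume "i < dim_row (mone R (m * n))" "j < dim_col (mone R (m * n))"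
  then show "blockL R n (mone R m) $$ (i, j) = mone R (m * n) $$ (i, j)"
    using index_div_mod_less[of i m n] index_div_mod_less[of j m n] div_mod_eq_iff[of i n j] by auto
qed simp_all

lemma blockR_mone: "blockR R m (mone R n) = mone R (m * n)"
  using blockL_mone[of n m] by (simp add: blockL_def blockR_def)

lemma mprod_blockL_blockL:
  assumes "A \<in> mats R" "B \<in> mats R" "dim_col B = dim_row A"
  shows "mprod R (blockL R n B) (blockL R n A) = blockL R n (mprod R B A)"
proof (rule eq_matI)
  fix r c assume "r < dim_row (blockL R n (mprod R B A))" "c < dim_col (blockL R n (mprod R B A))"
  then have r: "r < dim_row B * n" and c: "c < dim_col A * n" by simp_all
  note rc = index_div_mod_less[OF r] index_div_mod_less[OF c]
  note car = assms(1,2)[unfolded mats_iff, rule_format]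
  define d where "d = (if r mod n = c mod n then \<one> else \<zero>)"
  have d: "d \<in> carrier R" by (simp add: d_def)
  have "mprod R (blockL R n B) (blockL R n A) $$ (r, c)
    = (\<Oplus>j\<in>{..<dim_row A}. blockL R n B $$ (r, j * n + c mod n) \<otimes> A $$ (j, c div n))"
    using assms r c by (intro index_mprod_blockL_right blockL_closed) simp_all
  also have "\<dots> = (\<Oplus>j\<in>{..<dim_row A}. B $$ (r div n, j) \<otimes> A $$ (j, c div n) \<otimes> d)"
    using assms r c rc car by (intro finsum_cong') (auto simp: pair_index_less d_def)
  also have "\<dots> = (\<Oplus>j\<in>{..<dim_row A}. B $$ (r div n, j) \<otimes> A $$ (j, c div n)) \<otimes> d"
    using assms rc car d by (intro finsum_ldistr[symmetric]) auto
  also have "\<dots> = blockL R n (mprod R B A) $$ (r, c)"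
    using assms r c rc by (simp add: index_mprod d_def)
  finally show "mprod R (blockL R n B) (blockL R n A) $$ (r, c) = blockL R n (mprod R B A) $$ (r, c)" .
qed simp_all

lemma mprod_blockR_blockR:
  assumes "A \<in> mats R" "B \<in> mats R" "dim_col B = dim_row A"
  shows "mprod R (blockR R m B) (blockR R m A) = blockR R m (mprod R B A)"
proof (rule eq_matI)
  fix r c assume "r < dim_row (blockR R m (mprod R B A))" "c < dim_col (blockR R m (mprod R B A))"
  then have r: "r < m * dim_row B" and c: "c < m * dim_col A" by simp_all
  note rc = index_div_mod_less[OF r] index_div_mod_less[OF c]
  note car = assms(1,2)[unfolded mats_iff, rule_format]
  define d where "d = (if r div dim_row B = c div dim_col A then \<one> else \<zero>)"
  have d: "d \<in> carrier R" by (simp add: d_def)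
  have "mprod R (blockR R m B) (blockR R m A) $$ (r, c) = (\<Oplus>l\<in>{..<dim_row A}.
      blockR R m B $$ (r, c div dim_col A * dim_row A + l) \<otimes> A $$ (l, c mod dim_col A))"
    using assms r c by (intro index_mprod_blockR_right blockR_closed) simp_all
  also have "\<dots> = (\<Oplus>l\<in>{..<dim_row A}. d \<otimes> (B $$ (r mod dim_row B, l) \<otimes> A $$ (l, c mod dim_col A)))"
    using assms r c rc car by (intro finsum_cong') (auto simp: pair_index_less d_def)
  also have "\<dots> = d \<otimes> (\<Oplus>l\<in>{..<dim_row A}. B $$ (r mod dim_row B, l) \<otimes> A $$ (l, c mod dim_col A))"
    using assms rc car d by (intro finsum_rdistr[symmetric]) auto
  also have "\<dots> = blockR R m (mprod R B A) $$ (r, c)"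
    using assms r c rc by (simp add: index_mprod d_def)
  finally show "mprod R (blockR R m B) (blockR R m A) $$ (r, c) = blockR R m (mprod R B A) $$ (r, c)" .
qed simp_all

lemma mprod_blockL_blockR:
  assumes "A \<in> mats R" "B \<in> mats R"
  shows "mprod R (blockL R (dim_row B) A) (blockR R (dim_col A) B) = block_mat (mult R) A B"
proof (rule eq_matI)
  fix r c assume "r < dim_row (block_mat (mult R) A B)" "c < dim_col (block_mat (mult R) A B)"
  then have r: "r < dim_row A * dim_row B" and c: "c < dim_col A * dim_col B" by simp_all
  note rc = index_div_mod_less[OF r] index_div_mod_less[OF c]
  note car = assms[unfolded mats_iff, rule_format]
  have "mprod R (blockL R (dim_row B) A) (blockR R (dim_col A) B) $$ (r, c)
    = (\<Oplus>j\<in>{..<dim_col A}. A $$ (r div dim_row B, j) \<otimes> ((if j = c div dim_col B then \<one> else \<zero>)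
        \<otimes> B $$ (r mod dim_row B, c mod dim_col B)))"
    using assms r c rc car
    by (auto simp: index_mprod_blockL_left blockR_closed pair_index_less intro!: finsum_cong')
  also have "\<dots> = A $$ (r div dim_row B, c div dim_col B) \<otimes> B $$ (r mod dim_row B, c mod dim_col B)"
    using rc car by (intro HOL.trans[OF finsum_one_term[of _ "c div dim_col B"]]) auto
  finally show "mprod R (blockL R (dim_row B) A) (blockR R (dim_col A) B) $$ (r, c)
      = block_mat (mult R) A B $$ (r, c)"
    using r c by simp
qed simp_all

lemma mprod_blockR_blockL:
  assumes "A \<in> mats R" "B \<in> mats R"
  shows "mprod R (blockR R (dim_row A) B) (blockL R (dim_col B) A) = block_mat (\<lambda>a b. b \<otimes> a) A B"
proof (rule eq_matI)
  fix r c assume "r < dim_row (block_mat (\<lambda>a b. b \<otimes> a) A B)" "c < dim_col (block_mat (\<lambda>a b. b \<otimes> a) A B)"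
  then have r: "r < dim_row A * dim_row B" and c: "c < dim_col A * dim_col B" by simp_all
  note rc = index_div_mod_less[OF r] index_div_mod_less[OF c]
  note car = assms[unfolded mats_iff, rule_format]
  have "mprod R (blockR R (dim_row A) B) (blockL R (dim_col B) A) $$ (r, c)
    = (\<Oplus>l\<in>{..<dim_col B}. B $$ (r mod dim_row B, l) \<otimes> (A $$ (r div dim_row B, c div dim_col B)
        \<otimes> (if l = c mod dim_col B then \<one> else \<zero>)))"
    using assms r c rc car
    by (auto simp: index_mprod_blockR_left blockL_closed pair_index_less intro!: finsum_cong')
  also have "\<dots> = B $$ (r mod dim_row B, c mod dim_col B) \<otimes> A $$ (r div dim_row B, c div dim_col B)"
    using rc car by (intro HOL.trans[OF finsum_one_term[of _ "c mod dim_col B"]]) auto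
  finally show "mprod R (blockR R (dim_row A) B) (blockL R (dim_col B) A) $$ (r, c)
      = block_mat (\<lambda>a b. b \<otimes> a) A B $$ (r, c)"
    using r c by simp
qed simp_all

lemma blockL_blockL: "A \<in> mats R \<Longrightarrow> blockL R z (blockL R y A) = blockL R (y * z) A"
  using mone_closed[of y] mone_closed[of z]
  using blockL_mone[of z y] unfolding blockL_def
  by (subst block_mat_assoc[of _ _ _ _ _ "mult R" "mult R"]) (auto simp: mats_def m_assoc subset_iff)

lemma blockL_blockR: "A \<in> mats R \<Longrightarrow> blockL R z (blockR R x A) = blockR R x (blockL R z A)"
  using mone_closed[of x] mone_closed[of z]
  unfolding blockL_def blockR_def
  by (subst block_mat_assoc[of _ _ _ _ _ "mult R" "mult R"]) (auto simp: mats_def m_assoc subset_iff)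

lemma blockR_blockR: "A \<in> mats R \<Longrightarrow> blockR R (x * y) A = blockR R x (blockR R y A)"
  using mone_closed[of x] mone_closed[of y]
  unfolding blockR_def blockL_mone[symmetric] unfolding blockL_def
  by (subst block_mat_assoc[of _ _ _ _ _ "mult R" "mult R"])
    (auto simp: mats_def m_assoc subset_iff)

lemma blockL_1: "A \<in> mats R \<Longrightarrow> blockL R 1 A = A"
  by (rule eq_matI) (auto simp: mats_iff)

lemma blockR_1: "A \<in> mats R \<Longrightarrow> blockR R 1 A = A"
  by (rule eq_matI) (auto simp: mats_iff)

lemma index_mprod_mswap_left:
  assumes "W \<in> mats R" "dim_row W = m * n" "r < n * m" "c < dim_col W"
  shows "mprod R (mswap R m n) W $$ (r, c) = W $$ (r mod m * n + r div m, c)"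
proof -
  note r = index_div_mod_less[OF assms(3)]
  have less: "r mod m * n + r div m < m * n" using r by (intro pair_index_less)
  have iff: "r mod m = s div n \<and> r div m = s mod n \<longleftrightarrow> s = r mod m * n + r div m" if "s < m * n" for s
    using r by (auto simp: div_mult_mod_eq)
  have "mprod R (mswap R m n) W $$ (r, c) = (\<Oplus>s\<in>{..<m * n}. mswap R m n $$ (r, s) \<otimes> W $$ (s, c))"
    using assms by (simp add: index_mprod mswap_closed)
  also have "\<dots> = (\<Oplus>s\<in>{..<m * n}. (if s = r mod m * n + r div m then \<one> else \<zero>) \<otimes> W $$ (s, c))"
    using assms iff by (intro finsum_cong') (auto simp: mswap_def mats_iff)
  also have "\<dots> = W $$ (r mod m * n + r div m, c)"
    using assms less
    by (intro HOL.trans[OF finsum_one_term[of _ "r mod m * n + r div m"]]) (auto simp: mats_iff)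
  finally show ?thesis .
qed

lemma index_mprod_mswap_right:
  assumes "W \<in> mats R" "dim_col W = n * m" "r < dim_row W" "c < m * n"
  shows "mprod R W (mswap R m n) $$ (r, c) = W $$ (r, c mod n * m + c div n)"
proof -
  note c = index_div_mod_less[OF assms(4)]
  have less: "c mod n * m + c div n < n * m" using c by (intro pair_index_less)
  have iff: "s mod m = c div n \<and> s div m = c mod n \<longleftrightarrow> s = c mod n * m + c div n" if "s < n * m" for s
    using c by (auto, metis div_mult_mod_eq)
  have "mprod R W (mswap R m n) $$ (r, c) = (\<Oplus>s\<in>{..<n * m}. W $$ (r, s) \<otimes> mswap R m n $$ (s, c))"
    using assms by (simp add: index_mprod mswap_closed)
  also have "\<dots> = (\<Oplus>s\<in>{..<n * m}. W $$ (r, s) \<otimes> (if s = c mod n * m + c div n then \<one> else \<zero>))"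
    using assms iff by (intro finsum_cong') (auto simp: mswap_def mats_iff)
  also have "\<dots> = W $$ (r, c mod n * m + c div n)"
    using assms less
    by (intro HOL.trans[OF finsum_one_term[of _ "c mod n * m + c div n"]]) (auto simp: mats_iff)
  finally show ?thesis .
qed

text \<open>Multiplication by the permutation matrix from the left permutes rows, and from the right columns, so
  that both sides have the entry \<open>p\<close> of an entry of \<open>A\<close> and an entry of \<open>B\<close> with the same indices.\<close>

lemma mswap_natural:
  assumes "block_mat p A B \<in> mats R" "block_mat (\<lambda>b a. p a b) B A \<in> mats R"
  shows "mprod R (mswap R (dim_row A) (dim_row B)) (block_mat p A B)
    = mprod R (block_mat (\<lambda>b a. p a b) B A) (mswap R (dim_col A) (dim_col B))"
proof (rule eq_matI)
  fix r c
  assume "r < dim_row (mprod R (block_mat (\<lambda>b a. p a b) B A) (mswap R (dim_col A) (dim_col B)))"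
    "c < dim_col (mprod R (block_mat (\<lambda>b a. p a b) B A) (mswap R (dim_col A) (dim_col B)))"
  then have r: "r < dim_row B * dim_row A" and c: "c < dim_col A * dim_col B" by simp_all
  note rc = index_div_mod_less[OF r] index_div_mod_less[OF c]
  show "mprod R (mswap R (dim_row A) (dim_row B)) (block_mat p A B) $$ (r, c)
    = mprod R (block_mat (\<lambda>b a. p a b) B A) (mswap R (dim_col A) (dim_col B)) $$ (r, c)"
    using assms r c rc
    by (simp add: index_mprod_mswap_left index_mprod_mswap_right pair_index_less)
qed simp_all

lemma mswap_mswap: "mprod R (mswap R n m) (mswap R m n) = mone R (m * n)"
proof (rule eq_matI)
  fix r c assume "r < dim_row (mone R (m * n))" "c < dim_col (mone R (m * n))"
  then have r: "r < m * n" and c: "c < m * n" by simp_all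
  note rc = index_div_mod_less[OF r] index_div_mod_less[OF c]
  have "mprod R (mswap R n m) (mswap R m n) $$ (r, c) = mswap R m n $$ (r mod n * m + r div n, c)"
    using r c by (intro index_mprod_mswap_left mswap_closed) simp_all
  then show "mprod R (mswap R n m) (mswap R m n) $$ (r, c) = mone R (m * n) $$ (r, c)"
    using r c rc div_mod_eq_iff[of r n c] by (simp add: mswap_def pair_index_less)
qed simp_all

lemma mswap_1: "mswap R 1 n = mone R n"
  by (rule eq_matI) (auto simp: mswap_def)

lemma mswap_hexagon:
  "mswap R x (y * z) = mprod R (blockR R y (mswap R x z)) (blockL R z (mswap R x y))"
proof (rule eq_matI)
  let ?W = "blockL R z (mswap R x y)"
  fix r c
  assume "r < dim_row (mprod R (blockR R y (mswap R x z)) ?W)" "c < dim_col (mprod R (blockR R y (mswap R x z)) ?W)"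
  then have r: "r < y * (z * x)" and c: "c < x * y * z" by simp_all
  note rc = index_div_mod_less[OF r] index_div_mod_less[OF c] index_div_mod_less[OF index_div_mod_less(2)[OF r]]
    index_div_mod_less[OF index_div_mod_less(1)[OF c]]
  have W: "?W \<in> mats R" by (intro blockL_closed mswap_closed)
  have r': "r < y * z * x" and c': "c < x * (y * z)" using r c by (simp_all add: mult.assoc)
  \<comment> \<open>the row index encodes the triple \<open>(j, k, i)\<close>; only the summand with \<open>l = (i, k)\<close> survives\<close>
  let ?i = "r mod x" and ?j = "r div x div z" and ?k = "r div x mod z"
  have ijk: "r div (z * x) = ?j" "r mod (z * x) div x = ?k" "r mod (z * x) mod x = ?i"
    by (simp_all add: div_mod_mult)
  have less: "?i < x" "?j < y" "?k < z" using rc by (simp_all add: div_mod_mult)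
  have less': "?i * z + ?k < x * z" "?j * x + ?i < y * x" "?j * (x * z) + (?i * z + ?k) < y * x * z"
    using less by (simp_all add: pair_index_less mult.assoc)
  have split: "?j * (x * z) + (?i * z + ?k) = (?j * x + ?i) * z + ?k"
    by (simp add: algebra_simps)
  have "mprod R (blockR R y (mswap R x z)) ?W $$ (r, c)
    = (\<Oplus>l\<in>{..<x * z}. mswap R x z $$ (r mod (z * x), l) \<otimes> ?W $$ (r div (z * x) * (x * z) + l, c))"
    using r c by (subst index_mprod_blockR_left) (simp_all add: mswap_closed blockL_closed mult.assoc)
  also have "\<dots> = mswap R x z $$ (r mod (z * x), ?i * z + ?k) \<otimes> ?W $$ (?j * (x * z) + (?i * z + ?k), c)"
  proof (subst finsum_one_term[of _ "?i * z + ?k"])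
    have iff: "r mod (z * x) mod x = l div z \<and> r mod (z * x) div x = l mod z \<longleftrightarrow> l = ?i * z + ?k" for l
      using less unfolding ijk by (auto simp: div_mult_mod_eq)
    show "mswap R x z $$ (r mod (z * x), l) \<otimes> ?W $$ (r div (z * x) * (x * z) + l, c) = \<zero>"
      if "l \<in> {..<x * z}" "l \<noteq> ?i * z + ?k" for l
    proof -
      have "?W $$ (r div (z * x) * (x * z) + l, c) \<in> carrier R"
        using that rc c pair_index_less[of "r div (z * x)" y l "x * z"]
        by (intro W[unfolded mats_iff, rule_format]) (simp_all add: mult.assoc)
      moreover have "mswap R x z $$ (r mod (z * x), l) = \<zero>"
        using that rc iff[of l] by (auto simp: mswap_def)
      ultimately show ?thesis by simp
    qed
    show "mswap R x z $$ (r mod (z * x), ?i * z + ?k) \<otimes> ?W $$ (r div (z * x) * (x * z) + (?i * z + ?k), c)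
        \<in> carrier R"
      using rc c less' ijk
      by (intro m_closed W[unfolded mats_iff, rule_format] mswap_closed[unfolded mats_iff, rule_format])
        (simp_all add: mult.assoc)
  qed (use less' ijk in simp_all)
  also have "mswap R x z $$ (r mod (z * x), ?i * z + ?k) = \<one>"
    using less less' rc ijk by (simp add: mswap_def)
  also have "?W $$ (?j * (x * z) + (?i * z + ?k), c)
    = (if ?i = c div z div y \<and> ?j = c div z mod y \<and> ?k = c mod z then \<one> else \<zero>)"
    using less less' rc c unfolding split by (simp add: mswap_def)
  also have "\<one> \<otimes> \<dots> = mswap R x (y * z) $$ (r, c)"
  proof -
    have "r div x = c mod (y * z) \<longleftrightarrow> ?j = c div z mod y \<and> ?k = c mod z"
      using div_mod_eq_iff[of "r div x" z "c mod (y * z)"] by (simp add: div_mod_mult)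
    then show ?thesis using r' c' by (simp add: mswap_def div_mult2_eq mult.commute[of y z])
  qed
  finally show "mswap R x (y * z) $$ (r, c) = mprod R (blockR R y (mswap R x z)) ?W $$ (r, c)" ..
qed (simp_all add: mult.assoc)

end

text \<open>In addition to homomorphisms such as domain and codomain, this is used for the additive maps
  \<open>A \<mapsto> \<zeta>\<^sub>A\<^sub>,\<^sub>D\<close> from objects to arrows.\<close>

lemma finsum_hom:
  assumes "semiring R" "semiring Q" "finite A" "f \<in> A \<rightarrow> carrier R"
    and "\<And>x. x \<in> carrier R \<Longrightarrow> h x \<in> carrier Q" "h (zero R) = zero Q"
    and "\<And>x y. \<lbrakk>x \<in> carrier R; y \<in> carrier R\<rbrakk> \<Longrightarrow> h (add R x y) = add Q (h x) (h y)"
  shows "h (finsum R f A) = finsum Q (\<lambda>i. h (f i)) A"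
proof -
  interpret R: semiring R by fact
  interpret Q: semiring Q by fact
  show ?thesis
    using assms(3,4)
  proof (induction A rule: finite_induct)
    case (insert a A)
    have "h (finsum R f (insert a A)) = h (add R (f a) (finsum R f A))"
      using insert by (subst R.finsum_insert) auto
    also have "\<dots> = add Q (h (f a)) (finsum Q (\<lambda>i. h (f i)) A)"
      using insert assms(7) by (auto intro!: R.finsum_closed)
    also have "\<dots> = finsum Q (\<lambda>i. h (f i)) (insert a A)"
      using insert assms(5) by (subst Q.finsum_insert) auto
    finally show ?case .
  qed (simp add: assms(6))
qed

lemma map_mat_mprod:
  assumes "semiring R" "semiring Q" "A \<in> mats R" "B \<in> mats R" "dim_col B = dim_row A"
    and "\<And>x. x \<in> carrier R \<Longrightarrow> h x \<in> carrier Q" "h (zero R) = zero Q"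
    and "\<And>x y. \<lbrakk>x \<in> carrier R; y \<in> carrier R\<rbrakk> \<Longrightarrow> h (add R x y) = add Q (h x) (h y)"
    and "\<And>x y. \<lbrakk>x \<in> carrier R; y \<in> carrier R\<rbrakk> \<Longrightarrow> h (mult R x y) = mult Q (h x) (h y)"
  shows "map_mat h (mprod R B A) = mprod Q (map_mat h B) (map_mat h A)"
proof -
  interpret R: semiring R by fact
  interpret Q: semiring Q by fact
  note car = assms(3,4)[unfolded mats_iff, rule_format]
  have hA: "map_mat h A \<in> mats Q" "map_mat h B \<in> mats Q"
    using assms(3,4,6) by (simp_all add: mats_iff)
  show ?thesis
  proof (rule eq_matI)
    fix k i assume "k < dim_row (mprod Q (map_mat h B) (map_mat h A))" "i < dim_col (mprod Q (map_mat h B) (map_mat h A))"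
    then have k: "k < dim_row B" and i: "i < dim_col A" by simp_all
    have "map_mat h (mprod R B A) $$ (k, i) = h (finsum R (\<lambda>j. mult R (B $$ (k, j)) (A $$ (j, i))) {..<dim_row A})"
      using k i assms by (simp add: R.index_mprod)
    also have "\<dots> = finsum Q (\<lambda>j. h (mult R (B $$ (k, j)) (A $$ (j, i)))) {..<dim_row A}"
      using k i car assms(5-8) by (intro finsum_hom[OF assms(1,2)]) auto
    also have "\<dots> = finsum Q (\<lambda>j. mult Q (map_mat h B $$ (k, j)) (map_mat h A $$ (j, i))) {..<dim_row A}"
      using k i car assms(5,6,9) by (intro Q.finsum_cong') auto
    also have "\<dots> = mprod Q (map_mat h B) (map_mat h A) $$ (k, i)"
      using k i hA assms(5) by (simp add: Q.index_mprod)
    finally show "map_mat h (mprod R B A) $$ (k, i) = mprod Q (map_mat h B) (map_mat h A) $$ (k, i)" .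
  qed simp_all
qed

lemma elements_matI': "i < dim_row A \<Longrightarrow> j < dim_col A \<Longrightarrow> A $$ (i, j) \<in> elements_mat A"
  by (intro elements_matI[OF carrier_matI[OF HOL.refl HOL.refl]]) auto

lemma map_block_mat:
  assumes "\<And>a b. \<lbrakk>a \<in> elements_mat A; b \<in> elements_mat B\<rbrakk> \<Longrightarrow> h (p a b) = p' (g a) (k b)"
  shows "map_mat h (block_mat p A B) = block_mat p' (map_mat g A) (map_mat k B)"
  by (intro eq_matI) (auto simp: index_div_mod_less intro!: assms elements_matI')

lemma block_mat_cong:
  assumes "\<And>a b. \<lbrakk>a \<in> elements_mat A; b \<in> elements_mat B\<rbrakk> \<Longrightarrow> p a b = p' a b"
  shows "block_mat p A B = block_mat p' A B"
  by (intro eq_matI) (auto simp: index_div_mod_less intro!: assms elements_matI')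

lemma elements_mone: "a \<in> elements_mat (mone R n) \<Longrightarrow> a = one R \<or> a = zero R"
  by (auto dest!: elements_matD)

lemma mats_elements: "A \<in> mats R \<Longrightarrow> a \<in> elements_mat A \<Longrightarrow> a \<in> carrier R"
  by (auto simp: mats_def)


section \<open>The 2-category of matrices\<close>

definition ob_semiring :: "('o, 'a) bimon_cat \<Rightarrow> 'o ring" where
  "ob_semiring C = \<lparr>carrier = Ob C, mult = mul0 C, one = uni C, zero = zer C, add = add0 C\<rparr>"

definition ar_semiring :: "('o, 'a) bimon_cat \<Rightarrow> 'a ring" where
  "ar_semiring C = \<lparr>carrier = Ar C, mult = mul1 C, one = ide C (uni C), zero = ide C (zer C), add = add1 C\<rparr>"

lemma ob_semiring_simps [simp]:
  "carrier (ob_semiring C) = Ob C" "mult (ob_semiring C) = mul0 C" "one (ob_semiring C) = uni C"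
  "zero (ob_semiring C) = zer C" "add (ob_semiring C) = add0 C"
  by (simp_all add: ob_semiring_def)

lemma ar_semiring_simps [simp]:
  "carrier (ar_semiring C) = Ar C" "mult (ar_semiring C) = mul1 C" "one (ar_semiring C) = ide C (uni C)"
  "zero (ar_semiring C) = ide C (zer C)" "add (ar_semiring C) = add1 C"
  by (simp_all add: ar_semiring_def)

lemma Mat_simps [simp]:
  "cells0 (Mat C) = UNIV" "cells1 (Mat C) = mats (ob_semiring C)" "cells2 (Mat C) = mats (ar_semiring C)"
  "src1 (Mat C) = dim_col" "tgt1 (Mat C) = dim_row" "src2 (Mat C) = map_mat (dm C)"
  "tgt2 (Mat C) = map_mat (cd C)" "id1 (Mat C) = mone (ob_semiring C)"
  "comp1 (Mat C) = mprod (ob_semiring C)" "id2 (Mat C) = map_mat (ide C)"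
  "hcomp (Mat C) = mprod (ar_semiring C)"
  by (auto simp: Mat_def mats_def mprod_def mat_one_def mone_def fun_eq_iff intro!: eq_matI)

lemma vcomp_Mat: "vcomp (Mat C) B A = mat (dim_row A) (dim_col A) (\<lambda>ij. cmp C (B $$ ij) (A $$ ij))"
  by (simp add: Mat_def)

lemma dim_vcomp_Mat [simp]:
  "dim_row (vcomp (Mat C) B A) = dim_row A" "dim_col (vcomp (Mat C) B A) = dim_col A"
  by (simp_all add: vcomp_Mat)

lemma index_vcomp_Mat [simp]: "\<lbrakk>i < dim_row A; j < dim_col A\<rbrakk> \<Longrightarrow>
    vcomp (Mat C) B A $$ (i, j) = cmp C (B $$ (i, j)) (A $$ (i, j))"
  by (simp add: vcomp_Mat)

lemma mat_one_eq_mone: "mat_one C n = mone (ob_semiring C) n"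
  by (rule eq_matI) (auto simp: mat_one_def)

lemma Mat_sym_eq_mswap: "Mat_sym C m n = mswap (ob_semiring C) m n"
  by (rule eq_matI) (auto simp: Mat_sym_def mswap_def)

lemma map_mat_eqD:
  assumes "map_mat f A = map_mat g B"
  shows "dim_row A = dim_row B" "dim_col A = dim_col B"
    "\<And>i j. \<lbrakk>i < dim_row B; j < dim_col B\<rbrakk> \<Longrightarrow> f (A $$ (i, j)) = g (B $$ (i, j))"
proof -
  show 1: "dim_row A = dim_row B" "dim_col A = dim_col B"
    using arg_cong[OF assms, of dim_row] arg_cong[OF assms, of dim_col] by simp_all
  show "f (A $$ (i, j)) = g (B $$ (i, j))" if "i < dim_row B" "j < dim_col B" for i j
    using arg_cong[OF assms, of "\<lambda>M. M $$ (i, j)"] that 1 by simp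
qed

lemma (in category) inverse_arrow_unique:
  assumes "a \<in> Ar" "b \<in> Ar" "x \<in> Ar" "dm a = cd b" "dm b = cd x" "dm x = dm a" "cd a = cd x"
    and "cmp a b = ide (dm b)" "cmp b x = ide (dm x)"
  shows "a = x"
proof -
  have "a = cmp a (cmp b x)" using assms cmp_ide_right[of a] by simp
  also have "\<dots> = cmp (cmp a b) x" using assms by (intro cmp_assoc) auto
  also have "\<dots> = x" using assms cmp_ide_left[of x] by simp
  finally show ?thesis .
qed

context strict_symmetric_bimonoidal_category begin

sublocale sum: permutative_category "Ob C" "Ar C" "dm C" "cd C" "ide C" "cmp C"
    "add0 C" "add1 C" "zer C" "\<lambda>A B. ide C (add0 C A B)"
  by (rule additive)

sublocale ten: permutative_category "Ob C" "Ar C" "dm C" "cd C" "ide C" "cmp C"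
    "mul0 C" "mul1 C" "uni C" "zeta C"
  by (rule multiplicative)

lemmas arrow_simps = sum.dm_closed sum.cd_closed sum.ide_closed sum.dm_ide sum.cd_ide sum.cmp_closed
  sum.dm_cmp sum.cd_cmp
  sum.tens0_closed sum.tens1_closed sum.dm_tens1 sum.cd_tens1 sum.e_closed
  ten.tens0_closed ten.tens1_closed ten.dm_tens1 ten.cd_tens1 ten.e_closed
  ten.sym_closed ten.dm_sym ten.cd_sym

text \<open>Since the additive symmetry is an identity, both objects and arrows form a semiring, with
  commutative addition.\<close>

lemma add0_commute: "A \<in> Ob C \<Longrightarrow> B \<in> Ob C \<Longrightarrow> add0 C A B = add0 C B A"
  using sum.cd_sym[of A B] by (simp add: arrow_simps)

lemma add1_commute:
  assumes "f \<in> Ar C" "g \<in> Ar C"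
  shows "add1 C f g = add1 C g f"
  using sum.sym_natural[OF assms] sum.cmp_ide_left[of "add1 C f g"] sum.cmp_ide_right[of "add1 C g f"] assms
    add0_commute[of "dm C f" "dm C g"]
  by (simp add: arrow_simps)

sublocale ob: semiring "ob_semiring C"
  by unfold_locales
    (auto simp: arrow_simps sum.tens0_assoc sum.tens0_e_left sum.tens0_e_right ten.tens0_assoc
      ten.tens0_e_left ten.tens0_e_right zer_mul0 mul0_zer distrib_left0 distrib_right0 intro: add0_commute)

sublocale ar: semiring "ar_semiring C"
  by unfold_locales
    (auto simp: arrow_simps sum.tens1_assoc sum.tens1_e_left sum.tens1_e_right ten.tens1_assoc
      ten.tens1_e_left ten.tens1_e_right zer_mul1 mul1_zer distrib_left1 distrib_right1 intro: add1_commute)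

lemma map_mat_mone: "map_mat (ide C) (mone (ob_semiring C) n) = mone (ar_semiring C) n"
  "map_mat (dm C) (mone (ar_semiring C) n) = mone (ob_semiring C) n"
  "map_mat (cd C) (mone (ar_semiring C) n) = mone (ob_semiring C) n"
  by (rule eq_matI; auto simp: arrow_simps)+

lemma map_mat_mswap: "map_mat (ide C) (mswap (ob_semiring C) m n) = mswap (ar_semiring C) m n"
  by (rule eq_matI) (auto simp: mswap_def)

lemma map_mat_closed:
  "A \<in> mats (ob_semiring C) \<Longrightarrow> map_mat (ide C) A \<in> mats (ar_semiring C)"
  "\<alpha> \<in> mats (ar_semiring C) \<Longrightarrow> map_mat (dm C) \<alpha> \<in> mats (ob_semiring C)"
  "\<alpha> \<in> mats (ar_semiring C) \<Longrightarrow> map_mat (cd C) \<alpha> \<in> mats (ob_semiring C)"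
  by (auto simp: mats_iff arrow_simps)

lemma map_mat_ide: "A \<in> mats (ob_semiring C) \<Longrightarrow> map_mat (dm C) (map_mat (ide C) A) = A"
  "A \<in> mats (ob_semiring C) \<Longrightarrow> map_mat (cd C) (map_mat (ide C) A) = A"
  by (auto intro!: eq_matI simp: mats_iff arrow_simps)

lemmas dm_finsum = finsum_hom[OF ar.semiring_axioms ob.semiring_axioms, of _ _ "dm C"]
lemmas cd_finsum = finsum_hom[OF ar.semiring_axioms ob.semiring_axioms, of _ _ "cd C"]

text \<open>Addition is a functor, so composition of arrows is additive on composable pairs.\<close>

lemma cmp_finsum:
  assumes "finite A" "\<And>i. i \<in> A \<Longrightarrow> f i \<in> Ar C \<and> g i \<in> Ar C \<and> dm C (g i) = cd C (f i)"
  shows "finsum (ar_semiring C) (\<lambda>i. cmp C (g i) (f i)) A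
    = cmp C (finsum (ar_semiring C) g A) (finsum (ar_semiring C) f A)"
  using assms
proof (induction A rule: finite_induct)
  case empty
  then show ?case using sum.cmp_ide_left[of "ide C (zer C)"] by (simp add: arrow_simps)
next
  case (insert a A)
  have cl: "finsum (ar_semiring C) f A \<in> Ar C" "finsum (ar_semiring C) g A \<in> Ar C"
    using insert ar.finsum_closed[of f A] ar.finsum_closed[of g A] by auto
  have "dm C (finsum (ar_semiring C) g A) = finsum (ob_semiring C) (\<lambda>i. dm C (g i)) A"
    using insert by (intro dm_finsum) (auto simp: arrow_simps)
  also have "\<dots> = finsum (ob_semiring C) (\<lambda>i. cd C (f i)) A"
    using insert by (intro ob.finsum_cong') (auto simp: arrow_simps)
  also have "\<dots> = cd C (finsum (ar_semiring C) f A)"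
    using insert by (intro cd_finsum[symmetric]) (auto simp: arrow_simps)
  finally have meet: "dm C (finsum (ar_semiring C) g A) = cd C (finsum (ar_semiring C) f A)" .
  have "finsum (ar_semiring C) (\<lambda>i. cmp C (g i) (f i)) (insert a A)
      = add1 C (cmp C (g a) (f a)) (finsum (ar_semiring C) (\<lambda>i. cmp C (g i) (f i)) A)"
    using insert by (subst ar.finsum_insert) (auto simp: arrow_simps)
  also have "\<dots> = cmp C (add1 C (g a) (finsum (ar_semiring C) g A)) (add1 C (f a) (finsum (ar_semiring C) f A))"
    using insert cl meet by (simp add: sum.tens1_cmp)
  also have "\<dots> = cmp C (finsum (ar_semiring C) g (insert a A)) (finsum (ar_semiring C) f (insert a A))"
    using insert by (subst (1 2) ar.finsum_insert) auto
  finally show ?case .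
qed

lemma dm_mprod: "\<lbrakk>\<alpha> \<in> mats (ar_semiring C); \<beta> \<in> mats (ar_semiring C); dim_col \<beta> = dim_row \<alpha>\<rbrakk> \<Longrightarrow>
    map_mat (dm C) (mprod (ar_semiring C) \<beta> \<alpha>) = mprod (ob_semiring C) (map_mat (dm C) \<beta>) (map_mat (dm C) \<alpha>)"
  by (rule map_mat_mprod[OF ar.semiring_axioms ob.semiring_axioms]) (auto simp: arrow_simps)

lemma cd_mprod: "\<lbrakk>\<alpha> \<in> mats (ar_semiring C); \<beta> \<in> mats (ar_semiring C); dim_col \<beta> = dim_row \<alpha>\<rbrakk> \<Longrightarrow>
    map_mat (cd C) (mprod (ar_semiring C) \<beta> \<alpha>) = mprod (ob_semiring C) (map_mat (cd C) \<beta>) (map_mat (cd C) \<alpha>)"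
  by (rule map_mat_mprod[OF ar.semiring_axioms ob.semiring_axioms]) (auto simp: arrow_simps)

lemma ide_mprod: "\<lbrakk>A \<in> mats (ob_semiring C); B \<in> mats (ob_semiring C); dim_col B = dim_row A\<rbrakk> \<Longrightarrow>
    map_mat (ide C) (mprod (ob_semiring C) B A) = mprod (ar_semiring C) (map_mat (ide C) B) (map_mat (ide C) A)"
  by (rule map_mat_mprod[OF ob.semiring_axioms ar.semiring_axioms])
    (auto simp: arrow_simps sum.tens1_ide ten.tens1_ide)

text \<open>Entrywise this is functoriality of the product, followed by additivity of composition.\<close>

lemma interchange_Mat:
  assumes cl: "\<alpha> \<in> mats (ar_semiring C)" "\<alpha>' \<in> mats (ar_semiring C)" "\<beta> \<in> mats (ar_semiring C)" "\<beta>' \<in> mats (ar_semiring C)"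
    and \<alpha>: "map_mat (dm C) \<alpha>' = map_mat (cd C) \<alpha>" and \<beta>: "map_mat (dm C) \<beta>' = map_mat (cd C) \<beta>"
    and d: "dim_col \<beta> = dim_row \<alpha>"
  shows "mprod (ar_semiring C) (vcomp (Mat C) \<beta>' \<beta>) (vcomp (Mat C) \<alpha>' \<alpha>)
    = vcomp (Mat C) (mprod (ar_semiring C) \<beta>' \<alpha>') (mprod (ar_semiring C) \<beta> \<alpha>)"
proof (rule eq_matI)
  let ?R = "ar_semiring C"
  note car = cl[unfolded mats_iff, rule_format, simplified]
  note A = map_mat_eqD[OF \<alpha>] and B = map_mat_eqD[OF \<beta>]
  fix k i
  assume "k < dim_row (vcomp (Mat C) (mprod ?R \<beta>' \<alpha>') (mprod ?R \<beta> \<alpha>))"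
    "i < dim_col (vcomp (Mat C) (mprod ?R \<beta>' \<alpha>') (mprod ?R \<beta> \<alpha>))"
  then have k: "k < dim_row \<beta>" and i: "i < dim_col \<alpha>" by simp_all
  have V: "vcomp (Mat C) \<beta>' \<beta> \<in> mats ?R" "vcomp (Mat C) \<alpha>' \<alpha> \<in> mats ?R"
    using car A B d by (auto simp: mats_iff intro!: sum.cmp_closed)
  have "mprod ?R (vcomp (Mat C) \<beta>' \<beta>) (vcomp (Mat C) \<alpha>' \<alpha>) $$ (k, i)
    = finsum ?R (\<lambda>j. mul1 C (cmp C (\<beta>' $$ (k, j)) (\<beta> $$ (k, j))) (cmp C (\<alpha>' $$ (j, i)) (\<alpha> $$ (j, i)))) {..<dim_row \<alpha>}"
    using V k i d car A B
    by (simp add: ar.index_mprod) (intro ar.finsum_cong', auto simp: arrow_simps)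
  also have "\<dots> = finsum ?R (\<lambda>j. cmp C (mul1 C (\<beta>' $$ (k, j)) (\<alpha>' $$ (j, i))) (mul1 C (\<beta> $$ (k, j)) (\<alpha> $$ (j, i)))) {..<dim_row \<alpha>}"
    using k i d car A B
    by (intro ar.finsum_cong') (auto simp: arrow_simps ten.tens1_cmp)
  also have "\<dots> = cmp C (finsum ?R (\<lambda>j. mul1 C (\<beta>' $$ (k, j)) (\<alpha>' $$ (j, i))) {..<dim_row \<alpha>})
      (finsum ?R (\<lambda>j. mul1 C (\<beta> $$ (k, j)) (\<alpha> $$ (j, i))) {..<dim_row \<alpha>})"
    using k i d car A B by (intro cmp_finsum) (auto simp: arrow_simps)
  also have "\<dots> = vcomp (Mat C) (mprod ?R \<beta>' \<alpha>') (mprod ?R \<beta> \<alpha>) $$ (k, i)"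
    using k i d cl A B by (simp add: ar.index_mprod)
  finally show "mprod ?R (vcomp (Mat C) \<beta>' \<beta>) (vcomp (Mat C) \<alpha>' \<alpha>) $$ (k, i)
    = vcomp (Mat C) (mprod ?R \<beta>' \<alpha>') (mprod ?R \<beta> \<alpha>) $$ (k, i)" .
qed simp_all

lemma vertical_category: "category (mats (ob_semiring C)) (mats (ar_semiring C)) (map_mat (dm C))
    (map_mat (cd C)) (map_mat (ide C)) (vcomp (Mat C))"
proof (unfold_locales, goal_cases)
  case (6 f g)
  then show ?case using map_mat_eqD[OF 6(3)] by (auto simp: mats_iff arrow_simps)
next
  case (7 f g)
  then show ?case using map_mat_eqD[OF 7(3)] by (auto simp: mats_iff arrow_simps intro!: eq_matI)
next
  case (8 f g)
  then show ?case using map_mat_eqD[OF 8(3)] by (auto simp: mats_iff arrow_simps intro!: eq_matI)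
next
  case (11 f g h)
  then show ?case using map_mat_eqD[OF 11(4)] map_mat_eqD[OF 11(5)]
    by (auto simp: mats_iff sum.cmp_assoc intro!: eq_matI)
qed (auto simp: mats_iff arrow_simps sum.cmp_ide_left sum.cmp_ide_right intro!: eq_matI)

lemma two_category_Mat: "two_category (Mat C)"
proof (intro two_category.intro, goal_cases)
  case 1 show ?case using ob.category_mats by simp
next
  case 2 show ?case using vertical_category by simp
next
  case 3 show ?case using ar.category_mats by (simp add: map_mat_mone fun_eq_iff)
next
  case (9 \<alpha> \<alpha>' \<beta> \<beta>') then show ?case using interchange_Mat by simp
qed (simp_all add: dm_mprod cd_mprod ide_mprod)

end

section \<open>Matrices form a permutative Gray monoid\<close>

context strict_symmetric_bimonoidal_category begin

abbreviation Lf :: "nat \<Rightarrow> (nat, 'o mat, 'a mat, nat, 'o mat, 'a mat) two_fun" where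
  "Lf n \<equiv> \<lparr>map0 = \<lambda>m. m * n, map1 = blockL (ob_semiring C) n, map2 = blockL (ar_semiring C) n\<rparr>"

abbreviation Rf :: "nat \<Rightarrow> (nat, 'o mat, 'a mat, nat, 'o mat, 'a mat) two_fun" where
  "Rf m \<equiv> \<lparr>map0 = \<lambda>n. m * n, map1 = blockR (ob_semiring C) m, map2 = blockR (ar_semiring C) m\<rparr>"

lemma Mat_mult_eq: "Mat_mult C = gray_lift (Mat C) Lf Rf (block_mat (zeta C))"
proof -
  have "map1 (Lf n) = (\<lambda>A. block_mat (mul0 C) A (mat_one C n))"
    "map2 (Lf n) = (\<lambda>A. block_mat (mul1 C) A (map_mat (ide C) (mat_one C n)))"
    "map1 (Rf n) = (\<lambda>A. block_mat (mul0 C) (mat_one C n) A)"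
    "map2 (Rf n) = (\<lambda>A. block_mat (mul1 C) (map_mat (ide C) (mat_one C n)) A)" for n
    by (simp_all add: fun_eq_iff blockL_def blockR_def mat_one_eq_mone map_mat_mone)
  then show ?thesis by (simp add: Mat_mult_def)
qed

text \<open>The axioms for the symmetry concern one of its two variables.  The corresponding facts for the other
  variable follow, since \<open>\<zeta>\<^sub>A\<^sub>,\<^sub>B\<close> is the only inverse of \<open>\<zeta>\<^sub>B\<^sub>,\<^sub>A\<close>.\<close>

lemma zeta_zeta: "A \<in> Ob C \<Longrightarrow> B \<in> Ob C \<Longrightarrow> cmp C (zeta C B A) (zeta C A B) = ide C (mul0 C A B)"
  by (rule ten.sym_sym)

lemma zeta_unique:
  assumes "A \<in> Ob C" "B \<in> Ob C" "x \<in> Ar C" "dm C x = mul0 C A B" "cd C x = mul0 C B A"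
    and "cmp C (zeta C B A) x = ide C (mul0 C A B)"
  shows "zeta C A B = x"
proof (rule sum.inverse_arrow_unique[of _ "zeta C B A"])
  show "cmp C (zeta C A B) (zeta C B A) = ide C (dm C (zeta C B A))"
    using assms(1,2) by (simp add: zeta_zeta arrow_simps)
  show "cmp C (zeta C B A) x = ide C (dm C x)" using assms(4,6) by simp
qed (use assms(1-5) in \<open>simp_all add: arrow_simps\<close>)

lemma uni_zeta: "A \<in> Ob C \<Longrightarrow> zeta C (uni C) A = ide C A"
  by (rule zeta_unique) (use sum.cmp_ide_left[of "ide C A"] in
      \<open>simp_all add: arrow_simps ten.sym_e ten.tens0_e_left ten.tens0_e_right\<close>)

lemma zer_zeta: "A \<in> Ob C \<Longrightarrow> zeta C (zer C) A = ide C (zer C)"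
  by (rule zeta_unique) (use sum.cmp_ide_left[of "ide C (zer C)"] in
      \<open>simp_all add: arrow_simps zeta_zer zer_mul0 mul0_zer\<close>)

lemma zeta_add_right:
  assumes "A \<in> Ob C" "B \<in> Ob C" "D \<in> Ob C"
  shows "zeta C A (add0 C B D) = add1 C (zeta C A B) (zeta C A D)"
  using assms
  by (intro zeta_unique)
    (simp_all add: arrow_simps zeta_add distrib_left0 distrib_right0 sum.tens1_cmp[symmetric] zeta_zeta sum.tens1_ide)

text \<open>The hexagon for the other variable: the right-hand side inverts the composite that the hexagon gives
  for \<open>\<zeta>\<^sub>D\<^sub>,\<^sub>A\<^sub>B\<close>.\<close>

lemma zeta_mul_left:
  assumes "A \<in> Ob C" "B \<in> Ob C" "D \<in> Ob C"
  shows "zeta C (mul0 C A B) D = cmp C (mul1 C (zeta C A D) (ide C B)) (mul1 C (ide C A) (zeta C B D))"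
proof (rule zeta_unique)
  let ?p = "mul1 C (ide C A) (zeta C D B)" and ?q = "mul1 C (zeta C D A) (ide C B)"
  let ?r = "mul1 C (zeta C A D) (ide C B)" and ?s = "mul1 C (ide C A) (zeta C B D)"
  note ty = arrow_simps ten.tens0_assoc
  have qr: "cmp C ?q ?r = ide C (mul0 C (mul0 C A D) B)" and ps: "cmp C ?p ?s = ide C (mul0 C A (mul0 C B D))"
    using assms sum.cmp_ide_left[of "ide C A"] sum.cmp_ide_left[of "ide C B"]
    by (simp_all add: ty ten.tens1_cmp[symmetric] zeta_zeta ten.tens1_ide)
  have "cmp C (zeta C D (mul0 C A B)) (cmp C ?r ?s) = cmp C (cmp C ?p ?q) (cmp C ?r ?s)"
    using assms by (simp add: ten.sym_hexagon)
  also have "\<dots> = cmp C ?p (cmp C (cmp C ?q ?r) ?s)"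
    using assms by (simp add: sum.cmp_assoc ty)
  also have "\<dots> = ide C (mul0 C (mul0 C A B) D)"
    using assms sum.cmp_ide_left[of ?s] ps by (simp add: qr ty)
  finally show "cmp C (zeta C D (mul0 C A B)) (cmp C ?r ?s) = ide C (mul0 C (mul0 C A B) D)" .
qed (use assms in \<open>simp_all add: arrow_simps ten.tens0_assoc\<close>)

lemma zeta_finsum_left:
  assumes "D \<in> Ob C" "finite S" "f \<in> S \<rightarrow> Ob C"
  shows "zeta C (finsum (ob_semiring C) f S) D = finsum (ar_semiring C) (\<lambda>i. zeta C (f i) D) S"
  by (rule finsum_hom[OF ob.semiring_axioms ar.semiring_axioms assms(2), of _ "\<lambda>A. zeta C A D"])
    (use assms in \<open>auto simp: arrow_simps zer_zeta zeta_add\<close>)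

lemma zeta_finsum_right:
  assumes "D \<in> Ob C" "finite S" "f \<in> S \<rightarrow> Ob C"
  shows "zeta C D (finsum (ob_semiring C) f S) = finsum (ar_semiring C) (\<lambda>i. zeta C D (f i)) S"
  by (rule finsum_hom[OF ob.semiring_axioms ar.semiring_axioms assms(2), of _ "\<lambda>A. zeta C D A"])
    (use assms in \<open>auto simp: arrow_simps zeta_zer zeta_add_right\<close>)

lemma elements_ob: "a \<in> elements_mat A \<Longrightarrow> A \<in> mats (ob_semiring C) \<Longrightarrow> a \<in> Ob C"
  using mats_elements[of A "ob_semiring C" a] by simp

lemma elements_ar: "a \<in> elements_mat A \<Longrightarrow> A \<in> mats (ar_semiring C) \<Longrightarrow> a \<in> Ar C"
  using mats_elements[of A "ar_semiring C" a] by simp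

lemmas elements_ob_mone = elements_ob[OF _ ob.mone_closed]
lemmas elements_ar_mone = elements_ar[OF _ ar.mone_closed]

lemma map_mat_block:
  assumes "A \<in> mats (ob_semiring C)"
  shows "map_mat (ide C) (blockL (ob_semiring C) n A) = blockL (ar_semiring C) n (map_mat (ide C) A)"
    "map_mat (ide C) (blockR (ob_semiring C) n A) = blockR (ar_semiring C) n (map_mat (ide C) A)"
  unfolding blockL_def blockR_def map_mat_mone(1)[symmetric]
  by (rule map_block_mat, simp add: ten.tens1_ide elements_ob[OF _ assms] elements_ob_mone)+

lemma map_mat_block':
  assumes "\<alpha> \<in> mats (ar_semiring C)"
  shows "map_mat (dm C) (blockL (ar_semiring C) n \<alpha>) = blockL (ob_semiring C) n (map_mat (dm C) \<alpha>)"
    "map_mat (dm C) (blockR (ar_semiring C) n \<alpha>) = blockR (ob_semiring C) n (map_mat (dm C) \<alpha>)"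
    "map_mat (cd C) (blockL (ar_semiring C) n \<alpha>) = blockL (ob_semiring C) n (map_mat (cd C) \<alpha>)"
    "map_mat (cd C) (blockR (ar_semiring C) n \<alpha>) = blockR (ob_semiring C) n (map_mat (cd C) \<alpha>)"
  unfolding blockL_def blockR_def
  subgoal unfolding map_mat_mone(2)[symmetric]
    by (rule map_block_mat) (simp add: arrow_simps elements_ar[OF _ assms] elements_ar_mone)
  subgoal unfolding map_mat_mone(2)[symmetric]
    by (rule map_block_mat) (simp add: arrow_simps elements_ar[OF _ assms] elements_ar_mone)
  subgoal unfolding map_mat_mone(3)[symmetric]
    by (rule map_block_mat) (simp add: arrow_simps elements_ar[OF _ assms] elements_ar_mone)
  subgoal unfolding map_mat_mone(3)[symmetric]
    by (rule map_block_mat) (simp add: arrow_simps elements_ar[OF _ assms] elements_ar_mone)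
  done

lemma zeta_closed:
  assumes "A \<in> mats (ob_semiring C)" "B \<in> mats (ob_semiring C)"
  shows "block_mat (zeta C) A B \<in> mats (ar_semiring C)"
    "block_mat (\<lambda>a b. zeta C b a) A B \<in> mats (ar_semiring C)"
  using assms by (auto simp: mats_iff index_div_mod_less intro!: ten.sym_closed)

lemma zeta_inverse:
  assumes "A \<in> mats (ob_semiring C)" "B \<in> mats (ob_semiring C)"
  shows "inverse2 (Mat C) (block_mat (zeta C) A B) (block_mat (\<lambda>a b. zeta C b a) A B)"
  using assms assms[unfolded mats_iff, rule_format] zeta_closed[OF assms]
  by (auto simp: inverse2_def index_div_mod_less arrow_simps zeta_zeta intro!: eq_matI)

lemma vcomp_blockL:
  assumes "\<alpha> \<in> mats (ar_semiring C)" "\<beta> \<in> mats (ar_semiring C)" "map_mat (dm C) \<beta> = map_mat (cd C) \<alpha>"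
  shows "blockL (ar_semiring C) n (vcomp (Mat C) \<beta> \<alpha>)
    = vcomp (Mat C) (blockL (ar_semiring C) n \<beta>) (blockL (ar_semiring C) n \<alpha>)"
    "blockR (ar_semiring C) n (vcomp (Mat C) \<beta> \<alpha>)
    = vcomp (Mat C) (blockR (ar_semiring C) n \<beta>) (blockR (ar_semiring C) n \<alpha>)"
proof -
  have idem: "cmp C (ide C (zer C)) (ide C (zer C)) = ide C (zer C)" "cmp C (ide C (uni C)) (ide C (uni C)) = ide C (uni C)"
    using sum.cmp_ide_left[of "ide C (zer C)"] sum.cmp_ide_left[of "ide C (uni C)"] by (simp_all add: arrow_simps)
  note D = map_mat_eqD[OF assms(3)]
  note car = assms(1,2)[unfolded mats_iff, rule_format]
  have "mul1 C (cmp C (\<beta> $$ (i, j)) (\<alpha> $$ (i, j))) d = cmp C (mul1 C (\<beta> $$ (i, j)) d) (mul1 C (\<alpha> $$ (i, j)) d)"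
    "mul1 C d (cmp C (\<beta> $$ (i, j)) (\<alpha> $$ (i, j))) = cmp C (mul1 C d (\<beta> $$ (i, j))) (mul1 C d (\<alpha> $$ (i, j)))"
    if "i < dim_row \<alpha>" "j < dim_col \<alpha>" "d = ide C (uni C) \<or> d = ide C (zer C)" for i j d
    using that car D ten.tens1_cmp[of "\<alpha> $$ (i, j)" "\<beta> $$ (i, j)" d d] ten.tens1_cmp[of d d "\<alpha> $$ (i, j)" "\<beta> $$ (i, j)"]
    by (auto simp: idem arrow_simps)
  then show "blockL (ar_semiring C) n (vcomp (Mat C) \<beta> \<alpha>)
    = vcomp (Mat C) (blockL (ar_semiring C) n \<beta>) (blockL (ar_semiring C) n \<alpha>)"
    "blockR (ar_semiring C) n (vcomp (Mat C) \<beta> \<alpha>)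
    = vcomp (Mat C) (blockR (ar_semiring C) n \<beta>) (blockR (ar_semiring C) n \<alpha>)"
    using D by (auto intro!: eq_matI simp: index_div_mod_less)
qed

lemma two_functor_Lf: "two_functor (Mat C) (Mat C) (Lf n)"
  by (intro two_functor.intro two_functor_axioms.intro two_category_Mat)
    (simp_all add: ob.blockL_closed ar.blockL_closed map_mat_block map_mat_block' ob.blockL_mone
      ob.mprod_blockL_blockL ar.mprod_blockL_blockL vcomp_blockL)

lemma two_functor_Rf: "two_functor (Mat C) (Mat C) (Rf n)"
  by (intro two_functor.intro two_functor_axioms.intro two_category_Mat)
    (simp_all add: ob.blockR_closed ar.blockR_closed map_mat_block map_mat_block' ob.blockR_mone
      ob.mprod_blockR_blockR ar.mprod_blockR_blockR vcomp_blockL)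

lemma map_mat_zeta:
  assumes "A \<in> mats (ob_semiring C)" "B \<in> mats (ob_semiring C)"
  shows "map_mat (dm C) (block_mat (zeta C) A B)
      = mprod (ob_semiring C) (blockL (ob_semiring C) (dim_row B) A) (blockR (ob_semiring C) (dim_col A) B)"
    "map_mat (cd C) (block_mat (zeta C) A B)
      = mprod (ob_semiring C) (blockR (ob_semiring C) (dim_row A) B) (blockL (ob_semiring C) (dim_col B) A)"
  using assms assms[unfolded mats_iff, rule_format]
  by (auto simp: ob.mprod_blockL_blockR ob.mprod_blockR_blockL index_div_mod_less arrow_simps intro!: eq_matI)

lemma gray_data_Mat: "gray_data (Mat C) (Mat C) (Mat C) Lf Rf (block_mat (zeta C))"
  by (intro gray_data.intro gray_data_axioms.intro two_category_pair.intro two_category_Mat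
      two_functor_Lf two_functor_Rf)
    (use zeta_inverse in \<open>auto simp: map_mat_zeta\<close>)

end

context strict_symmetric_bimonoidal_category begin

lemma zeta_natural:
  assumes "\<alpha> \<in> mats (ar_semiring C)" "\<beta> \<in> mats (ar_semiring C)"
  shows "vcomp (Mat C) (block_mat (\<lambda>a b. mul1 C b a) \<alpha> \<beta>) (block_mat (zeta C) (map_mat (dm C) \<alpha>) (map_mat (dm C) \<beta>))
    = vcomp (Mat C) (block_mat (zeta C) (map_mat (cd C) \<alpha>) (map_mat (cd C) \<beta>)) (block_mat (mul1 C) \<alpha> \<beta>)"
  using assms[unfolded mats_iff, rule_format]
  by (auto intro!: eq_matI simp: index_div_mod_less ten.sym_natural)

lemma zeta_mone:
  assumes "A \<in> mats (ob_semiring C)"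
  shows "block_mat (zeta C) (mone (ob_semiring C) n) A = map_mat (ide C) (blockR (ob_semiring C) n A)"
    "block_mat (zeta C) A (mone (ob_semiring C) n) = map_mat (ide C) (blockL (ob_semiring C) n A)"
proof -
  note car = assms[unfolded mats_iff, rule_format]
  show "block_mat (zeta C) (mone (ob_semiring C) n) A = map_mat (ide C) (blockR (ob_semiring C) n A)"
    using car by (intro eq_matI) (auto simp: index_div_mod_less uni_zeta zer_zeta ten.tens0_e_left zer_mul0)
  show "block_mat (zeta C) A (mone (ob_semiring C) n) = map_mat (ide C) (blockL (ob_semiring C) n A)"
    using car by (intro eq_matI) (auto simp: index_div_mod_less ten.sym_e zeta_zer ten.tens0_e_right mul0_zer)
qed

text \<open>Both products on the right-hand side are sums over the middle index of \<open>F'\<close> and \<open>F\<close>.  Their composite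
  is the sum of the composites, and each summand is an instance of the hexagon.\<close>

lemma zeta_mprod_left:
  assumes "F \<in> mats (ob_semiring C)" "F' \<in> mats (ob_semiring C)" "dim_col F' = dim_row F" "G \<in> mats (ob_semiring C)"
  shows "block_mat (zeta C) (mprod (ob_semiring C) F' F) G = vcomp (Mat C)
    (mprod (ar_semiring C) (block_mat (zeta C) F' G) (map_mat (ide C) (blockL (ob_semiring C) (dim_col G) F)))
    (mprod (ar_semiring C) (map_mat (ide C) (blockL (ob_semiring C) (dim_row G) F')) (block_mat (zeta C) F G))"
    (is "?lhs = vcomp (Mat C) ?X ?Y")
proof (rule eq_matI)
  let ?R = "ar_semiring C"
  fix r c assume "r < dim_row (vcomp (Mat C) ?X ?Y)" "c < dim_col (vcomp (Mat C) ?X ?Y)"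
  then have r: "r < dim_row F' * dim_row G" and c: "c < dim_col F * dim_col G" by simp_all
  note rc = index_div_mod_less[OF r] index_div_mod_less[OF c]
  note car = assms(1,2,4)[unfolded mats_iff, rule_format, simplified]
  define f where "f j = F $$ (j, c div dim_col G)" for j
  define f' where "f' j = F' $$ (r div dim_row G, j)" for j
  define g where "g = G $$ (r mod dim_row G, c mod dim_col G)"
  have cl: "f j \<in> Ob C" "f' j \<in> Ob C" "g \<in> Ob C" if "j < dim_row F" for j
    using car that rc assms(3) by (auto simp: f_def f'_def g_def)
  have X: "?X $$ (r, c) = finsum ?R (\<lambda>j. mul1 C (zeta C (f' j) g) (ide C (f j))) {..<dim_row F}"
    unfolding map_mat_block(1)[OF assms(1)] using r c rc assms cl
    by (subst ar.index_mprod_blockL_right)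
      (auto simp: zeta_closed map_mat_closed pair_index_less f_def f'_def g_def arrow_simps intro!: ar.finsum_cong')
  have Y: "?Y $$ (r, c) = finsum ?R (\<lambda>j. mul1 C (ide C (f' j)) (zeta C (f j) g)) {..<dim_row F}"
    unfolding map_mat_block(1)[OF assms(2)] using r c rc assms cl
    by (subst ar.index_mprod_blockL_left)
      (auto simp: zeta_closed map_mat_closed pair_index_less f_def f'_def g_def arrow_simps intro!: ar.finsum_cong')
  have "?lhs $$ (r, c) = zeta C (finsum (ob_semiring C) (\<lambda>j. mul0 C (f' j) (f j)) {..<dim_row F}) g"
    using r c rc assms by (simp add: ob.index_mprod f_def f'_def g_def)
  also have "\<dots> = finsum ?R (\<lambda>j. zeta C (mul0 C (f' j) (f j)) g) {..<dim_row F}"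
    using cl car rc by (intro zeta_finsum_left) (auto simp: g_def arrow_simps)
  also have "\<dots> = finsum ?R (\<lambda>j. cmp C (mul1 C (zeta C (f' j) g) (ide C (f j))) (mul1 C (ide C (f' j)) (zeta C (f j) g))) {..<dim_row F}"
    using cl by (intro ar.finsum_cong') (auto simp: zeta_mul_left arrow_simps ten.tens0_assoc)
  also have "\<dots> = cmp C (?X $$ (r, c)) (?Y $$ (r, c))"
    unfolding X Y using cl by (intro cmp_finsum) (auto simp: arrow_simps ten.tens0_assoc)
  finally show "?lhs $$ (r, c) = vcomp (Mat C) ?X ?Y $$ (r, c)" using r c by simp
qed simp_all

lemma zeta_mprod_right:
  assumes "F \<in> mats (ob_semiring C)" "G \<in> mats (ob_semiring C)" "G' \<in> mats (ob_semiring C)" "dim_col G' = dim_row G"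
  shows "block_mat (zeta C) F (mprod (ob_semiring C) G' G) = vcomp (Mat C)
    (mprod (ar_semiring C) (map_mat (ide C) (blockR (ob_semiring C) (dim_row F) G')) (block_mat (zeta C) F G))
    (mprod (ar_semiring C) (block_mat (zeta C) F G') (map_mat (ide C) (blockR (ob_semiring C) (dim_col F) G)))"
    (is "?lhs = vcomp (Mat C) ?X ?Y")
proof (rule eq_matI)
  let ?R = "ar_semiring C"
  fix r c assume "r < dim_row (vcomp (Mat C) ?X ?Y)" "c < dim_col (vcomp (Mat C) ?X ?Y)"
  then have r: "r < dim_row F * dim_row G'" and c: "c < dim_col F * dim_col G" by simp_all
  note rc = index_div_mod_less[OF r] index_div_mod_less[OF c]
  note car = assms(1-3)[unfolded mats_iff, rule_format, simplified]
  define f where "f = F $$ (r div dim_row G', c div dim_col G)"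
  define g where "g l = G $$ (l, c mod dim_col G)" for l
  define g' where "g' l = G' $$ (r mod dim_row G', l)" for l
  have cl: "g l \<in> Ob C" "g' l \<in> Ob C" "f \<in> Ob C" if "l < dim_row G" for l
    using car that rc assms(4) by (auto simp: f_def g_def g'_def)
  have X: "?X $$ (r, c) = finsum ?R (\<lambda>l. mul1 C (ide C (g' l)) (zeta C f (g l))) {..<dim_row G}"
    unfolding map_mat_block(2)[OF assms(3)] using r c rc assms cl
    by (subst ar.index_mprod_blockR_left)
      (auto simp: zeta_closed map_mat_closed pair_index_less f_def g_def g'_def arrow_simps intro!: ar.finsum_cong')
  have Y: "?Y $$ (r, c) = finsum ?R (\<lambda>l. mul1 C (zeta C f (g' l)) (ide C (g l))) {..<dim_row G}"
    unfolding map_mat_block(2)[OF assms(2)] using r c rc assms cl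
    by (subst ar.index_mprod_blockR_right)
      (auto simp: zeta_closed map_mat_closed pair_index_less f_def g_def g'_def arrow_simps intro!: ar.finsum_cong')
  have "?lhs $$ (r, c) = zeta C f (finsum (ob_semiring C) (\<lambda>l. mul0 C (g' l) (g l)) {..<dim_row G})"
    using r c rc assms by (simp add: ob.index_mprod f_def g_def g'_def)
  also have "\<dots> = finsum ?R (\<lambda>l. zeta C f (mul0 C (g' l) (g l))) {..<dim_row G}"
    using cl car rc by (intro zeta_finsum_right) (auto simp: f_def arrow_simps)
  also have "\<dots> = finsum ?R (\<lambda>l. cmp C (mul1 C (ide C (g' l)) (zeta C f (g l))) (mul1 C (zeta C f (g' l)) (ide C (g l)))) {..<dim_row G}"
    using cl by (intro ar.finsum_cong') (auto simp: ten.sym_hexagon arrow_simps ten.tens0_assoc)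
  also have "\<dots> = cmp C (?X $$ (r, c)) (?Y $$ (r, c))"
    unfolding X Y using cl by (intro cmp_finsum) (auto simp: arrow_simps ten.tens0_assoc)
  finally show "?lhs $$ (r, c) = vcomp (Mat C) ?X ?Y $$ (r, c)" using r c by simp
qed simp_all

lemma gray_cocycle_Mat: "gray_cocycle (Mat C) (Mat C) (Mat C) Lf Rf (block_mat (zeta C))"
proof (intro gray_cocycle.intro gray_data_Mat gray_cocycle_axioms.intro, goal_cases)
  case (1 \<alpha> G)
  then have G: "map_mat (ide C) G \<in> mats (ar_semiring C)" by (simp add: map_mat_closed)
  then show ?case
    using 1 zeta_natural[OF _ G, of \<alpha>] ar.mprod_blockR_blockL[OF _ G, of \<alpha>] ar.mprod_blockL_blockR[OF _ G, of \<alpha>]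
    by (simp add: map_mat_block map_mat_ide)
next
  case (2 F \<beta>)
  then have F: "map_mat (ide C) F \<in> mats (ar_semiring C)" by (simp add: map_mat_closed)
  then show ?case
    using 2 zeta_natural[OF F, of \<beta>] ar.mprod_blockR_blockL[OF F, of \<beta>] ar.mprod_blockL_blockR[OF F, of \<beta>]
    by (simp add: map_mat_block map_mat_ide)
next
  case 3 then show ?case by (simp add: zeta_mone)
next
  case 4 then show ?case by (simp add: zeta_mone)
next
  case 5 then show ?case by (simp add: zeta_mprod_left)
next
  case 6 then show ?case by (simp add: zeta_mprod_right)
qed

text \<open>In each case one of the three factors is an entry of an identity matrix.  If it is \<open>1\<close>, both sides agree
  by the unit laws; if it is \<open>0\<close>, both are the identity of \<open>0\<close>.\<close>

lemma zeta_block: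
  assumes "A \<in> mats (ob_semiring C)" "B \<in> mats (ob_semiring C)"
  shows "block_mat (zeta C) (blockL (ob_semiring C) n A) B = block_mat (zeta C) A (blockR (ob_semiring C) n B)"
    "block_mat (zeta C) (blockR (ob_semiring C) n A) B = blockR (ar_semiring C) n (block_mat (zeta C) A B)"
    "blockL (ar_semiring C) n (block_mat (zeta C) A B) = block_mat (zeta C) A (blockL (ob_semiring C) n B)"
proof -
  have id: "map_mat (\<lambda>x. x) M = M" for M :: "'o mat" by (rule eq_matI) auto
  note el = elements_ob[OF _ assms(1)] elements_ob[OF _ assms(2)]
  note z = ten.tens0_e_left ten.tens0_e_right zer_mul0 mul0_zer uni_zeta zer_zeta ten.sym_e zeta_zer
    ten.tens1_e_left ten.tens1_e_right zer_mul1 mul1_zer arrow_simps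
  show "block_mat (zeta C) (blockL (ob_semiring C) n A) B = block_mat (zeta C) A (blockR (ob_semiring C) n B)"
    unfolding blockL_def blockR_def
    by (rule block_mat_assoc) (auto dest!: elements_mone el simp: z)
  have "block_mat (zeta C) (block_mat (mul0 C) (mone (ob_semiring C) n) A) (map_mat (\<lambda>x. x) B)
      = block_mat (mul1 C) (map_mat (ide C) (mone (ob_semiring C) n)) (block_mat (zeta C) A B)"
    by (rule block_mat_assoc_map) (auto dest!: elements_mone el simp: z)
  then show "block_mat (zeta C) (blockR (ob_semiring C) n A) B = blockR (ar_semiring C) n (block_mat (zeta C) A B)"
    by (simp add: blockR_def id map_mat_mone)
  have "block_mat (mul1 C) (block_mat (zeta C) A B) (map_mat (ide C) (mone (ob_semiring C) n))
      = block_mat (zeta C) (map_mat (\<lambda>x. x) A) (block_mat (mul0 C) B (mone (ob_semiring C) n))"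
    by (rule block_mat_assoc_map) (auto dest!: elements_mone el simp: z)
  then show "blockL (ar_semiring C) n (block_mat (zeta C) A B) = block_mat (zeta C) A (blockL (ob_semiring C) n B)"
    by (simp add: blockL_def id map_mat_mone)
qed

lemma cubical_monoid_Mat: "cubical_monoid (Mat C) Lf Rf (block_mat (zeta C)) 1"
  by (intro cubical_monoid.intro gray_cocycle_Mat cubical_monoid_axioms.intro)
    (simp_all add: ob.blockL_blockL ar.blockL_blockL ob.blockL_blockR ar.blockL_blockR
      ob.blockR_blockR ar.blockR_blockR zeta_block ob.blockL_1[simplified] ob.blockR_1[simplified]
      ar.blockL_1[simplified] ar.blockR_1[simplified])

lemma mswap_blockL:
  assumes "semiring R" "A \<in> mats R"
  shows "mprod R (mswap R (dim_row A) n) (blockL R n A) = mprod R (blockR R n A) (mswap R (dim_col A) n)"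
proof -
  interpret R: semiring R by fact
  have "block_mat (\<lambda>b a. mult R a b) (mone R n) A = blockR R n A"
    unfolding blockR_def
    by (rule block_mat_cong) (use mats_elements[OF assms(2)] in \<open>auto dest!: elements_mone\<close>)
  then show ?thesis
    using R.mswap_natural[of "mult R" A "mone R n"] R.blockL_closed[OF assms(2), of n] R.blockR_closed[OF assms(2), of n]
    by (simp add: blockL_def)
qed

lemma symmetric_cubical_monoid_Mat:
  "symmetric_cubical_monoid (Mat C) Lf Rf (block_mat (zeta C)) 1 (Mat_sym C)"
proof (intro symmetric_cubical_monoid.intro cubical_monoid_Mat symmetric_cubical_monoid_axioms.intro, goal_cases)
  case (7 F G)
  then have FG: "F \<in> mats (ob_semiring C)" "G \<in> mats (ob_semiring C)" by simp_all
  have "inv2 (Mat C) (block_mat (zeta C) G F) = block_mat (\<lambda>a b. zeta C b a) G F"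
    by (intro two_category.inv2_eq[OF two_category_Mat] zeta_inverse FG)
  then show ?case
    using ar.mswap_natural[OF zeta_closed(1)[OF FG] zeta_closed(2)[OF FG(2,1)]]
    by (simp add: Mat_sym_eq_mswap map_mat_mswap)
qed (simp_all add: Mat_sym_eq_mswap map_mat_mswap ob.mswap_closed ob.mswap_mswap ob.mswap_1[simplified]
    ob.mswap_hexagon mswap_blockL[OF ob.semiring_axioms] mswap_blockL[OF ar.semiring_axioms] mult.commute)

end

theorem theoremI9p3p16:
  fixes C :: "('o, 'a) bimon_cat"
  assumes "strict_symmetric_bimonoidal_category C"
  shows "permutative_gray_monoid (Mat C) (Mat_mult C) 1 (Mat_sym C)"
proof -
  interpret strict_symmetric_bimonoidal_category C by fact
  interpret symmetric_cubical_monoid "Mat C" Lf Rf "block_mat (zeta C)" 1 "Mat_sym C"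
    by (rule symmetric_cubical_monoid_Mat)
  show ?thesis unfolding Mat_mult_eq by (rule permutative_gray_monoid)
qed

end
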